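(* Let $n\ge 1$ and let $\mathcal{A}=\{H_1,\dots,H_n\}$ be a generic central hyperplane arrangement in $\mathbb{C}^3$ consisting of $n$ hyperplanes, and let $\partial\overline{F}$ be its Milnor fiber boundary. Then \[ H_1(\partial\overline{F};\mathbb{Z})\cong \mathbb{Z}^{n(n-1)/2}\oplus \mathbb{Z}_n^{(n-2)(n-3)/2}. \]
   Context: A central hyperplane arrangement in $\mathbb{C}^3$ is a finite set $\mathcal{A}=\{H_1,\dots,H_n\}$ of linear (through the origin) hyperplanes. Let $L_2(\mathcal{A})$ be the set of nonempty intersections of hyperplanes of $\mathcal{A}$ having codimension $2$, and for $X\in L_2(\mathcal{A})$ let $\mathcal{A}_X=\{H\in\mathcal{A}: H\supset X\}$. The arrangement is called generic if $|\mathcal{A}_X|=2$ for every $X\in L_2(\mathcal{A})$. Let $\alpha_i$ be a linear form defining $H_i$ and $Q=\prod_{i=1}^n\alpha_i:\mathbb{C}^3\to\mathbb{C}$. The Milnor fiber is $F=Q^{-1}(1)$; for a sufficiently large closed ball $B^6\subset\mathbb{C}^3$ centered at the origin, the Milnor fiber boundary is the smooth closed $3$-manifold $\partial\overline{F}=F\cap\partial B^6$. Here $\mathbb{Z}_n$ denotes $\mathbb{Z}/n\mathbb{Z}$. *)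

theory Defs
  imports "HOL-Analysis.Analysis" "HOL-Homology.Homology"
    "HOL-Algebra.Elementary_Groups" "HOL-Algebra.Product_Groups"
begin

definition lform :: "complex^3 \<Rightarrow> complex^3 \<Rightarrow> complex" where
  "lform a x = (\<Sum>j\<in>UNIV. a$j * x$j)"

definition hyp :: "complex^3 \<Rightarrow> (complex^3) set" where
  "hyp a = {x. lform a x = 0}"

definition central_arrangement :: "nat \<Rightarrow> (nat \<Rightarrow> complex^3) \<Rightarrow> bool" where
  "central_arrangement n a \<longleftrightarrow>
     (\<forall>i<n. a i \<noteq> 0) \<and> (\<forall>i<n. \<forall>j<n. i \<noteq> j \<longrightarrow> hyp (a i) \<noteq> hyp (a j))"

text \<open>Nonempty intersections of hyperplanes having complex codimension 2 in C^3,
  i.e. complex dimension 1, i.e. real dimension 2.\<close>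
definition L2 :: "nat \<Rightarrow> (nat \<Rightarrow> complex^3) \<Rightarrow> (complex^3) set set" where
  "L2 n a = {X. \<exists>S. S \<subseteq> {..<n} \<and> S \<noteq> {} \<and> X = (\<Inter>i\<in>S. hyp (a i)) \<and> dim X = 2}"

definition generic_arrangement :: "nat \<Rightarrow> (nat \<Rightarrow> complex^3) \<Rightarrow> bool" where
  "generic_arrangement n a \<longleftrightarrow>
     (\<forall>X\<in>L2 n a. card {i. i < n \<and> X \<subseteq> hyp (a i)} = 2)"

definition milnor_fiber :: "nat \<Rightarrow> (nat \<Rightarrow> complex^3) \<Rightarrow> (complex^3) set" where
  "milnor_fiber n a = {x. (\<Prod>i<n. lform (a i) x) = 1}"

definition milnor_fiber_boundary :: "nat \<Rightarrow> (nat \<Rightarrow> complex^3) \<Rightarrow> real \<Rightarrow> (complex^3) set" where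
  "milnor_fiber_boundary n a R = milnor_fiber n a \<inter> sphere 0 R"

definition Zsum_group :: "nat \<Rightarrow> nat \<Rightarrow> nat \<Rightarrow> (nat \<Rightarrow> int) monoid" where
  "Zsum_group r m s = product_group {0..<r+s}
      (\<lambda>i. if i < r then integer_group else integer_mod_group m)"

end

theory Submission
  imports Defs
begin

text \<open>
  Radial scaling identifies the Milnor fiber boundary of radius \<open>R\<close> up to homotopy with the cone
  \<open>X = {y \<noteq> 0. \<Prod>\<alpha>\<^sub>i y = \<delta> |y|^n}\<close>, \<open>\<delta> = R^-n\<close>. For small \<open>\<delta>\<close> a point of \<open>X\<close> lies close to some
  hyperplane \<open>H\<^sub>i\<close>, and by genericity close to at most two. So \<open>X\<close> is covered by open cores \<open>A\<^sub>i\<close>, where only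
  \<open>\<alpha>\<^sub>i\<close> is small, and open necks \<open>B\<^sub>i\<^sub>j\<close>, where \<open>\<alpha>\<^sub>i\<close> and \<open>\<alpha>\<^sub>j\<close> are small. Solving the equation for \<open>\<alpha>\<^sub>i\<close> by a
  contraction shows that \<open>A\<^sub>i\<close> is the complement in \<open>H\<^sub>i\<close> of tubes about the lines \<open>H\<^sub>i \<inter> H\<^sub>j\<close>, and that \<open>B\<^sub>i\<^sub>j\<close> and
  \<open>A\<^sub>i \<inter> B\<^sub>i\<^sub>j\<close> are thickened tori. In all of these pieces a 1-cycle bounds as soon as its winding numbers
  under the \<open>\<alpha>\<^sub>k\<close> and under a linear form \<open>\<gamma>\<^sub>i\<^sub>j\<close> completing \<open>\<alpha>\<^sub>i, \<alpha>\<^sub>j\<close> to a basis vanish.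

  Mayer-Vietoris then yields the homology: the nerve is the complete graph on \<open>n\<close> vertices, whose triangles
  \<open>0, j, k\<close> contribute a free summand of rank \<open>(n-1)(n-2)/2\<close>, and the meridians \<open>\<mu>\<^sub>i\<^sub>j\<close> generate the rest,
  subject to the relations \<open>x\<^sub>i\<^sub>j = P\<^sub>i - P\<^sub>j - n P\<^sub>i\<^sub>j\<close> for skew-symmetric integer matrices \<open>P\<close> with row sums \<open>P\<^sub>i\<close>.
  The row sums of \<open>x\<close> and its sums around the triangles \<open>1, j, k\<close> modulo \<open>n\<close> identify this quotient with
  \<open>\<int>^(n-1) \<oplus> \<int>\<^sub>n^((n-2)(n-3)/2)\<close>.
\<close>

section \<open>Chains and winding numbers\<close>

text \<open>The contraction charts do not identify the cores and necks with model spaces; they only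
  squeeze them between models with slightly different constants. No homology group of a piece is
  therefore computed. It is enough that a cycle of a piece with vanishing windings bounds in the
  whole cone, that prescribed windings are realised where a core meets a neck, and that base points
  can be joined; these requirements make up the locale \<open>neck_decomposition\<close>. The factor
  \<open>n\<close> in the relations has this origin. The product of all \<alpha>_k is a positive
  real on the cone, so the windings of a cycle add up to 0. In the neck of i and j the other n - 2
  forms wind like \<gamma>_ij; a loop there with \<gamma>-winding P_ij and \<alpha>_j-winding 0 has
  \<alpha>_i-winding -(n - 2) P_ij, which is one of its coordinates in core j. Two more copies of
  P_ij come from the ends of the neck. The term |y|^n makes the equation of the cone homogeneous, so
  every estimate can be made at normalised points, with one set of constants for all small
  \<delta>.\<close>

definition frag_eval :: "('b \<Rightarrow> 'c::comm_ring_1) \<Rightarrow> ('b \<Rightarrow>\<^sub>0 int) \<Rightarrow> 'c"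
  where "frag_eval h x = (\<Sum>i\<in>Poly_Mapping.keys x. of_int (Poly_Mapping.lookup x i) * h i)"

lemma frag_eval_superset:
  assumes "finite K" "Poly_Mapping.keys x \<subseteq> K"
  shows "frag_eval h x = (\<Sum>i\<in>K. of_int (Poly_Mapping.lookup x i) * h i)"
  unfolding frag_eval_def using assms
  by (intro sum.mono_neutral_left) (auto simp: in_keys_iff)

lemma frag_eval_0 [simp]: "frag_eval h 0 = 0"
  by (simp add: frag_eval_def)

lemma frag_eval_of [simp]: "frag_eval h (frag_of a) = h a"
  by (simp add: frag_eval_def)

lemma frag_eval_add [simp]: "frag_eval h (x + y) = frag_eval h x + frag_eval h y"
proof -
  let ?K = "Poly_Mapping.keys x \<union> Poly_Mapping.keys y"
  have "Poly_Mapping.keys (x + y) \<subseteq> ?K"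
    by (rule Poly_Mapping.keys_add)
  then show ?thesis
    by (simp add: frag_eval_superset [of ?K] lookup_add distrib_right sum.distrib)
qed

lemma frag_eval_minus [simp]: "frag_eval h (- x) = - frag_eval h x"
  using frag_eval_add [of h x "-x"] by (simp add: eq_neg_iff_add_eq_0 add.commute)

lemma frag_eval_diff [simp]: "frag_eval h (x - y) = frag_eval h x - frag_eval h y"
  using frag_eval_add [of h x "-y"] by simp

lemma frag_eval_cmul [simp]: "frag_eval h (frag_cmul k x) = of_int k * frag_eval h x"
proof -
  have "Poly_Mapping.keys (frag_cmul k x) \<subseteq> Poly_Mapping.keys x"
    by (rule keys_cmul)
  then show ?thesis
    by (simp add: frag_eval_superset [of "Poly_Mapping.keys x"] sum_distrib_left mult.assoc)
qed

lemma frag_eval_sum: "frag_eval h (sum f I) = (\<Sum>i\<in>I. frag_eval h (f i))"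
  by (induction I rule: infinite_finite_induct) auto

lemma frag_eval_cong:
  "(\<And>i. i \<in> Poly_Mapping.keys x \<Longrightarrow> h i = h' i) \<Longrightarrow> frag_eval h x = frag_eval h' x"
  by (simp add: frag_eval_def)

lemma frag_eval_fun_add: "frag_eval (\<lambda>i. h i + h' i) x = frag_eval h x + frag_eval h' x"
  by (simp add: frag_eval_def distrib_left sum.distrib)

lemma frag_eval_extend: "frag_eval h (frag_extend b x) = frag_eval (\<lambda>i. frag_eval h (b i)) x"
proof -
  have "frag_eval h (frag_extend b x)
      = (\<Sum>i\<in>Poly_Mapping.keys x. of_int (Poly_Mapping.lookup x i) * frag_eval h (b i))"
    unfolding frag_extend_def frag_eval_sum by simp
  then show ?thesis
    by (simp add: frag_eval_def)
qed

section \<open>Singular chains, cycles and boundaries in subsets\<close>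

abbreviation chain_in :: "nat \<Rightarrow> 'a::topological_space set \<Rightarrow> 'a chain \<Rightarrow> bool"
  where "chain_in p S \<equiv> singular_chain p (top_of_set S)"

abbreviation cycle_in :: "nat \<Rightarrow> 'a::topological_space set \<Rightarrow> 'a chain \<Rightarrow> bool"
  where "cycle_in p S \<equiv> singular_relcycle p (top_of_set S) {}"

abbreviation bounds_in :: "nat \<Rightarrow> 'a::topological_space set \<Rightarrow> 'a chain \<Rightarrow> bool"
  where "bounds_in p S \<equiv> singular_relboundary p (top_of_set S) {}"

lemma cycle_in_imp_chain_in: "cycle_in p S c \<Longrightarrow> chain_in p S c"
  by (simp add: singular_cycle)

lemma bounds_in_imp_cycle_in: "bounds_in p S c \<Longrightarrow> cycle_in p S c"
  by (rule singular_relboundary_imp_relcycle)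

lemma chain_in_mono: "chain_in p S c \<Longrightarrow> S \<subseteq> T \<Longrightarrow> chain_in p T c"
  by (rule singular_chain_mono)

lemma cycle_in_mono: "cycle_in p S c \<Longrightarrow> S \<subseteq> T \<Longrightarrow> cycle_in p T c"
  by (rule singular_cycle_mono)

lemma bounds_in_mono: "bounds_in p S c \<Longrightarrow> S \<subseteq> T \<Longrightarrow> bounds_in p T c"
  by (rule singular_boundary_mono)

lemma bounds_in_boundary: "chain_in (Suc p) S d \<Longrightarrow> bounds_in p S (chain_boundary (Suc p) d)"
  by (auto simp: singular_boundary)

lemma singular_simplex_top_of_set:
  "singular_simplex p (top_of_set S) f \<longleftrightarrow>
     continuous_on (standard_simplex p) f \<and> f ` standard_simplex p \<subseteq> S \<and> f \<in> extensional (standard_simplex p)"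
  by (auto simp: singular_simplex_def euclidean_product_topology continuous_map_in_subtopology)

lemma chain_in_iff:
  "chain_in p S c \<longleftrightarrow> (\<forall>f\<in>Poly_Mapping.keys c. continuous_on (standard_simplex p) f \<and>
      f ` standard_simplex p \<subseteq> S \<and> f \<in> extensional (standard_simplex p))"
  unfolding singular_chain_def subset_eq mem_Collect_eq singular_simplex_top_of_set ..

lemma chain_in_Int: "chain_in p S c \<Longrightarrow> chain_in p T c \<Longrightarrow> chain_in p (S \<inter> T) c"
  unfolding chain_in_iff by blast

lemma cycle_in_Int: "cycle_in p S c \<Longrightarrow> chain_in p T c \<Longrightarrow> cycle_in p (S \<inter> T) c"
  by (simp add: singular_cycle chain_in_Int)

lemma cycle_map_in:
  assumes "cycle_in p S c" "continuous_on S g" "g ` S \<subseteq> T"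
  shows "cycle_in p T (chain_map p g c)"
  using assms by (intro singular_relcycle_chain_map) (auto simp: image_subset_iff_funcset)

lemma bounds_map_in:
  assumes "bounds_in p S c" "continuous_on S g" "g ` S \<subseteq> T"
  shows "bounds_in p T (chain_map p g c)"
  using assms by (intro singular_relboundary_chain_map) (auto simp: image_subset_iff_funcset)

section \<open>Parametrised edges and triangles\<close>

definition edge :: "real \<Rightarrow> nat \<Rightarrow> real"
  where "edge t = (\<lambda>i. if i = 0 then 1 - t else if i = 1 then t else 0)"

definition tri_param :: "real \<times> real \<Rightarrow> nat \<Rightarrow> real"
  where "tri_param = (\<lambda>(s,t) i. if i = 0 then 1 - s - t else if i = 1 then s else if i = 2 then t else 0)"

abbreviation vertex :: "nat \<Rightarrow> real"
  where "vertex \<equiv> (\<lambda>j. if j = 0 then 1 else 0)"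

lemma edge_in: "t \<in> {0..1} \<Longrightarrow> edge t \<in> standard_simplex 1"
  by (auto simp: edge_def standard_simplex_def)

lemma continuous_edge: "continuous_on T edge"
  unfolding edge_def
proof (rule continuous_on_coordinatewise_then_product)
  fix i :: nat
  consider "i = 0" | "i = 1" | "i > 1" by linarith
  then show "continuous_on T (\<lambda>x. if i = 0 then 1 - x else if i = 1 then x else 0)"
    by cases (auto intro!: continuous_intros)
qed

lemma standard_simplex_1_eq: "x \<in> standard_simplex 1 \<Longrightarrow> x = edge (x 1)"
proof -
  assume "x \<in> standard_simplex 1"
  then have "x 0 = 1 - x 1" "\<And>i. i > 1 \<Longrightarrow> x i = 0"
    by (auto simp: standard_simplex_def)
  then show ?thesis
    by (auto simp: edge_def fun_eq_iff)
qed

lemma continuous_tri_param: "continuous_on T tri_param"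
  unfolding tri_param_def case_prod_unfold
proof (rule continuous_on_coordinatewise_then_product)
  fix i :: nat
  consider "i = 0" | "i = 1" | "i = 2" | "i > 2" by linarith
  then show "continuous_on T (\<lambda>x. if i = 0 then 1 - fst x - snd x else if i = 1 then fst x
      else if i = 2 then snd x else 0)"
    by cases (auto intro!: continuous_intros)
qed

lemma tri_param_in: "s \<ge> 0 \<Longrightarrow> t \<ge> 0 \<Longrightarrow> s + t \<le> 1 \<Longrightarrow> tri_param (s,t) \<in> standard_simplex 2"
  by (auto simp: tri_param_def standard_simplex_def numeral_2_eq_2)

lemma simplical_face_edge:
  "simplical_face 0 (edge t) = tri_param (1 - t, t)"
  "simplical_face (Suc 0) (edge t) = tri_param (0, t)"
  "simplical_face 2 (edge t) = tri_param (t, 0)"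
  by (auto simp: simplical_face_def edge_def tri_param_def fun_eq_iff)

lemma singular_face_vertex:
  "singular_face (Suc 0) 0 f vertex = f (edge 1)"
  "singular_face (Suc 0) (Suc 0) f vertex = f (edge 0)"
proof -
  have "simplical_face 0 vertex = edge 1" "simplical_face (Suc 0) vertex = edge 0"
    by (auto simp: simplical_face_def edge_def fun_eq_iff)
  then show "singular_face (Suc 0) 0 f vertex = f (edge 1)"
    "singular_face (Suc 0) (Suc 0) f vertex = f (edge 0)"
    by (simp_all add: singular_face_def)
qed

lemma singular_face_edge:
  assumes "k \<le> 2" "t \<in> {0..1}"
  shows "singular_face 2 k f (edge t) = f (simplical_face k (edge t))"
  using edge_in [OF assms(2)] by (simp add: singular_face_def)

section \<open>Evaluation of 0-chains and winding numbers of 1-chains\<close>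

definition pt_eval :: "('a \<Rightarrow> 'c::comm_ring_1) \<Rightarrow> 'a chain \<Rightarrow> 'c"
  where "pt_eval h = frag_eval (\<lambda>\<tau>. h (\<tau> vertex))"

lemma pt_eval_boundary:
  "pt_eval h (chain_boundary 1 c) = frag_eval (\<lambda>\<sigma>. h (\<sigma> (edge 1)) - h (\<sigma> (edge 0))) c"
  by (simp add: pt_eval_def chain_boundary_def frag_eval_extend singular_face_vertex)

text \<open>The change of a continuous logarithm of \<open>f\<close> along a single edge, in units
  of 2 pi i. It is complex valued because an edge need not close up; integrality appears only for
  cycles. The choice of \<open>L\<close> does not matter, as two logarithms differ by a
  constant.\<close>

definition winding1 :: "('a \<Rightarrow> complex) \<Rightarrow> ((nat \<Rightarrow> real) \<Rightarrow> 'a) \<Rightarrow> complex"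
  where "winding1 f \<sigma> = (SOME d. \<exists>L. continuous_on {0..1} L \<and> (\<forall>t\<in>{0..1}. f (\<sigma> (edge t)) = exp (L t)) \<and>
           d = (L 1 - L 0) / (2 * of_real pi * \<i>))"

definition winding :: "('a \<Rightarrow> complex) \<Rightarrow> 'a chain \<Rightarrow> complex"
  where "winding f = frag_eval (winding1 f)"

text \<open>The difference of two logarithms is continuous, and its values are multiples of 2 pi i,
  hence at least 2 pi apart if distinct. So it is constant on the interval.\<close>

lemma log_difference_unique:
  assumes "continuous_on {0..1::real} L" "continuous_on {0..1} L'"
    and eq: "\<And>t. t \<in> {0..1} \<Longrightarrow> exp (L t) = exp (L' t)"
  shows "L 1 - L 0 = L' 1 - (L' 0 :: complex)"
proof -
  have "(\<lambda>t. L t - L' t) constant_on {0..1}"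
  proof (rule continuous_discrete_range_constant)
    show "continuous_on {0..1} (\<lambda>t. L t - L' t)"
      using assms by (intro continuous_intros)
    fix x :: real assume x: "x \<in> {0..1}"
    have "2 * pi \<le> norm ((L y - L' y) - (L x - L' x))"
      if y: "y \<in> {0..1}" "L y - L' y \<noteq> L x - L' x" for y
    proof -
      obtain m where m: "L x = L' x + (of_int (2 * m) * pi) * \<i>"
        using eq [OF x] unfolding exp_eq by auto
      obtain k where k: "L y = L' y + (of_int (2 * k) * pi) * \<i>"
        using eq [OF y(1)] unfolding exp_eq by auto
      have d: "(L y - L' y) - (L x - L' x) = of_real (2 * pi * of_int (k - m)) * \<i>"
        by (simp add: m k algebra_simps)
      have "k \<noteq> m"
        using d y(2) by auto
      then have "1 \<le> \<bar>real_of_int (k - m)\<bar>"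
        by linarith
      then show ?thesis
        unfolding d norm_mult norm_ii norm_of_real by (simp add: abs_mult)
    qed
    then show "\<exists>e>0. \<forall>y. y \<in> {0..1} \<and> L y - L' y \<noteq> L x - L' x \<longrightarrow> e \<le> norm (L y - L' y - (L x - L' x))"
      using pi_gt_zero by (intro exI [of _ "2*pi"]) auto
  qed auto
  then obtain k where "\<And>t. t \<in> {0..1} \<Longrightarrow> L t - L' t = k"
    unfolding constant_on_def by blast
  from this [of 0] this [of 1] have "L 0 - L' 0 = L 1 - L' 1" by simp
  then show ?thesis by (simp add: algebra_simps)
qed

lemma winding1_eq:
  assumes "continuous_on {0..1} L" "\<And>t. t \<in> {0..1} \<Longrightarrow> f (\<sigma> (edge t)) = exp (L t)"
  shows "winding1 f \<sigma> = (L 1 - L 0) / (2 * of_real pi * \<i>)"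
  unfolding winding1_def
proof (rule some_equality)
  fix d assume "\<exists>L. continuous_on {0..1} L \<and> (\<forall>t\<in>{0..1}. f (\<sigma> (edge t)) = exp (L t)) \<and>
           d = (L 1 - L 0) / (2 * of_real pi * \<i>)"
  then obtain L' where "continuous_on {0..1} L'" "\<And>t. t \<in> {0..1} \<Longrightarrow> f (\<sigma> (edge t)) = exp (L' t)"
    "d = (L' 1 - L' 0) / (2 * of_real pi * \<i>)" by blast
  with log_difference_unique [of L L'] assms show "d = (L 1 - L 0) / (2 * of_real pi * \<i>)"
    by auto
qed (use assms in blast)

lemma log_along_edge:
  assumes "continuous_on S f" "\<And>x. x \<in> S \<Longrightarrow> f x \<noteq> 0" "singular_simplex 1 (top_of_set S) \<sigma>"
  obtains L where "continuous_on {0..1} L" "\<And>t. t \<in> {0..1} \<Longrightarrow> f (\<sigma> (edge t)) = exp (L t)"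
    "winding1 f \<sigma> = (L 1 - L 0) / (2 * of_real pi * \<i>)"
proof -
  have im: "edge ` {0..1} \<subseteq> standard_simplex 1"
    using edge_in by blast
  then have "\<sigma> ` edge ` {0..1} \<subseteq> S"
    using assms(3) unfolding singular_simplex_top_of_set by blast
  then have "continuous_on {0..1} (f \<circ> \<sigma> \<circ> edge)"
    using assms im unfolding singular_simplex_top_of_set o_assoc [symmetric]
    by (intro continuous_on_compose continuous_edge) (auto intro: continuous_on_subset simp: image_comp)
  moreover have "(f \<circ> \<sigma> \<circ> edge) t \<noteq> 0" if "t \<in> {0..1}" for t
    using assms(2,3) im that unfolding singular_simplex_top_of_set by (auto simp: image_subset_iff)
  ultimately obtain L where "continuous_on {0..1} L" "\<And>t. t \<in> {0..1} \<Longrightarrow> (f \<circ> \<sigma> \<circ> edge) t = exp (L t)"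
    by (metis continuous_logarithm_on_contractible convex_imp_contractible convex_real_interval(5))
  with that winding1_eq [of L f \<sigma>] show ?thesis
    by auto
qed

lemma winding_0 [simp]: "winding f 0 = 0"
  and winding_add: "winding f (c + d) = winding f c + winding f d"
  and winding_minus: "winding f (- c) = - winding f c"
  and winding_diff: "winding f (c - d) = winding f c - winding f d"
  and winding_cmul: "winding f (frag_cmul k c) = of_int k * winding f c"
  and winding_sum: "winding f (sum g I) = (\<Sum>i\<in>I. winding f (g i))"
  by (simp_all add: winding_def frag_eval_sum)

lemma chain_in_keys: "chain_in p S c \<Longrightarrow> \<sigma> \<in> Poly_Mapping.keys c \<Longrightarrow> singular_simplex p (top_of_set S) \<sigma>"
  by (auto simp: singular_chain_def)

lemma winding_mult:
  assumes c: "chain_in 1 S c" and f: "continuous_on S f" "\<And>x. x \<in> S \<Longrightarrow> f x \<noteq> 0"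
    and g: "continuous_on S g" "\<And>x. x \<in> S \<Longrightarrow> g x \<noteq> 0"
  shows "winding (\<lambda>x. f x * g x) c = winding f c + winding g c"
  unfolding winding_def frag_eval_fun_add [symmetric]
proof (rule frag_eval_cong)
  fix \<sigma> assume "\<sigma> \<in> Poly_Mapping.keys c"
  then have \<sigma>: "singular_simplex 1 (top_of_set S) \<sigma>"
    using c by (rule chain_in_keys [rotated])
  obtain L M where L: "continuous_on {0..1} L" "\<And>t. t \<in> {0..1} \<Longrightarrow> f (\<sigma> (edge t)) = exp (L t)"
    "winding1 f \<sigma> = (L 1 - L 0) / (2 * of_real pi * \<i>)"
    and M: "continuous_on {0..1} M" "\<And>t. t \<in> {0..1} \<Longrightarrow> g (\<sigma> (edge t)) = exp (M t)"
    "winding1 g \<sigma> = (M 1 - M 0) / (2 * of_real pi * \<i>)"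
    using log_along_edge [OF f \<sigma>] log_along_edge [OF g \<sigma>] by metis
  have "winding1 (\<lambda>x. f x * g x) \<sigma> = ((L 1 + M 1) - (L 0 + M 0)) / (2 * of_real pi * \<i>)"
    using L M by (intro winding1_eq [of "\<lambda>t. L t + M t"]) (auto intro!: continuous_intros simp: exp_add)
  then show "winding1 (\<lambda>x. f x * g x) \<sigma> = winding1 f \<sigma> + winding1 g \<sigma>"
    by (simp add: L M add_divide_distrib [symmetric])
qed

text \<open>With a logarithm \<open>h\<close> on all of \<open>S\<close> the increments telescope:
  only the values of \<open>h\<close> on the boundary of the chain remain, and on a cycle nothing is
  left.\<close>

lemma winding_exp:
  assumes c: "chain_in 1 S c" and h: "continuous_on S h" and f: "\<And>x. x \<in> S \<Longrightarrow> f x = exp (h x)"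
  shows "winding f c = pt_eval h (chain_boundary 1 c) / (2 * of_real pi * \<i>)"
proof -
  have "winding f c = frag_eval (\<lambda>\<sigma>. 1 / (2 * of_real pi * \<i>) * (h (\<sigma> (edge 1)) - h (\<sigma> (edge 0)))) c"
    unfolding winding_def
  proof (rule frag_eval_cong)
    fix \<sigma> assume "\<sigma> \<in> Poly_Mapping.keys c"
    then have \<sigma>: "singular_simplex 1 (top_of_set S) \<sigma>"
      using c by (rule chain_in_keys [rotated])
    have im: "edge ` {0..1} \<subseteq> standard_simplex 1"
      using edge_in by blast
    then have "\<sigma> ` edge ` {0..1} \<subseteq> S"
      using \<sigma> unfolding singular_simplex_top_of_set by blast
    then have "continuous_on {0..1} (h \<circ> \<sigma> \<circ> edge)"
      using \<sigma> h im unfolding singular_simplex_top_of_set o_assoc [symmetric]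
      by (intro continuous_on_compose continuous_edge) (auto intro: continuous_on_subset simp: image_comp)
    moreover have "f (\<sigma> (edge t)) = exp ((h \<circ> \<sigma> \<circ> edge) t)" if "t \<in> {0..1}" for t
      using f \<sigma> im that unfolding singular_simplex_top_of_set by (auto simp: image_subset_iff)
    ultimately show "winding1 f \<sigma> = 1 / (2 * of_real pi * \<i>) * (h (\<sigma> (edge 1)) - h (\<sigma> (edge 0)))"
      by (subst winding1_eq) auto
  qed
  also have "\<dots> = pt_eval h (chain_boundary 1 c) / (2 * of_real pi * \<i>)"
    unfolding pt_eval_boundary by (simp add: frag_eval_def sum_divide_distrib sum_distrib_left)
  finally show ?thesis .
qed

lemma winding_exp_cycle:
  assumes "cycle_in 1 S c" "continuous_on S h" "\<And>x. x \<in> S \<Longrightarrow> f x = exp (h x)"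
  shows "winding f c = 0"
  using assms by (subst winding_exp [of S c h]) (auto simp: singular_cycle pt_eval_def)

text \<open>In the coordinates \<open>tri_param\<close> the 2-simplex is a convex planar triangle,
  so \<open>f\<close> has a logarithm on each singular 2-simplex and its increments along the three
  sides cancel.\<close>

lemma winding_boundary:
  assumes b: "chain_in 2 S b" and f: "continuous_on S f" "\<And>x. x \<in> S \<Longrightarrow> f x \<noteq> 0"
  shows "winding f (chain_boundary 2 b) = 0"
proof -
  have "winding f (chain_boundary 2 b)
      = frag_eval (\<lambda>\<sigma>. winding1 f (singular_face 2 0 \<sigma>) - winding1 f (singular_face 2 1 \<sigma>) + winding1 f (singular_face 2 2 \<sigma>)) b"
    by (simp add: winding_def chain_boundary_def frag_eval_extend numeral_2_eq_2)
  also have "\<dots> = frag_eval (\<lambda>\<sigma>. 0) b"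
  proof (rule frag_eval_cong)
    fix \<sigma> assume "\<sigma> \<in> Poly_Mapping.keys b"
    then have \<sigma>: "singular_simplex 2 (top_of_set S) \<sigma>"
      using b by (rule chain_in_keys [rotated])
    define T where "T = {x::real\<times>real. fst x \<ge> 0 \<and> snd x \<ge> 0 \<and> fst x + snd x \<le> 1}"
    have "convex T"
    proof -
      have "T = {x. (-1, 0) \<bullet> x \<le> 0} \<inter> {x. (0, -1) \<bullet> x \<le> 0} \<inter> {x. (1, 1) \<bullet> x \<le> 1}"
        by (auto simp: T_def inner_prod_def)
      then show ?thesis
        by (simp add: convex_Int convex_halfspace_le)
    qed
    have im: "tri_param ` T \<subseteq> standard_simplex 2"
      using tri_param_in by (auto simp: T_def)
    then have "\<sigma> ` tri_param ` T \<subseteq> S"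
      using \<sigma> unfolding singular_simplex_top_of_set by blast
    then have "continuous_on T (f \<circ> \<sigma> \<circ> tri_param)"
      using \<sigma> f im unfolding singular_simplex_top_of_set o_assoc [symmetric]
      by (intro continuous_on_compose continuous_tri_param) (auto intro: continuous_on_subset simp: image_comp)
    moreover have "(f \<circ> \<sigma> \<circ> tri_param) x \<noteq> 0" if "x \<in> T" for x
      using f(2) \<sigma> im that unfolding singular_simplex_top_of_set by (auto simp: image_subset_iff)
    ultimately obtain L where L: "continuous_on T L" "\<And>x. x \<in> T \<Longrightarrow> (f \<circ> \<sigma> \<circ> tri_param) x = exp (L x)"
      by (metis continuous_logarithm_on_contractible convex_imp_contractible \<open>convex T\<close>)
    have *: "winding1 f (singular_face 2 k \<sigma>) = (L (e 1) - L (e 0)) / (2 * of_real pi * \<i>)"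
      if "k \<le> 2" "\<And>t. simplical_face k (edge t) = tri_param (e t)" "e ` {0..1} \<subseteq> T" "continuous_on {0..1} e" for k e
    proof -
      have "continuous_on {0..1} (L \<circ> e)"
        by (meson continuous_on_compose continuous_on_subset L(1) that(3,4))
      moreover have "f (singular_face 2 k \<sigma> (edge t)) = exp ((L \<circ> e) t)" if "t \<in> {0..1}" for t
        using singular_face_edge [OF \<open>k \<le> 2\<close> that, of \<sigma>] \<open>\<And>t. simplical_face k (edge t) = tri_param (e t)\<close>
          L(2) [of "e t"] that \<open>e ` {0..1} \<subseteq> T\<close> by (simp add: image_subset_iff)
      ultimately show ?thesis
        by (subst winding1_eq) auto
    qed
    have "winding1 f (singular_face 2 0 \<sigma>) = (L (0,1) - L (1,0)) / (2 * of_real pi * \<i>)"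
      by (subst * [of 0 "\<lambda>t. (1-t,t)"]) (auto simp: T_def simplical_face_edge intro!: continuous_intros)
    moreover have "winding1 f (singular_face 2 1 \<sigma>) = (L (0,1) - L (0,0)) / (2 * of_real pi * \<i>)"
      by (subst * [of 1 "\<lambda>t. (0,t)"]) (auto simp: T_def simplical_face_edge intro!: continuous_intros)
    moreover have "winding1 f (singular_face 2 2 \<sigma>) = (L (1,0) - L (0,0)) / (2 * of_real pi * \<i>)"
      by (subst * [of 2 "\<lambda>t. (t,0)"]) (auto simp: T_def simplical_face_edge intro!: continuous_intros)
    ultimately show "winding1 f (singular_face 2 0 \<sigma>) - winding1 f (singular_face 2 1 \<sigma>) + winding1 f (singular_face 2 2 \<sigma>) = 0"
      by (simp add: diff_divide_distrib)
  qed
  finally show ?thesis by (simp add: frag_eval_def)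
qed

lemma winding_bounds:
  assumes "bounds_in 1 S c" "continuous_on S f" "\<And>x. x \<in> S \<Longrightarrow> f x \<noteq> 0"
  shows "winding f c = 0"
  using assms winding_boundary [of S] by (auto simp: singular_boundary numeral_2_eq_2)

lemma winding_homologous:
  assumes "homologous_rel 1 (top_of_set S) {} c d" "continuous_on S f" "\<And>x. x \<in> S \<Longrightarrow> f x \<noteq> 0"
  shows "winding f c = winding f d"
  using winding_bounds [of S "c - d" f] assms by (simp add: homologous_rel_def winding_diff)

lemma frag_eval_Ints:
  "(\<And>i. i \<in> Poly_Mapping.keys x \<Longrightarrow> h i \<in> \<int>) \<Longrightarrow> frag_eval h x \<in> \<int>"
  unfolding frag_eval_def by (auto intro!: Ints_sum Ints_mult)

text \<open>The winding of one edge differs from an integer by the change of the principal value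
  \<open>Ln\<close> between its end points. These corrections depend only on the vertices, so they
  cancel on a cycle, and the jumps of \<open>Ln\<close> do no harm.\<close>

lemma winding_Ints:
  assumes c: "cycle_in 1 S c" and f: "continuous_on S f" "\<And>x. x \<in> S \<Longrightarrow> f x \<noteq> 0"
  shows "winding f c \<in> \<int>"
proof -
  let ?\<kappa> = "2 * of_real pi * \<i>"
  let ?h = "\<lambda>x. - Ln (f x) / ?\<kappa>"
  have "frag_eval (\<lambda>\<sigma>. winding1 f \<sigma> + (?h (\<sigma> (edge 1)) - ?h (\<sigma> (edge 0)))) c \<in> \<int>"
  proof (rule frag_eval_Ints)
    fix \<sigma> assume "\<sigma> \<in> Poly_Mapping.keys c"
    then have \<sigma>: "singular_simplex 1 (top_of_set S) \<sigma>"
      using c by (meson chain_in_keys cycle_in_imp_chain_in)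
    obtain L where L: "continuous_on {0..1} L" "\<And>t. t \<in> {0..1} \<Longrightarrow> f (\<sigma> (edge t)) = exp (L t)"
    "winding1 f \<sigma> = (L 1 - L 0) / ?\<kappa>"
      using log_along_edge [OF f \<sigma>] by metis
    have "\<exists>k::int. L t - Ln (f (\<sigma> (edge t))) = of_int k * ?\<kappa>" if "t \<in> {0..1}" for t
    proof -
      have "exp (L t) = exp (Ln (f (\<sigma> (edge t))))"
        using L(2) [OF that] by simp
      then show ?thesis
        unfolding exp_eq by (auto simp: algebra_simps)
    qed
    from this [of 0] this [of 1] obtain k m :: int where
      "L 0 - Ln (f (\<sigma> (edge 0))) = of_int k * ?\<kappa>" "L 1 - Ln (f (\<sigma> (edge 1))) = of_int m * ?\<kappa>"
      by auto
    moreover have "winding1 f \<sigma> + (?h (\<sigma> (edge 1)) - ?h (\<sigma> (edge 0)))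
      = ((L 1 - Ln (f (\<sigma> (edge 1)))) - (L 0 - Ln (f (\<sigma> (edge 0))))) / ?\<kappa>"
      unfolding L(3) by (simp add: diff_divide_distrib add_divide_distrib)
    ultimately have "winding1 f \<sigma> + (?h (\<sigma> (edge 1)) - ?h (\<sigma> (edge 0))) = of_int (m - k)"
      by (simp add: diff_divide_distrib)
    then show "winding1 f \<sigma> + (?h (\<sigma> (edge 1)) - ?h (\<sigma> (edge 0))) \<in> \<int>"
      by (metis Ints_of_int)
  qed
  moreover have "frag_eval (\<lambda>\<sigma>. winding1 f \<sigma> + (?h (\<sigma> (edge 1)) - ?h (\<sigma> (edge 0)))) c = winding f c"
    using pt_eval_boundary [of ?h c] c
    by (simp add: frag_eval_fun_add winding_def singular_cycle pt_eval_def)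
  ultimately show ?thesis by simp
qed

lemma winding_chain_map: "winding f (chain_map 1 g c) = winding (f \<circ> g) c"
proof -
  have "winding1 f (simplex_map 1 g \<sigma>) = winding1 (f \<circ> g) \<sigma>" for \<sigma>
  proof -
    have *: "(simplex_map 1 g \<sigma>) (edge t) = g (\<sigma> (edge t))" if "t \<in> {0..1}" for t
      using edge_in [OF that] by (simp add: simplex_map_def)
    have "(\<forall>t\<in>{0..1}. f ((simplex_map 1 g \<sigma>) (edge t)) = exp (L t)) \<longleftrightarrow>
      (\<forall>t\<in>{0..1}. (f \<circ> g) (\<sigma> (edge t)) = exp (L t))" for L
      using * by auto
    then show ?thesis
      unfolding winding1_def by presburger
  qed
  then show ?thesis
    by (simp add: winding_def chain_map_def frag_eval_extend)
qed

lemma winding_cong: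
  assumes "chain_in 1 S c" "\<And>x. x \<in> S \<Longrightarrow> f x = g x"
  shows "winding f c = winding g c"
  unfolding winding_def
proof (rule frag_eval_cong)
  fix \<sigma> assume "\<sigma> \<in> Poly_Mapping.keys c"
  with assms(1) have "\<sigma> ` standard_simplex 1 \<subseteq> S"
    by (auto simp: chain_in_iff)
  then have "f (\<sigma> (edge t)) = g (\<sigma> (edge t))" if "t \<in> {0..1}" for t
    using edge_in [OF that] assms(2) by auto
  then have "(\<forall>t\<in>{0..1}. f (\<sigma> (edge t)) = exp (L t)) \<longleftrightarrow> (\<forall>t\<in>{0..1}. g (\<sigma> (edge t)) = exp (L t))" for L
    by auto
  then show "winding1 f \<sigma> = winding1 g \<sigma>"
    unfolding winding1_def by presburger
qed

lemma winding_prod: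
  assumes "finite I" "chain_in 1 S c" "\<And>i. i \<in> I \<Longrightarrow> continuous_on S (f i)" "\<And>i x. i \<in> I \<Longrightarrow> x \<in> S \<Longrightarrow> f i x \<noteq> 0"
  shows "winding (\<lambda>x. \<Prod>i\<in>I. f i x) c = (\<Sum>i\<in>I. winding (f i) c)"
  using assms
proof (induction I rule: finite_induct)
  case empty
  have "winding (\<lambda>x. 1) c = pt_eval (\<lambda>x. 0) (chain_boundary 1 c) / (2 * of_real pi * \<i>)"
    using empty by (intro winding_exp [of S]) auto
  then show ?case by (simp add: pt_eval_def frag_eval_def)
next
  case (insert i I)
  then show ?case
    by (simp add: winding_mult [of S] continuous_on_prod)
qed

text \<open>The quotient of \<open>f\<close> and \<open>g\<close> stays within distance 1 of the
  point 1, hence off the branch cut of \<open>Ln\<close>, and has winding number 0. This is the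
  argument behind Rouche's theorem; it later replaces a form by its leading term on a neck or on a
  core.\<close>

lemma winding_near:
  assumes c: "cycle_in 1 S c" and f: "continuous_on S f"
    and g: "continuous_on S g" and near: "\<And>x. x \<in> S \<Longrightarrow> norm (f x - g x) < norm (g x)"
  shows "winding f c = winding g c"
proof -
  have g0: "g x \<noteq> 0" if "x \<in> S" for x
    using near [OF that] by auto
  define q where "q = (\<lambda>x. f x / g x)"
  have q: "q x \<notin> \<real>\<^sub>\<le>\<^sub>0" if "x \<in> S" for x
  proof -
    have "norm (q x - 1) = norm (f x - g x) / norm (g x)"
      unfolding q_def norm_divide [symmetric] using g0 [OF that] by (simp add: diff_divide_distrib)
    then have "norm (q x - 1) < 1"
      using near [OF that] g0 [OF that] by simp
    then have "\<bar>Re (q x - 1)\<bar> < 1"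
      using abs_Re_le_cmod le_less_trans by blast
    then show ?thesis by (auto simp: complex_nonpos_Reals_iff)
  qed
  have qc: "continuous_on S q"
    unfolding q_def using f g g0 by (intro continuous_intros) auto
  have q0: "q x \<noteq> 0" if "x \<in> S" for x
    using q [OF that] by auto
  have "winding q c = 0"
    using c qc q q0 by (intro winding_exp_cycle [of S c "\<lambda>x. Ln (q x)"]) (auto intro!: continuous_intros)
  moreover have "winding (\<lambda>x. q x * g x) c = winding q c + winding g c"
    using c qc g g0 q0 by (intro winding_mult) (auto simp: singular_cycle)
  moreover have "winding (\<lambda>x. q x * g x) c = winding f c"
    using c g0 by (intro winding_cong [of S]) (auto simp: q_def singular_cycle)
  ultimately show ?thesis by simp
qed

section \<open>Mayer-Vietoris at the level of chains\<close>

lemma subdivision_power_chain_in: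
  "chain_in p S c \<Longrightarrow> chain_in p S ((singular_subdivision p ^^ m) c)"
  by (induction m) (auto simp: singular_chain_singular_subdivision)

lemma subdivision_power_boundary:
  "chain_in p S c \<Longrightarrow> chain_boundary p ((singular_subdivision p ^^ m) c)
      = (singular_subdivision (p - Suc 0) ^^ m) (chain_boundary p c)"
proof (induction m)
  case (Suc m)
  then show ?case
    using chain_boundary_singular_subdivision [OF subdivision_power_chain_in [OF Suc.prems]] by simp
qed auto

lemma subdivision_power_homologous:
  assumes "cycle_in p S c"
  shows "homologous_rel p (top_of_set S) {} ((singular_subdivision p ^^ m) c) c"
proof (induction m)
  case (Suc m)
  have "cycle_in p S ((singular_subdivision p ^^ m) c)"
    using Suc assms homologous_rel_singular_relcycle by blast
  then have "homologous_rel p (top_of_set S) {} ((singular_subdivision p ^^ Suc m) c) ((singular_subdivision p ^^ m) c)"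
    by (simp add: homologous_rel_singular_subdivision)
  with Suc show ?case by (meson homologous_rel_trans)
qed auto

lemma subdivision_power_0:
  "chain_in 0 S c \<Longrightarrow> (singular_subdivision 0 ^^ m) c = c"
  by (induction m) (auto simp: singular_subdivision_zero)

text \<open>By compactness of the simplices some iterated subdivision consists of simplices that lie
  in \<open>A\<close> or in \<open>B\<close>; \<open>frag_split\<close> sorts them. The three
  Mayer-Vietoris statements below rest on this.\<close>

lemma subdivided_chain_splits:
  assumes "openin (top_of_set (A \<union> B)) A" "openin (top_of_set (A \<union> B)) B" "chain_in p (A \<union> B) c"
  obtains m d e where "chain_in p A d" "chain_in p B e" "(singular_subdivision p ^^ m) c = d + e"
proof -
  obtain m where m: "\<And>k f. \<lbrakk>m \<le> k; f \<in> Poly_Mapping.keys ((singular_subdivision p ^^ k) c)\<rbrakk>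
                             \<Longrightarrow> \<exists>V \<in> {A, B}. f \<in> (standard_simplex p) \<rightarrow> V"
    by (rule sufficient_iterated_singular_subdivision_exists [of "{A, B}" "top_of_set (A \<union> B)" p c])
       (use assms in auto)
  have "chain_in p (A \<union> B) ((singular_subdivision p ^^ m) c)"
    by (rule subdivision_power_chain_in [OF assms(3)])
  then have "Poly_Mapping.keys ((singular_subdivision p ^^ m) c)
       \<subseteq> singular_simplex_set p (top_of_set A) \<union> singular_simplex_set p (top_of_set B)"
    using m [OF order_refl] unfolding chain_in_iff by (fastforce simp: singular_simplex_top_of_set)
  then show ?thesis
    using that frag_split unfolding singular_chain_def by metis
qed

text \<open>The summands are chains, not cycles: their boundaries cancel each other and carry the
  connecting homomorphism.\<close>

lemma MV_cycle:
  assumes "openin (top_of_set (A \<union> B)) A" "openin (top_of_set (A \<union> B)) B" "cycle_in p (A \<union> B) c"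
  obtains d e where "chain_in p A d" "chain_in p B e" "homologous_rel p (top_of_set (A \<union> B)) {} c (d + e)"
  by (metis subdivided_chain_splits [OF assms(1,2) cycle_in_imp_chain_in [OF assms(3)]]
      subdivision_power_homologous [OF assms(3)] homologous_rel_sym)

text \<open>After subdivision a chain with boundary \<open>c\<close> splits into parts
  \<open>bA\<close> and \<open>bB\<close>. The boundary of \<open>bB\<close> is the required cycle:
  it bounds in \<open>B\<close> by construction, and it differs from the subdivided \<open>c\<close>
  by the boundary of \<open>bA\<close>, which puts it into \<open>A\<close>.\<close>

lemma MV_kernel:
  assumes op: "openin (top_of_set (A \<union> B)) A" "openin (top_of_set (A \<union> B)) B"
    and c: "cycle_in p A c" and bd: "bounds_in p (A \<union> B) c"
  obtains e where "cycle_in p (A \<inter> B) e" "homologous_rel p (top_of_set A) {} c e" "bounds_in p B e"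
proof -
  obtain b where b: "chain_in (Suc p) (A \<union> B) b" "chain_boundary (Suc p) b = c"
    using bd by (auto simp: singular_boundary)
  obtain m bA bB where AB: "chain_in (Suc p) A bA" "chain_in (Suc p) B bB"
    "(singular_subdivision (Suc p) ^^ m) b = bA + bB"
    by (rule subdivided_chain_splits [OF op b(1)])
  define e where "e = chain_boundary (Suc p) bB"
  have sd: "(singular_subdivision p ^^ m) c = chain_boundary (Suc p) bA + e"
    using subdivision_power_boundary [OF b(1), of m] b(2) AB(3)
    by (simp add: chain_boundary_add e_def)
  have hom: "homologous_rel p (top_of_set A) {} ((singular_subdivision p ^^ m) c) c"
    by (rule subdivision_power_homologous [OF c])
  have "homologous_rel p (top_of_set A) {} ((singular_subdivision p ^^ m) c) e"
    unfolding homologous_rel_def sd using AB(1) by (simp add: bounds_in_boundary)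
  then have ce: "homologous_rel p (top_of_set A) {} c e"
    using hom by (meson homologous_rel_sym homologous_rel_trans)
  then have "cycle_in p A e"
    using c homologous_rel_singular_relcycle by blast
  moreover have "bounds_in p B e"
    unfolding e_def by (rule bounds_in_boundary [OF AB(2)])
  ultimately show ?thesis
    using ce that [of e] cycle_in_Int by (metis cycle_in_imp_chain_in bounds_in_imp_cycle_in)
qed

text \<open>Exactness at the connecting homomorphism: when \<open>d + e\<close> bounds in the union,
  the boundary of \<open>e\<close> already vanishes in H_0 of the intersection.\<close>

lemma MV_connecting:
  assumes op: "openin (top_of_set (A \<union> B)) A" "openin (top_of_set (A \<union> B)) B"
    and d: "chain_in 1 A d" and e: "chain_in 1 B e" and bd: "bounds_in 1 (A \<union> B) (d + e)"
  obtains u where "chain_in 1 (A \<inter> B) u" "chain_boundary 1 u = chain_boundary 1 e"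
proof -
  obtain b where b: "chain_in 2 (A \<union> B) b" "chain_boundary 2 b = d + e"
    using bd by (auto simp: singular_boundary numeral_2_eq_2)
  obtain m bA bB where AB: "chain_in 2 A bA" "chain_in 2 B bB" "(singular_subdivision 2 ^^ m) b = bA + bB"
    by (rule subdivided_chain_splits [OF op b(1)])
  define sd :: "'a chain \<Rightarrow> 'a chain" where "sd = singular_subdivision 1 ^^ m"
  have sd_add: "sd (x + y) = sd x + sd y" for x y
    unfolding sd_def by (induction m) (auto simp: singular_subdivision_add)
  have eq: "sd d + sd e = chain_boundary 2 bA + chain_boundary 2 bB"
    using subdivision_power_boundary [OF b(1), of m] b(2) AB(3)
    by (simp add: chain_boundary_add sd_add [symmetric]) (simp add: sd_def)
  \<comment> \<open>This formula shows that \<open>u\<close> lies in \<open>B\<close>; by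
    \<open>eq\<close> it equals \<open>chain_boundary 2 bA - sd d\<close>, which lies in
    \<open>A\<close>. Subdivision fixes 0-chains, so the boundary of \<open>sd e\<close> is still
    that of \<open>e\<close>.\<close>
  define u where "u = sd e - chain_boundary 2 bB"
  have "chain_in 1 B u"
    unfolding u_def sd_def using e singular_chain_boundary [OF AB(2)]
    by (intro singular_chain_diff subdivision_power_chain_in) auto
  moreover have "u = chain_boundary 2 bA - sd d"
    using eq by (simp add: u_def algebra_simps)
  then have "chain_in 1 A u"
    unfolding sd_def using d singular_chain_boundary [OF AB(1)]
    by (auto intro!: singular_chain_diff subdivision_power_chain_in simp del: One_nat_def)
  moreover have "chain_boundary 1 u = chain_boundary 1 e"
  proof -
    have "chain_boundary 1 (chain_boundary 2 bB) = 0"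
      using chain_boundary_boundary [OF AB(2)] by simp
    moreover have "chain_boundary 1 (sd e) = chain_boundary 1 e"
      using subdivision_power_boundary [OF e, of m] singular_chain_boundary [OF e]
      by (simp add: sd_def subdivision_power_0)
    ultimately show ?thesis by (simp add: u_def chain_boundary_diff)
  qed
  ultimately show ?thesis
    using that chain_in_Int by blast
qed

lemma bounds_in_sum:
  "(\<And>i. i \<in> I \<Longrightarrow> bounds_in p S (f i)) \<Longrightarrow> bounds_in p S (sum f I)"
  by (induction I rule: infinite_finite_induct) (auto intro: singular_relboundary_add)

section \<open>Chains in disjoint families of relatively open sets\<close>

definition separated_family :: "'i set \<Rightarrow> ('i \<Rightarrow> 'a::topological_space set) \<Rightarrow> bool"
  where "separated_family I U \<longleftrightarrow> finite I \<and> disjoint_family_on U I \<and>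
           (\<forall>i\<in>I. openin (top_of_set (\<Union>(U ` I))) (U i))"

text \<open>The projection that keeps the simplices inside \<open>U\<close>. For a member of a
  separated family it commutes with the boundary and splits the chain complex; for an arbitrary set
  it would not commute.\<close>

definition chain_part :: "nat \<Rightarrow> 'a set \<Rightarrow> 'a chain \<Rightarrow> 'a chain"
  where "chain_part p U = frag_extend (\<lambda>f. if f ` standard_simplex p \<subseteq> U then frag_of f else 0)"

lemma part_0 [simp]: "chain_part p U 0 = 0"
  and part_add: "chain_part p U (c + d) = chain_part p U c + chain_part p U d"
  and part_diff: "chain_part p U (c - d) = chain_part p U c - chain_part p U d"
  and part_minus: "chain_part p U (- c) = - chain_part p U c"
  and part_cmul: "chain_part p U (frag_cmul k c) = frag_cmul k (chain_part p U c)"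
  by (simp_all add: chain_part_def frag_extend_add frag_extend_diff frag_extend_minus frag_extend_cmul)

lemma part_sum: "chain_part p U (sum g I) = (\<Sum>i\<in>I. chain_part p U (g i))"
  by (induction I rule: infinite_finite_induct) (auto simp: part_add)

lemma part_of: "chain_part p U (frag_of f) = (if f ` standard_simplex p \<subseteq> U then frag_of f else 0)"
  by (simp add: chain_part_def)

lemma chain_in_induct [consumes 1, case_names zero one diff]:
  assumes "chain_in p S c" "P 0" "\<And>f. singular_simplex p (top_of_set S) f \<Longrightarrow> P (frag_of f)"
    "\<And>a b. P a \<Longrightarrow> P b \<Longrightarrow> P (a - b)"
  shows "P c"
  using assms(1) unfolding singular_chain_def
  by (rule frag_induction) (use assms in auto)

lemma part_in: "chain_in p S c \<Longrightarrow> chain_in p (S \<inter> U) (chain_part p U c)"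
  by (induction rule: chain_in_induct)
     (auto simp: part_of part_diff singular_chain_of singular_simplex_top_of_set intro: singular_chain_diff)

lemma part_self: "chain_in p U c \<Longrightarrow> chain_part p U c = c"
  by (induction rule: chain_in_induct) (auto simp: part_of part_diff singular_simplex_top_of_set)

lemma part_disjoint: "chain_in p V c \<Longrightarrow> U \<inter> V = {} \<Longrightarrow> chain_part p U c = 0"
proof (induction rule: chain_in_induct)
  case (one f)
  then have "f ` standard_simplex p \<subseteq> V" "f ` standard_simplex p \<noteq> {}"
    using nonempty_standard_simplex by (auto simp: singular_simplex_top_of_set)
  with one show ?case
    by (auto simp: part_of)
qed (auto simp: part_diff)

text \<open>A simplex is connected, and the members of the family are disjoint and relatively open,
  so its image cannot meet two of them.\<close>

lemma simplex_in_separated: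
  assumes sep: "separated_family I U" and f: "singular_simplex p (top_of_set (\<Union>(U ` I))) f"
  obtains i where "i \<in> I" "f ` standard_simplex p \<subseteq> U i"
    "\<And>j. j \<in> I \<Longrightarrow> j \<noteq> i \<Longrightarrow> f ` standard_simplex p \<inter> U j = {}"
proof -
  let ?S = "\<Union>(U ` I)" and ?F = "f ` standard_simplex p"
  have F: "continuous_on (standard_simplex p) f" "?F \<subseteq> ?S"
    using f by (auto simp: singular_simplex_top_of_set)
  have conF: "connected ?F"
    using connectedin_standard_simplex [of p]
    by (intro connected_continuous_image F) (auto simp: euclidean_product_topology)
  obtain x i where x: "x \<in> ?F" "i \<in> I" "x \<in> U i"
    using F(2) nonempty_standard_simplex [of p] by blast
  let ?V = "\<Union>(U ` (I - {i}))"
  have "openin (top_of_set ?S) (U i)" "openin (top_of_set ?S) ?V"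
    using sep x by (auto simp: separated_family_def)
  then obtain O1 O2 where O: "open O1" "open O2" "U i = ?S \<inter> O1" "?V = ?S \<inter> O2"
    by (auto simp: openin_open)
  have disj: "U i \<inter> U j = {}" if "j \<in> I" "j \<noteq> i" for j
    using sep x that unfolding separated_family_def disjoint_family_on_def by metis
  have "O1 \<inter> O2 \<inter> ?F = {}"
  proof -
    have "U i \<inter> ?V = {}"
      using disj by auto
    then have "?S \<inter> O1 \<inter> (?S \<inter> O2) = {}"
      unfolding O(3,4) [symmetric] .
    then show ?thesis
      using F(2) by blast
  qed
  moreover have "?F \<subseteq> O1 \<union> O2"
  proof
    fix y assume "y \<in> ?F"
    then obtain j where "j \<in> I" "y \<in> U j" using F(2) by blast
    then have "y \<in> U i \<or> y \<in> ?V" by (cases "j = i") auto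
    then show "y \<in> O1 \<union> O2" using O by blast
  qed
  ultimately have "O1 \<inter> ?F = {} \<or> O2 \<inter> ?F = {}"
    using conF O(1,2) unfolding connected_def by meson
  then have "O2 \<inter> ?F = {}"
    using x O by blast
  then have "?F \<subseteq> U i"
    using \<open>?F \<subseteq> O1 \<union> O2\<close> F(2) O by blast
  then show ?thesis
    using that [of i] x disj by blast
qed

lemma chain_sum_parts:
  assumes sep: "separated_family I U" and c: "chain_in p (\<Union>(U ` I)) c"
  shows "c = (\<Sum>i\<in>I. chain_part p (U i) c)"
  using c
proof (induction rule: chain_in_induct)
  case (one f)
  then obtain i where i: "i \<in> I" "f ` standard_simplex p \<subseteq> U i"
    "\<And>j. j \<in> I \<Longrightarrow> j \<noteq> i \<Longrightarrow> f ` standard_simplex p \<inter> U j = {}"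
    using simplex_in_separated [OF sep] by metis
  have "chain_part p (U j) (frag_of f) = (if j = i then frag_of f else 0)" if "j \<in> I" for j
    using i(2) i(3) [OF that] nonempty_standard_simplex [of p] by (auto simp: part_of)
  then have "(\<Sum>j\<in>I. chain_part p (U j) (frag_of f)) = (\<Sum>j\<in>I. if j = i then frag_of f else 0)"
    by (rule sum.cong [OF refl])
  then show ?case
    using i(1) sep by (simp add: separated_family_def)
next
  case (diff a b)
  have "(\<Sum>i\<in>I. chain_part p (U i) (a - b)) = (\<Sum>i\<in>I. chain_part p (U i) a) - (\<Sum>i\<in>I. chain_part p (U i) b)"
    by (simp add: part_diff sum_subtractf)
  then show ?case
    using diff by metis
qed auto

text \<open>All faces of a simplex lie in the same member of the family as the simplex
  itself.\<close>

lemma part_boundary: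
  assumes sep: "separated_family I U" and i: "i \<in> I" and c: "chain_in (Suc p) (\<Union>(U ` I)) c"
  shows "chain_boundary (Suc p) (chain_part (Suc p) (U i) c) = chain_part p (U i) (chain_boundary (Suc p) c)"
  using c
proof (induction rule: chain_in_induct)
  case (one f)
  obtain k where k: "k \<in> I" "f ` standard_simplex (Suc p) \<subseteq> U k"
    "\<And>j. j \<in> I \<Longrightarrow> j \<noteq> k \<Longrightarrow> f ` standard_simplex (Suc p) \<inter> U j = {}"
    using simplex_in_separated [OF sep one] by metis
  have "singular_simplex (Suc p) (top_of_set (U k)) f"
    using one k by (auto simp: singular_simplex_top_of_set)
  then have fk: "chain_in (Suc p) (U k) (frag_of f)"
    by (simp add: singular_chain_of)
  then have bk: "chain_in p (U k) (chain_boundary (Suc p) (frag_of f))"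
    using singular_chain_boundary_alt by blast
  show ?case
  proof (cases "i = k")
    case True
    then show ?thesis using part_self [OF fk] part_self [OF bk] by simp
  next
    case False
    then have "U i \<inter> U k = {}"
      using sep i k unfolding separated_family_def disjoint_family_on_def by metis
    then show ?thesis using part_disjoint [OF fk] part_disjoint [OF bk] by simp
  qed
qed (auto simp: part_diff chain_boundary_diff)

lemma cycle_part:
  assumes sep: "separated_family I U" and i: "i \<in> I" and c: "cycle_in (Suc p) (\<Union>(U ` I)) c"
  shows "cycle_in (Suc p) (U i) (chain_part (Suc p) (U i) c)"
proof -
  have "chain_in (Suc p) (U i) (chain_part (Suc p) (U i) c)"
    by (rule chain_in_mono [OF part_in [OF cycle_in_imp_chain_in [OF c]]]) auto
  then show ?thesis
    using part_boundary [OF sep i cycle_in_imp_chain_in [OF c]] c by (simp add: singular_cycle)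
qed

lemma bounds_part:
  assumes sep: "separated_family I U" and i: "i \<in> I" and c: "bounds_in p (\<Union>(U ` I)) c"
  shows "bounds_in p (U i) (chain_part p (U i) c)"
proof -
  obtain b where b: "chain_in (Suc p) (\<Union>(U ` I)) b" "chain_boundary (Suc p) b = c"
    using c by (auto simp: singular_boundary)
  have "chain_in (Suc p) (U i) (chain_part (Suc p) (U i) b)"
    using part_in [OF b(1)] chain_in_mono by blast
  then show ?thesis
    using part_boundary [OF sep i b(1)] b(2) bounds_in_boundary by metis
qed

lemma separated_subfamily:
  assumes "separated_family I U" "\<And>i. i \<in> I \<Longrightarrow> V i = U i \<inter> S"
  shows "separated_family I V"
  unfolding separated_family_def
proof (intro conjI ballI)
  show "finite I"
    using assms by (simp add: separated_family_def)
  show "disjoint_family_on V I"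
    unfolding disjoint_family_on_def
  proof (intro ballI impI)
    fix m n assume "m \<in> I" "n \<in> I" "m \<noteq> n"
    then have "U m \<inter> U n = {}"
      using assms(1) unfolding separated_family_def disjoint_family_on_def by metis
    then show "V m \<inter> V n = {}"
      using assms(2) \<open>m \<in> I\<close> \<open>n \<in> I\<close> by auto
  qed
  fix i assume i: "i \<in> I"
  then obtain O' where "open O'" "U i = \<Union>(U ` I) \<inter> O'"
    using assms by (auto simp: separated_family_def openin_open)
  moreover have "V i = \<Union>(V ` I) \<inter> O'"
  proof -
    have "\<Union>(V ` I) = \<Union>(U ` I) \<inter> S" using assms(2) by auto
    then show ?thesis using assms(2) [OF i] \<open>U i = \<Union>(U ` I) \<inter> O'\<close> by auto
  qed
  ultimately show "openin (top_of_set (\<Union>(V ` I))) (V i)"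
    by (metis openin_open)
qed

section \<open>Augmentation and criteria for bounding\<close>

abbreviation aug :: "'a chain \<Rightarrow> int"
  where "aug \<equiv> pt_eval (\<lambda>_. 1)"

lemma aug_boundary [simp]: "aug (chain_boundary 1 c) = 0" "aug (chain_boundary (Suc 0) c) = 0"
  using pt_eval_boundary [of "\<lambda>_. 1::int" c] by (simp_all add: frag_eval_def)

lemma pt_eval_add: "pt_eval h (c + d) = pt_eval h c + pt_eval h d"
  and pt_eval_diff: "pt_eval h (c - d) = pt_eval h c - pt_eval h d"
  and pt_eval_minus: "pt_eval h (- c) = - pt_eval h c"
  and pt_eval_cmul: "pt_eval h (frag_cmul k c) = of_int k * pt_eval h c"
  and pt_eval_sum: "pt_eval h (sum g I) = (\<Sum>i\<in>I. pt_eval h (g i))"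
  and pt_eval_0 [simp]: "pt_eval h 0 = 0"
  by (simp_all add: pt_eval_def frag_eval_sum)

text \<open>Any simplex \<open>f0\<close> occurring in \<open>z\<close> serves as base point: in a
  path connected set \<open>z\<close> is homologous to \<open>aug z\<close> copies of it.\<close>

lemma aug_zero_bounds:
  assumes S: "path_connected S" and z: "chain_in 0 S z" "aug z = 0"
  shows "bounds_in 0 S z"
proof (cases "z = 0")
  case False
  then obtain f0 where "f0 \<in> Poly_Mapping.keys z" by fastforce
  then have f0: "singular_simplex 0 (top_of_set S) f0"
    using z(1) chain_in_keys by blast
  have "homologous_rel 0 (top_of_set S) {} z (frag_cmul (aug z) (frag_of f0))"
    using z(1)
  proof (induction rule: chain_in_induct)
    case (one f)
    then show ?case
      using iso_integer_zeroth_homology_group_aux [of "top_of_set S" f f0] S f0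
      by (simp add: pt_eval_def path_connected_def path_connected_space_def pathin_def path_def
          path_image_def pathstart_def pathfinish_def image_subset_iff_funcset)
  next
    case (diff a b)
    then show ?case
      using homologous_rel_diff by (fastforce simp: pt_eval_diff frag_cmul_diff_distrib)
  qed auto
  with z show ?thesis by (simp add: homologous_rel_def)
qed auto

lemma homotopic_constant_bounds:
  assumes "homotopic_with_canon (\<lambda>_. True) S T id (\<lambda>x. a)" "a \<in> T" "cycle_in 1 S c"
  shows "bounds_in 1 T c"
proof -
  have 1: "homologous_rel 1 (top_of_set T) {} (chain_map 1 id c) (chain_map 1 (\<lambda>x. a) c)"
    using assms(1) by (intro homotopic_imp_homologous_rel_chain_maps [OF _ assms(3)]) simp
  have "cycle_in 1 {a} (chain_map 1 (\<lambda>x. a) c)"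
    by (rule cycle_map_in [OF assms(3)]) auto
  then have "bounds_in 1 {a} (chain_map 1 (\<lambda>x. a) c)"
    using singular_boundary_eq_cycle_singleton [of "top_of_set {a}" a 1] by simp
  then have "bounds_in 1 T (chain_map 1 (\<lambda>x. a) c)"
    using assms(2) by (auto elim: bounds_in_mono)
  moreover have "chain_map 1 id c = c"
    using assms(3) by (auto simp: singular_cycle intro: chain_map_ident)
  ultimately show ?thesis
    using 1 unfolding homologous_rel_def by (metis diff_add_cancel singular_relboundary_add)
qed

lemma convex_cycle_bounds:
  fixes E :: "'a::real_normed_vector set"
  assumes "convex E" "cycle_in 1 E c"
  shows "bounds_in 1 E c"
proof (cases "E = {}")
  case True
  with assms have "c = 0"
    by (metis cycle_in_imp_chain_in singular_chain_empty topspace_euclidean_subtopology)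
  then show ?thesis by simp
next
  case False
  then obtain a where "a \<in> E" by blast
  moreover have "homotopic_with_canon (\<lambda>_. True) E E id (\<lambda>x. a)"
    using assms(1) \<open>a \<in> E\<close> by (intro homotopic_with_linear) (auto simp: closed_segment_subset intro: continuous_on_id)
  ultimately show ?thesis using assms(2) homotopic_constant_bounds by blast
qed

text \<open>The sets where the first or the second coordinate is nonzero are open, each contracts to
  a point inside the punctured plane, and their intersection is path connected. So a cycle can be
  cut into two cycles, one in each set.\<close>

lemma punctured_plane_cycle_bounds:
  assumes c: "cycle_in 1 (UNIV - {0 :: complex \<times> complex}) c"
  shows "bounds_in 1 (UNIV - {0}) c"
proof -
  define A B where "A = {x :: complex \<times> complex. fst x \<noteq> 0}" and "B = {x :: complex \<times> complex. snd x \<noteq> 0}"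
  let ?T = "UNIV - {0 :: complex \<times> complex}"
  have AB: "A \<union> B = ?T"
    by (auto simp: A_def B_def prod_eq_iff)
  have "open A" "open B"
    unfolding A_def B_def by (auto intro!: open_Collect_neq continuous_intros)
  then have op: "openin (top_of_set (A \<union> B)) A" "openin (top_of_set (A \<union> B)) B"
    by (auto intro: open_subset)
  obtain d e where de: "chain_in 1 A d" "chain_in 1 B e" "homologous_rel 1 (top_of_set (A \<union> B)) {} c (d + e)"
    using c MV_cycle [OF op] unfolding AB by metis
  have "cycle_in 1 ?T (d + e)"
    using de(3) c homologous_rel_singular_relcycle unfolding AB by blast
  then have bd: "chain_boundary 1 d = - chain_boundary 1 e"
    by (simp add: singular_cycle chain_boundary_add eq_neg_iff_add_eq_0)
  have "chain_in 0 B (chain_boundary 1 e)" "chain_in 0 A (chain_boundary 1 d)"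
    using singular_chain_boundary [OF de(1)] singular_chain_boundary [OF de(2)] by simp_all
  then have "chain_in 0 (A \<inter> B) (chain_boundary 1 e)"
    using bd by (metis chain_in_Int minus_minus singular_chain_minus)
  moreover have "path_connected (A \<inter> B)"
  proof -
    have "A \<inter> B = (- {0}) \<times> (- {0})"
      by (auto simp: A_def B_def)
    moreover have "path_connected (- {0::complex})"
      by (rule path_connected_punctured_universe) auto
    ultimately show ?thesis
      by (simp add: path_connected_Times)
  qed
  ultimately have "bounds_in 0 (A \<inter> B) (chain_boundary 1 e)"
    by (intro aug_zero_bounds) auto
  then obtain u where u: "chain_in 1 (A \<inter> B) u" "chain_boundary 1 u = chain_boundary 1 e"
    by (auto simp: singular_boundary)
  \<comment> \<open>\<open>u\<close> closes both halves without changing their sum.\<close>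
  have "cycle_in 1 A (d + u)" "cycle_in 1 B (e - u)"
    using de u bd by (auto simp: singular_cycle chain_boundary_add chain_boundary_diff
        intro!: singular_chain_add singular_chain_diff elim: chain_in_mono)
  \<comment> \<open>The second coordinate moves to 1 while the first one, which is nonzero, is kept;
    then the first moves to 0 while the second stays 1. Neither motion meets the origin, although
    \<open>A\<close> itself is left.\<close>
  moreover have "homotopic_with_canon (\<lambda>_. True) A ?T id (\<lambda>x. (0, 1))"
  proof (rule homotopic_with_trans)
    show "homotopic_with_canon (\<lambda>_. True) A ?T id (\<lambda>x. (fst x, 1))"
    proof (rule homotopic_with_linear)
      fix x assume "x \<in> A"
      have "closed_segment (id x) (fst x, 1) \<subseteq> {fst x} \<times> UNIV"
        by (intro closed_segment_subset convex_Times) (auto simp: mem_Times_iff)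
      also have "\<dots> \<subseteq> ?T"
        using \<open>x \<in> A\<close> by (auto simp: A_def zero_prod_def)
      finally show "closed_segment (id x) (fst x, 1) \<subseteq> ?T" .
    qed (auto intro!: continuous_intros)
    show "homotopic_with_canon (\<lambda>_. True) A ?T (\<lambda>x. (fst x, 1)) (\<lambda>x. (0, 1))"
    proof (rule homotopic_with_linear)
      fix x :: "complex \<times> complex"
      have "closed_segment (fst x, 1) (0, 1) \<subseteq> UNIV \<times> {1}"
        by (intro closed_segment_subset convex_Times) auto
      also have "\<dots> \<subseteq> ?T"
        by (auto simp: zero_prod_def)
      finally show "closed_segment (fst x, 1) (0, 1) \<subseteq> ?T" .
    qed (auto intro!: continuous_intros)
  qed
  moreover have "homotopic_with_canon (\<lambda>_. True) B ?T id (\<lambda>x. (1, 0))"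
  proof (rule homotopic_with_trans)
    show "homotopic_with_canon (\<lambda>_. True) B ?T id (\<lambda>x. (1, snd x))"
    proof (rule homotopic_with_linear)
      fix x assume "x \<in> B"
      have "closed_segment (id x) (1, snd x) \<subseteq> UNIV \<times> {snd x}"
        by (intro closed_segment_subset convex_Times) (auto simp: mem_Times_iff)
      also have "\<dots> \<subseteq> ?T"
        using \<open>x \<in> B\<close> by (auto simp: B_def zero_prod_def)
      finally show "closed_segment (id x) (1, snd x) \<subseteq> ?T" .
    qed (auto intro!: continuous_intros)
    show "homotopic_with_canon (\<lambda>_. True) B ?T (\<lambda>x. (1, snd x)) (\<lambda>x. (1, 0))"
    proof (rule homotopic_with_linear)
      fix x :: "complex \<times> complex"
      have "closed_segment (1, snd x) (1, 0) \<subseteq> {1} \<times> UNIV"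
        by (intro closed_segment_subset convex_Times) auto
      also have "\<dots> \<subseteq> ?T"
        by (auto simp: zero_prod_def)
      finally show "closed_segment (1, snd x) (1, 0) \<subseteq> ?T" .
    qed (auto intro!: continuous_intros)
  qed
  ultimately have "bounds_in 1 ?T (d + u)" "bounds_in 1 ?T (e - u)"
    using homotopic_constant_bounds [of A ?T "(0,1)" "d + u"] homotopic_constant_bounds [of B ?T "(1,0)" "e - u"]
    by (simp_all add: zero_prod_def del: One_nat_def)
  then have "bounds_in 1 ?T (d + e)"
    using singular_relboundary_add by fastforce
  then show ?thesis
    using de(3) unfolding homologous_rel_def AB by (metis diff_add_cancel singular_relboundary_add)
qed

lemma homologous_bounds:
  assumes "homologous_rel p (top_of_set X) {} c d"
  shows "bounds_in p X c \<longleftrightarrow> bounds_in p X d"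
proof
  assume "bounds_in p X c"
  then show "bounds_in p X d"
    using singular_relboundary_diff [of p "top_of_set X" "{}" c "c - d"] assms
    by (simp add: homologous_rel_def)
next
  assume "bounds_in p X d"
  then show "bounds_in p X c"
    using singular_relboundary_add [of p "top_of_set X" "{}" "c - d" d] assms
    by (simp add: homologous_rel_def)
qed

section \<open>Paths and points as singular chains\<close>

definition path_chain :: "(real \<Rightarrow> 'a) \<Rightarrow> 'a chain"
  where "path_chain g = frag_of (restrict (\<lambda>x. g (x 1)) (standard_simplex 1))"

definition point_chain :: "'a \<Rightarrow> 'a chain"
  where "point_chain a = frag_of (restrict (\<lambda>x. a) (standard_simplex 0))"

lemma path_chain_in:
  assumes "continuous_on {0..1} g" "g ` {0..1} \<subseteq> S"
  shows "chain_in 1 S (path_chain g)"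
proof -
  have im: "(\<lambda>x. x 1) ` standard_simplex 1 \<subseteq> {0..1}"
    by (auto simp: standard_simplex_def)
  have "continuous_on (standard_simplex 1) (g \<circ> (\<lambda>x. x 1))"
    using assms im by (intro continuous_on_compose) (auto intro: continuous_on_subset continuous_on_product_coordinates)
  then have "continuous_on (standard_simplex 1) (restrict (\<lambda>x. g (x 1)) (standard_simplex 1))"
    by (simp add: o_def cong: continuous_on_cong)
  then show ?thesis
    using assms im unfolding path_chain_def singular_chain_of singular_simplex_top_of_set by auto
qed

lemma boundary_path_chain: "chain_boundary 1 (path_chain g) = point_chain (g 1) - point_chain (g 0)"
proof -
  have "singular_face (Suc 0) 0 (restrict (\<lambda>x. g (x 1)) (standard_simplex 1)) = restrict (\<lambda>x. g 1) (standard_simplex 0)"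
    "singular_face (Suc 0) (Suc 0) (restrict (\<lambda>x. g (x 1)) (standard_simplex 1)) = restrict (\<lambda>x. g 0) (standard_simplex 0)"
    by (auto simp: singular_face_def standard_simplex_0 fun_eq_iff simplical_face_def standard_simplex_def)
  then show ?thesis
    by (simp add: path_chain_def point_chain_def chain_boundary_of)
qed

lemma chain_map_path_chain: "chain_map 1 h (path_chain g) = path_chain (h \<circ> g)"
proof -
  have "simplex_map 1 h (restrict (\<lambda>x. g (x 1)) (standard_simplex 1))
      = restrict (\<lambda>x. (h \<circ> g) (x 1)) (standard_simplex 1)"
    by (auto simp: simplex_map_def fun_eq_iff restrict_def)
  then show ?thesis
    by (simp add: path_chain_def)
qed

lemma path_chain_cong:
  assumes "\<And>t. t \<in> {0..1} \<Longrightarrow> g t = h t"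
  shows "path_chain g = path_chain h"
proof -
  have "x 1 \<in> {0..1}" if "x \<in> standard_simplex 1" for x
    using that by (auto simp: standard_simplex_def)
  with assms have "restrict (\<lambda>x. g (x 1)) (standard_simplex 1) = restrict (\<lambda>x. h (x 1)) (standard_simplex 1)"
    by (auto simp: fun_eq_iff restrict_def)
  then show ?thesis
    by (simp add: path_chain_def)
qed

lemma simplex_eq_path_chain:
  assumes "singular_simplex 1 (top_of_set S) \<sigma>"
  shows "frag_of \<sigma> = path_chain (\<lambda>t. \<sigma> (edge t))"
proof -
  have "\<sigma> = restrict (\<lambda>x. \<sigma> (edge (x 1))) (standard_simplex 1)"
  proof
    fix x
    show "\<sigma> x = restrict (\<lambda>x. \<sigma> (edge (x 1))) (standard_simplex 1) x"
      using assms standard_simplex_1_eq [of x] unfolding singular_simplex_top_of_set extensional_def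
      by (cases "x \<in> standard_simplex 1") auto
  qed
  then show ?thesis
    unfolding path_chain_def by (rule arg_cong [where f = frag_of])
qed

lemma point_chain_in: "a \<in> S \<Longrightarrow> chain_in 0 S (point_chain a)"
  by (auto simp: point_chain_def singular_chain_of singular_simplex_top_of_set standard_simplex_0)

lemma aug_point_chain [simp]: "aug (point_chain a) = 1"
  by (simp add: point_chain_def pt_eval_def)

lemma winding_path_chain:
  assumes "continuous_on {0..1} L" "\<And>t. t \<in> {0..1} \<Longrightarrow> f (g t) = exp (L t)"
  shows "winding f (path_chain g) = (L 1 - L 0) / (2 * of_real pi * \<i>)"
  unfolding winding_def path_chain_def frag_eval_of
proof (rule winding1_eq [OF assms(1)])
  fix t :: real assume t: "t \<in> {0..1}"
  then have "edge t \<in> standard_simplex 1" "edge t 1 = t"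
    using edge_in by (auto simp: edge_def)
  then show "f (restrict (\<lambda>x. g (x 1)) (standard_simplex 1) (edge t)) = exp (L t)"
    using assms(2) [OF t] by simp
qed

section \<open>Thickened tori and tube complements\<close>

text \<open>Homotopy equivalent to a torus, and a cone because the conditions are homogeneous. In
  the applications the first coordinate is a form without zeros on the piece, and the second one
  measures the distance to a hyperplane.\<close>

definition shell :: "real \<Rightarrow> real \<Rightarrow> (complex \<times> complex) set"
  where "shell a b = {x. a * norm (fst x) < norm (snd x) \<and> norm (snd x) < b * norm (fst x)}"

text \<open>On the convex set \<open>log_shell\<close> below this is the universal covering of the
  shell; translations by a \<open>period\<close> are its deck transformations.\<close>

definition exp2 :: "complex \<times> complex \<Rightarrow> complex \<times> complex"
  where "exp2 u = (exp (fst u), exp (snd u))"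

context
  fixes a b :: real
  assumes ab: "0 < a" "a < b"
begin

lemma shell_nonzero: "x \<in> shell a b \<Longrightarrow> fst x \<noteq> 0" "x \<in> shell a b \<Longrightarrow> snd x \<noteq> 0"
proof -
  assume "x \<in> shell a b"
  then have x: "a * norm (fst x) < norm (snd x)" "norm (snd x) < b * norm (fst x)"
    by (auto simp: shell_def)
  moreover have "0 \<le> a * norm (fst x)"
    using ab by simp
  ultimately show "fst x \<noteq> 0" "snd x \<noteq> 0"
    by auto
qed

definition log_shell :: "(complex \<times> complex) set"
  where "log_shell = {u. ln a < Re (snd u) - Re (fst u) \<and> Re (snd u) - Re (fst u) < ln b}"

lemma convex_log_shell: "convex log_shell"
proof -
  have "log_shell = {u. ln a < (-1, 1) \<bullet> u} \<inter> {u. (-1, 1) \<bullet> u < ln b}"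
    by (auto simp: log_shell_def inner_prod_def inner_complex_def)
  then show ?thesis
    by (metis convex_Int convex_halfspace_gt convex_halfspace_lt)
qed

lemma exp2_in_shell: "exp2 u \<in> shell a b \<longleftrightarrow> u \<in> log_shell"
proof -
  have "a * exp (Re (fst u)) < exp (Re (snd u)) \<longleftrightarrow> ln a < Re (snd u) - Re (fst u)"
    using ab ln_less_cancel_iff [of "a * exp (Re (fst u))" "exp (Re (snd u))"]
    by (simp add: ln_mult) linarith
  moreover have "exp (Re (snd u)) < b * exp (Re (fst u)) \<longleftrightarrow> Re (snd u) - Re (fst u) < ln b"
    using ab ln_less_cancel_iff [of "exp (Re (snd u))" "b * exp (Re (fst u))"]
    by (simp add: ln_mult) linarith
  ultimately show ?thesis
    by (simp add: shell_def exp2_def log_shell_def norm_exp_eq_Re)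
qed

lemma continuous_exp2: "continuous_on S exp2"
  unfolding exp2_def by (intro continuous_intros)

lemma exp2_surj: "fst x \<noteq> 0 \<Longrightarrow> snd x \<noteq> 0 \<Longrightarrow> exp2 (Ln (fst x), Ln (snd x)) = x"
  by (simp add: exp2_def)

lemma shell_eq: "shell a b = exp2 ` log_shell"
proof (intro equalityI subsetI)
  fix x assume x: "x \<in> shell a b"
  then have "exp2 (Ln (fst x), Ln (snd x)) = x"
    using exp2_surj shell_nonzero by blast
  then show "x \<in> exp2 ` log_shell"
    using x exp2_in_shell [of "(Ln (fst x), Ln (snd x))"] by force
qed (auto simp: exp2_in_shell)

lemma path_connected_shell: "path_connected (shell a b)"
  unfolding shell_eq by (intro path_connected_continuous_image continuous_exp2 convex_imp_path_connected convex_log_shell)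

definition base_log :: "complex \<times> complex"
  where "base_log = (0, of_real (ln ((a + b) / 2)))"

definition period :: "int \<times> int \<Rightarrow> complex \<times> complex"
  where "period k = (of_int (fst k) * (2 * of_real pi * \<i>), of_int (snd k) * (2 * of_real pi * \<i>))"

lemma exp2_period: "exp2 (u + period k) = exp2 u"
proof -
  have "exp (x + of_int m * (2 * of_real pi * \<i>)) = exp x" for x m
    using exp_eq [of "x + of_int m * (2 * of_real pi * \<i>)" x] by (auto intro!: exI [of _ m])
  then show ?thesis by (simp add: exp2_def period_def)
qed

lemma period_in_log_shell: "u + period k \<in> log_shell \<longleftrightarrow> u \<in> log_shell"
  by (metis exp2_in_shell exp2_period)

lemma base_log_in: "base_log \<in> log_shell"
  using ab by (auto simp: base_log_def log_shell_def)

text \<open>Projection of the segment from the base point of the covering to its translate by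
  \<open>period k\<close>: the element \<open>k\<close> of the fundamental group, which is free
  abelian of rank 2.\<close>

definition std_loop :: "int \<times> int \<Rightarrow> (complex \<times> complex) chain"
  where "std_loop k = path_chain (exp2 \<circ> linepath base_log (base_log + period k))"

text \<open>One fixed path from the base point to each point. The principal values make the choice
  definite; as only end points of edges are inserted, it may jump with \<open>x\<close>.\<close>

definition tail :: "complex \<times> complex \<Rightarrow> (complex \<times> complex) chain"
  where "tail x = path_chain (exp2 \<circ> linepath base_log (Ln (fst x), Ln (snd x)))"

lemma linepath_in: "u \<in> log_shell \<Longrightarrow> v \<in> log_shell \<Longrightarrow> linepath u v ` {0..1} \<subseteq> log_shell"
  using convex_log_shell by (metis closed_segment_subset path_image_def path_image_linepath)

lemma seg_chain_in:
  "u \<in> log_shell \<Longrightarrow> v \<in> log_shell \<Longrightarrow> chain_in 1 log_shell (path_chain (linepath u v))"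
  by (intro path_chain_in linepath_in) (auto intro: continuous_on_linepath)

text \<open>The covering space is convex, so every closed polygon in it bounds. The homology
  relations in the shell below are images of such polygons.\<close>

lemma exp2_push:
  assumes "cycle_in 1 log_shell c"
  shows "bounds_in 1 (shell a b) (chain_map 1 exp2 c)"
  using convex_cycle_bounds [OF convex_log_shell assms]
  by (rule bounds_map_in [OF _ continuous_exp2]) (auto simp: exp2_in_shell)

lemma linepath_shift: "linepath (u + w) (v + w) t = linepath u v t + w"
  by (simp add: linepath_def algebra_simps)

text \<open>Image of a triangle in the covering whose vertices are the base point and its translates
  by the periods of \<open>k\<close> and of \<open>k + m\<close>. A deck transformation carries the
  segment defining \<open>std_loop m\<close> to the second side.\<close>

lemma std_loop_add: "bounds_in 1 (shell a b) (std_loop k + std_loop m - std_loop (k + m))"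
proof -
  let ?e = base_log
  let ?c = "path_chain (linepath ?e (?e + period k)) + path_chain (linepath (?e + period k) (?e + period m + period k))
     - path_chain (linepath ?e (?e + period (k + m)))"
  have pkm: "?e + period m + period k = ?e + period (k + m)"
    by (simp add: period_def algebra_simps)
  have "cycle_in 1 log_shell ?c"
    unfolding singular_cycle
    by (auto simp: chain_boundary_add chain_boundary_diff boundary_path_chain linepath_0' linepath_1' pkm
        period_in_log_shell base_log_in simp del: One_nat_def
        intro!: singular_chain_add singular_chain_diff seg_chain_in)
  from exp2_push [OF this]
  have "bounds_in 1 (shell a b) (path_chain (exp2 \<circ> linepath ?e (?e + period k))
     + path_chain (exp2 \<circ> linepath (?e + period k) (?e + period m + period k))
     - path_chain (exp2 \<circ> linepath ?e (?e + period (k + m))))"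
    by (simp add: chain_map_add chain_map_diff chain_map_path_chain del: One_nat_def)
  moreover have "exp2 \<circ> linepath (?e + period k) (?e + period m + period k) = exp2 \<circ> linepath ?e (?e + period m)"
    by (simp add: fun_eq_iff linepath_shift exp2_period)
  ultimately show ?thesis
    by (simp add: std_loop_def)
qed

lemma std_loop_0: "bounds_in 1 (shell a b) (std_loop 0)"
  using std_loop_add [of 0 0] by simp

text \<open>The edge is lifted to the covering, starting at the principal logarithm of its initial
  point. The lift ends at a translate, by some period \<open>k\<close>, of the principal logarithm
  of the final point. The two tails, one of them translated, and the segment to the translated base
  point close it to a quadrilateral.\<close>

lemma simplex_homologous_loop:
  assumes \<sigma>: "singular_simplex 1 (top_of_set (shell a b)) \<sigma>"
  shows "\<exists>k. bounds_in 1 (shell a b)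
     (frag_of \<sigma> - (std_loop k + tail (\<sigma> (edge 1)) - tail (\<sigma> (edge 0))))"
proof -
  let ?e = base_log
  have \<sigma>_in: "\<sigma> (edge t) \<in> shell a b" if "t \<in> {0..1}" for t
    using \<sigma> edge_in [OF that] by (auto simp: singular_simplex_top_of_set)
  have cfs: "continuous_on (shell a b) fst" "continuous_on (shell a b) snd"
    by (intro continuous_intros)+
  obtain L where L: "continuous_on {0..1} L" "\<And>t. t \<in> {0..1} \<Longrightarrow> fst (\<sigma> (edge t)) = exp (L t)"
    using log_along_edge [OF cfs(1) shell_nonzero(1) \<sigma>] by blast
  obtain M where M: "continuous_on {0..1} M" "\<And>t. t \<in> {0..1} \<Longrightarrow> snd (\<sigma> (edge t)) = exp (M t)"
    using log_along_edge [OF cfs(2) shell_nonzero(2) \<sigma>] by blast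
  have lg: "\<exists>k. (L t, M t) = (Ln (fst (\<sigma> (edge t))), Ln (snd (\<sigma> (edge t)))) + period k" if t: "t \<in> {0..1}" for t
  proof -
    have "exp (L t) = exp (Ln (fst (\<sigma> (edge t))))" "exp (M t) = exp (Ln (snd (\<sigma> (edge t))))"
      using L(2) [OF t] M(2) [OF t] by simp_all
    then obtain k m :: int where "L t = Ln (fst (\<sigma> (edge t))) + (of_int (2 * k) * pi) * \<i>"
      "M t = Ln (snd (\<sigma> (edge t))) + (of_int (2 * m) * pi) * \<i>"
      unfolding exp_eq by blast
    then show ?thesis
      by (intro exI [of _ "(k,m)"]) (simp add: period_def)
  qed
  obtain k0 k1 where k0: "(L 0, M 0) = (Ln (fst (\<sigma> (edge 0))), Ln (snd (\<sigma> (edge 0)))) + period k0"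
    and k1: "(L 1, M 1) = (Ln (fst (\<sigma> (edge 1))), Ln (snd (\<sigma> (edge 1)))) + period k1"
    using lg [of 0] lg [of 1] by auto
  \<comment> \<open>Subtracting the period \<open>k0\<close> makes the lift start exactly where the
    lift of the tail ends.\<close>
  define g where "g t = (L t, M t) + period (- k0)" for t
  define k where "k = k1 - k0"
  let ?x0 = "(Ln (fst (\<sigma> (edge 0))), Ln (snd (\<sigma> (edge 0))))"
  let ?x1 = "(Ln (fst (\<sigma> (edge 1))), Ln (snd (\<sigma> (edge 1))))"
  have per: "period (x + y) = period x + period y" for x y
    by (simp add: period_def algebra_simps)
  have per0: "period 0 = 0" by (simp add: period_def zero_prod_def)
  have g0: "g 0 = ?x0"
    unfolding g_def k0 by (simp only: add.assoc per [symmetric]) (simp add: per0)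
  have g1: "g 1 = ?x1 + period k"
    unfolding g_def k1 k_def by (simp only: add.assoc per [symmetric]) simp
  have exg: "exp2 (g t) = \<sigma> (edge t)" if "t \<in> {0..1}" for t
    unfolding g_def exp2_period using L(2) [OF that] M(2) [OF that] by (simp add: exp2_def prod_eq_iff)
  have gin: "g ` {0..1} \<subseteq> log_shell"
    using exg \<sigma>_in by (auto simp flip: exp2_in_shell)
  have gcont: "continuous_on {0..1} g"
    unfolding g_def using L(1) M(1) by (intro continuous_intros)
  have x0: "?x0 \<in> log_shell" and x1: "?x1 + period k \<in> log_shell"
    unfolding g0 [symmetric] g1 [symmetric] using gin by auto
  let ?c = "path_chain (linepath ?e ?x0) + path_chain g - path_chain (linepath ?e (?e + period k))
     - path_chain (linepath (?e + period k) (?x1 + period k))"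
  have "cycle_in 1 log_shell ?c"
    unfolding singular_cycle
  proof
    show "chain_in 1 log_shell ?c"
      using x0 x1 gin gcont
      by (intro singular_chain_add singular_chain_diff seg_chain_in path_chain_in)
         (auto simp: period_in_log_shell base_log_in)
    show "chain_boundary 1 ?c = 0"
      by (simp add: chain_boundary_add chain_boundary_diff boundary_path_chain linepath_0' linepath_1' g0 g1
          del: One_nat_def)
  qed
  from exp2_push [OF this]
  have "bounds_in 1 (shell a b) (path_chain (exp2 \<circ> linepath ?e ?x0) + path_chain (exp2 \<circ> g)
     - path_chain (exp2 \<circ> linepath ?e (?e + period k))
     - path_chain (exp2 \<circ> linepath (?e + period k) (?x1 + period k)))"
    by (simp add: chain_map_add chain_map_diff chain_map_path_chain del: One_nat_def)
  moreover have "path_chain (exp2 \<circ> g) = frag_of \<sigma>"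
    unfolding simplex_eq_path_chain [OF \<sigma>] by (rule path_chain_cong) (simp add: exg)
  moreover have "exp2 \<circ> linepath (?e + period k) (?x1 + period k) = exp2 \<circ> linepath ?e ?x1"
    by (simp add: fun_eq_iff linepath_shift exp2_period)
  ultimately have "bounds_in 1 (shell a b) (tail (\<sigma> (edge 0)) + frag_of \<sigma> - std_loop k - tail (\<sigma> (edge 1)))"
    unfolding tail_def std_loop_def by simp
  then show ?thesis
    by (intro exI [of _ k]) (simp add: algebra_simps)
qed

definition tails :: "(complex \<times> complex) chain \<Rightarrow> (complex \<times> complex) chain"
  where "tails = frag_extend (\<lambda>\<tau>. tail (\<tau> vertex))"

text \<open>The tails make the statement meaningful for chains that are not closed, so that it can
  be proved by induction over simplices. On a cycle they cancel.\<close>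

lemma chain_homologous_loop:
  assumes "chain_in 1 (shell a b) c"
  shows "\<exists>k. bounds_in 1 (shell a b) (c - (std_loop k + tails (chain_boundary 1 c)))"
  using assms
proof (induction rule: chain_in_induct)
  case zero
  show ?case
    using std_loop_0 by (intro exI [of _ 0]) (simp add: tails_def singular_relboundary_minus)
next
  case (one \<sigma>)
  have "tails (chain_boundary 1 (frag_of \<sigma>)) = tail (\<sigma> (edge 1)) - tail (\<sigma> (edge 0))"
    by (simp add: tails_def chain_boundary_of frag_extend_diff singular_face_vertex)
  then show ?case
    using simplex_homologous_loop [OF one] by (simp add: add_diff_eq)
next
  case (diff c d)
  then obtain k m where k: "bounds_in 1 (shell a b) (c - (std_loop k + tails (chain_boundary 1 c)))"
    and m: "bounds_in 1 (shell a b) (d - (std_loop m + tails (chain_boundary 1 d)))" by blast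
  have "bounds_in 1 (shell a b) (std_loop m + std_loop (k - m) - std_loop k)"
    using std_loop_add [of m "k - m"] by simp
  then have "bounds_in 1 (shell a b) ((c - (std_loop k + tails (chain_boundary 1 c)))
     - (d - (std_loop m + tails (chain_boundary 1 d))) - (std_loop m + std_loop (k - m) - std_loop k))"
    using singular_relboundary_diff [OF singular_relboundary_diff [OF k m]] by blast
  moreover have "tails (chain_boundary 1 (c - d)) = tails (chain_boundary 1 c) - tails (chain_boundary 1 d)"
    by (simp add: tails_def chain_boundary_diff frag_extend_diff)
  then have "(c - (std_loop k + tails (chain_boundary 1 c))) - (d - (std_loop m + tails (chain_boundary 1 d)))
       - (std_loop m + std_loop (k - m) - std_loop k)
     = (c - d) - (std_loop (k - m) + tails (chain_boundary 1 (c - d)))"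
    by (simp only:) (simp add: algebra_simps)
  ultimately show ?case
    by metis
qed

lemma winding_std_loop:
  "winding fst (std_loop k) = of_int (fst k)" "winding snd (std_loop k) = of_int (snd k)"
proof -
  let ?\<kappa> = "2 * of_real pi * \<i>"
  have "winding fst (std_loop k) = (of_real 1 * of_int (fst k) * ?\<kappa> - of_real 0 * of_int (fst k) * ?\<kappa>) / ?\<kappa>"
    unfolding std_loop_def
    by (intro winding_path_chain [of "\<lambda>t. of_real t * of_int (fst k) * ?\<kappa>"] continuous_intros)
       (simp add: exp2_def base_log_def linepath_def period_def algebra_simps scaleR_conv_of_real)
  then show "winding fst (std_loop k) = of_int (fst k)" by simp
  let ?l = "of_real (ln ((a + b) / 2)) :: complex"
  have "winding snd (std_loop k) = ((?l + of_real 1 * of_int (snd k) * ?\<kappa>) - (?l + of_real 0 * of_int (snd k) * ?\<kappa>)) / ?\<kappa>"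
    unfolding std_loop_def
    by (intro winding_path_chain [of "\<lambda>t. ?l + of_real t * of_int (snd k) * ?\<kappa>"] continuous_intros)
       (simp add: exp2_def base_log_def linepath_def period_def algebra_simps scaleR_conv_of_real)
  then show "winding snd (std_loop k) = of_int (snd k)" by simp
qed

lemma std_loop_cycle: "cycle_in 1 (shell a b) (std_loop k)"
proof -
  have "chain_in 1 (shell a b) (std_loop k)"
    unfolding std_loop_def
  proof (rule path_chain_in)
    show "continuous_on {0..1} (exp2 \<circ> linepath base_log (base_log + period k))"
      by (intro continuous_on_compose continuous_on_linepath continuous_exp2)
    show "(exp2 \<circ> linepath base_log (base_log + period k)) ` {0..1} \<subseteq> shell a b"
      using linepath_in [of base_log "base_log + period k"]
      by (auto simp: exp2_in_shell period_in_log_shell base_log_in image_subset_iff)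
  qed
  then show ?thesis
    by (simp add: singular_cycle std_loop_def boundary_path_chain linepath_0' linepath_1' exp2_period del: One_nat_def)
qed

lemma shell_loop_exists:
  obtains c where "cycle_in 1 (shell a b) c" "winding fst c = of_int p" "winding snd c = of_int q"
  using std_loop_cycle [of "(p, q)"] winding_std_loop [of "(p, q)"] that by simp

text \<open>\<open>c\<close> is homologous to some \<open>std_loop k\<close>, and its two windings
  are the components of \<open>k\<close>.\<close>

lemma shell_cycle_bounds:
  assumes c: "cycle_in 1 (shell a b) c" and w: "winding fst c = 0" "winding snd c = 0"
  shows "bounds_in 1 (shell a b) c"
proof -
  obtain k where "bounds_in 1 (shell a b) (c - (std_loop k + tails (chain_boundary 1 c)))"
    using chain_homologous_loop [OF cycle_in_imp_chain_in [OF c]] by blast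
  then have k: "bounds_in 1 (shell a b) (c - std_loop k)"
    using c by (simp add: singular_cycle tails_def)
  have "winding fst (c - std_loop k) = 0" "winding snd (c - std_loop k) = 0"
    using shell_nonzero by (auto intro!: winding_bounds [OF k] continuous_intros)
  then have "k = 0"
    using w by (simp add: winding_diff winding_std_loop prod_eq_iff)
  with k std_loop_0 show ?thesis
    using singular_relboundary_add by fastforce
qed

end

text \<open>Mayer-Vietoris for the punctured plane, covered by \<open>D\<close> and by tubes of the
  larger width \<open>\<epsilon>'\<close>, whose intersections with \<open>D\<close> are shells in
  the coordinates \<open>\<gamma> k\<close>, \<open>\<beta> k\<close>. A cycle of \<open>D\<close>
  bounds in the punctured plane, so it is homologous in \<open>D\<close> to shell cycles that bound
  in the tubes. There \<open>\<gamma> k\<close> has no zero, which kills one winding; the hypothesis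
  kills the other.\<close>

lemma tube_complement:
  fixes \<beta> \<gamma> :: "'i \<Rightarrow> complex \<times> complex \<Rightarrow> complex" and \<phi> :: "'i \<Rightarrow> complex \<times> complex \<Rightarrow> complex \<times> complex"
  assumes K: "finite K" and \<epsilon>: "0 < \<epsilon>" "\<epsilon> < \<epsilon>'"
    and cont: "\<And>k S. k \<in> K \<Longrightarrow> continuous_on S (\<beta> k)" "\<And>k S. k \<in> K \<Longrightarrow> continuous_on S (\<gamma> k)"
      "\<And>k S. k \<in> K \<Longrightarrow> continuous_on S (\<phi> k)"
    and inv: "\<And>k x. k \<in> K \<Longrightarrow> \<phi> k (\<gamma> k x, \<beta> k x) = x"
      "\<And>k y. k \<in> K \<Longrightarrow> \<gamma> k (\<phi> k y) = fst y" "\<And>k y. k \<in> K \<Longrightarrow> \<beta> k (\<phi> k y) = snd y"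
    and zero: "\<And>k. k \<in> K \<Longrightarrow> \<beta> k 0 = 0" "\<And>k. k \<in> K \<Longrightarrow> \<gamma> k 0 = 0"
    and disj: "\<And>k l x. k \<in> K \<Longrightarrow> l \<in> K \<Longrightarrow> k \<noteq> l \<Longrightarrow> norm (\<beta> k x) < \<epsilon>' * norm (\<gamma> k x) \<Longrightarrow>
        norm (\<beta> l x) < \<epsilon>' * norm (\<gamma> l x) \<Longrightarrow> False"
  defines "D \<equiv> {x. x \<noteq> 0 \<and> (\<forall>k\<in>K. \<epsilon> * norm (\<gamma> k x) < norm (\<beta> k x))}"
  shows tube_complement_H1: "cycle_in 1 D c \<Longrightarrow> (\<And>k. k \<in> K \<Longrightarrow> winding (\<beta> k) c = 0) \<Longrightarrow> bounds_in 1 D c"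
    and tube_complement_H0: "chain_in 0 D z \<Longrightarrow> aug z = 0 \<Longrightarrow> bounds_in 0 D z"
proof -
  define T where "T k = {x. norm (\<beta> k x) < \<epsilon>' * norm (\<gamma> k x)}" for k
  define TT where "TT = \<Union>(T ` K)"
  let ?P = "UNIV - {0 :: complex \<times> complex}"
  have g0: "\<gamma> k x \<noteq> 0" if "x \<in> T k" for k x
    using that \<epsilon> by (auto simp: T_def)
  have T0: "0 \<notin> T k" if "k \<in> K" for k
    using zero [OF that] by (simp add: T_def)
  have ker: "x = 0" if "k \<in> K" "\<beta> k x = 0" "\<gamma> k x = 0" for k x
    using inv(1) [OF that(1), of x] inv(1) [OF that(1), of 0] zero that by simp
  have b0: "\<beta> l x \<noteq> 0" if "k \<in> K" "l \<in> K" "k \<noteq> l" "x \<in> T k" for k l x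
  proof
    assume "\<beta> l x = 0"
    moreover have "\<not> norm (\<beta> l x) < \<epsilon>' * norm (\<gamma> l x)"
      using disj [of k l x] that by (auto simp: T_def)
    ultimately have "\<gamma> l x = 0"
      using \<epsilon> by (auto simp: zero_less_mult_iff)
    then have "x = 0" using ker that \<open>\<beta> l x = 0\<close> by blast
    then show False using T0 that by blast
  qed
  have bD: "\<beta> k x \<noteq> 0" if "k \<in> K" "x \<in> D" for k x
  proof
    assume "\<beta> k x = 0"
    then have "\<epsilon> * norm (\<gamma> k x) < 0" using that by (auto simp: D_def)
    then show False using \<epsilon> by (simp add: mult_less_0_iff)
  qed
  have DT: "D \<union> TT = ?P"
  proof (intro equalityI subsetI)
    fix x :: "complex \<times> complex" assume "x \<in> ?P"
    show "x \<in> D \<union> TT"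
    proof (cases "x \<in> D")
      case False
      with \<open>x \<in> ?P\<close> obtain k where k: "k \<in> K" "norm (\<beta> k x) \<le> \<epsilon> * norm (\<gamma> k x)"
        by (auto simp: D_def not_less)
      then have "\<gamma> k x \<noteq> 0"
        using ker [of k x] \<open>x \<in> ?P\<close> by auto
      then have "\<epsilon> * norm (\<gamma> k x) < \<epsilon>' * norm (\<gamma> k x)"
        using \<epsilon> by simp
      then have "x \<in> T k" using k by (simp add: T_def)
      then show ?thesis using k by (auto simp: TT_def)
    qed auto
  qed (use T0 in \<open>auto simp: D_def TT_def\<close>)
  have opT: "open (T k)" if "k \<in> K" for k
    unfolding T_def using that by (intro open_Collect_less continuous_intros cont)
  have opD: "open D"
  proof -
    have "D = - {0} \<inter> (\<Inter>k\<in>K. {x. \<epsilon> * norm (\<gamma> k x) < norm (\<beta> k x)})"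
      by (auto simp: D_def)
    then show ?thesis
      using K by (auto intro!: open_Int open_INT open_Collect_less continuous_intros cont)
  qed
  have op: "openin (top_of_set (D \<union> TT)) D" "openin (top_of_set (D \<union> TT)) TT"
    using opD opT by (auto simp: TT_def intro!: open_subset)
  have disjT: "T k \<inter> T l = {}" if "k \<in> K" "l \<in> K" "k \<noteq> l" for k l
    unfolding T_def using disj [OF that] by blast
  have sepT: "separated_family K T"
    unfolding separated_family_def disjoint_family_on_def
    using K disjT opT by (auto intro!: open_subset)
  \<comment> \<open>Inside tube \<open>k\<close> the conditions of \<open>D\<close> for the other
    tubes hold automatically, because the tubes of width \<open>\<epsilon>'\<close> are
    disjoint.\<close>
  have DTk: "D \<inter> T k = (\<phi> k) ` shell \<epsilon> \<epsilon>'" if k: "k \<in> K" for k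
  proof (intro equalityI subsetI)
    fix x assume "x \<in> D \<inter> T k"
    then have "(\<gamma> k x, \<beta> k x) \<in> shell \<epsilon> \<epsilon>'"
      using k by (auto simp: D_def T_def shell_def)
    then show "x \<in> \<phi> k ` shell \<epsilon> \<epsilon>'"
      using inv(1) [OF k] by (metis image_eqI)
  next
    fix x assume "x \<in> \<phi> k ` shell \<epsilon> \<epsilon>'"
    then obtain y where y: "y \<in> shell \<epsilon> \<epsilon>'" "x = \<phi> k y" by blast
    then have xk: "x \<in> T k" "\<epsilon> * norm (\<gamma> k x) < norm (\<beta> k x)"
      using inv(2,3) [OF k] by (auto simp: T_def shell_def)
    moreover have "\<epsilon> * norm (\<gamma> l x) < norm (\<beta> l x)" if l: "l \<in> K" "l \<noteq> k" for l
    proof -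
      have "\<beta> l x \<noteq> 0" using b0 k l xk by metis
      moreover have "\<epsilon>' * norm (\<gamma> l x) \<le> norm (\<beta> l x)"
        using disj [of k l x] k l xk by (force simp: T_def)
      moreover have "\<epsilon> * norm (\<gamma> l x) < \<epsilon>' * norm (\<gamma> l x)" if "\<gamma> l x \<noteq> 0"
        using \<epsilon> that by simp
      ultimately show ?thesis
        by (cases "\<gamma> l x = 0") (simp, linarith)
    qed
    moreover have "x \<noteq> 0" using xk T0 k by blast
    ultimately show "x \<in> D \<inter> T k" by (auto simp: D_def)
  qed
  define V where "V k = D \<inter> T k" for k
  have sepV: "separated_family K V"
    by (rule separated_subfamily [OF sepT, of _ D]) (auto simp: V_def)
  have VTT: "\<Union>(V ` K) = D \<inter> TT" by (auto simp: V_def TT_def)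
  show "bounds_in 1 D c" if c: "cycle_in 1 D c" and w: "\<And>k. k \<in> K \<Longrightarrow> winding (\<beta> k) c = 0"
  proof -
    have "bounds_in 1 ?P c"
      by (rule punctured_plane_cycle_bounds [OF cycle_in_mono [OF c]]) (use DT in blast)
    then obtain e where e: "cycle_in 1 (D \<inter> TT) e" "homologous_rel 1 (top_of_set D) {} c e" "bounds_in 1 TT e"
      using MV_kernel [OF op c] unfolding DT by metis
    have eV: "cycle_in (Suc 0) (\<Union>(V ` K)) e"
      using e(1) by (simp add: VTT)
    have esum: "e = (\<Sum>k\<in>K. chain_part 1 (V k) e)"
      using chain_sum_parts [OF sepV cycle_in_imp_chain_in [OF eV]] by simp
    \<comment> \<open>Since \<open>e\<close> lies in \<open>D\<close>, cutting it by the tube or by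
      the shell inside the tube gives the same chain; \<open>bounds_part\<close> applies to the
      former, \<open>cycle_part\<close> to the latter.\<close>
    have part_eq: "chain_part 1 (V k) e = chain_part 1 (T k) e" if k: "k \<in> K" for k
    proof -
      have in_T: "chain_in 1 (T l) (chain_part 1 (V l) e)" if "l \<in> K" for l
        using cycle_in_imp_chain_in [OF cycle_part [OF sepV that eV]] chain_in_mono [of 1 "V l" _ "T l"]
        by (simp add: V_def)
      have "chain_part 1 (T k) (chain_part 1 (V l) e) = (if l = k then chain_part 1 (V k) e else 0)" if "l \<in> K" for l
        using that k disjT [of k l] part_self [OF in_T [OF k]] part_disjoint [OF in_T [OF that], of "T k"] by auto
      moreover have "chain_part 1 (T k) e = (\<Sum>l\<in>K. chain_part 1 (T k) (chain_part 1 (V l) e))"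
        by (subst esum) (rule part_sum)
      ultimately show ?thesis
        using K k by simp
    qed
    have "bounds_in 1 D (chain_part 1 (V k) e)" if k: "k \<in> K" for k
    proof -
      let ?ek = "chain_part 1 (V k) e"
      have ek: "cycle_in 1 (V k) ?ek"
        using cycle_part [OF sepV k eV] by simp
      have bk: "bounds_in 1 (T l) (chain_part 1 (V l) e)" if "l \<in> K" for l
        using bounds_part [OF sepT that, of 1 e] e(3) that part_eq by (simp add: TT_def)
      have wg: "winding (\<gamma> k) ?ek = 0"
        using g0 k by (intro winding_bounds [OF bk] cont) auto
      \<comment> \<open>The parts of \<open>e\<close> in the other tubes bound where
        \<open>\<beta> k\<close> has no zero, so the whole winding of \<open>e\<close> under
        \<open>\<beta> k\<close> comes from tube \<open>k\<close>.\<close>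
      have "winding (\<beta> k) (chain_part 1 (V l) e) = 0" if "l \<in> K" "l \<noteq> k" for l
        using b0 [of l k] k that by (intro winding_bounds [OF bk] cont) auto
      then have "(\<Sum>l\<in>K. winding (\<beta> k) (chain_part 1 (V l) e)) = winding (\<beta> k) ?ek"
        using K k by (subst sum.remove [of _ k]) auto
      then have "winding (\<beta> k) e = winding (\<beta> k) ?ek"
        by (subst esum) (simp add: winding_sum)
      moreover have "winding (\<beta> k) e = winding (\<beta> k) c"
        using winding_homologous [OF e(2) cont(1)] k bD by force
      ultimately have wb: "winding (\<beta> k) ?ek = 0"
        using w k by simp
      let ?y = "chain_map 1 (\<lambda>x. (\<gamma> k x, \<beta> k x)) ?ek"
      have "cycle_in 1 (shell \<epsilon> \<epsilon>') ?y"
        using k by (intro cycle_map_in [OF ek] continuous_intros cont) (auto simp: V_def D_def T_def shell_def)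
      moreover have "winding fst ?y = 0" "winding snd ?y = 0"
        using wg wb by (simp_all only: winding_chain_map o_def fst_conv snd_conv)
      ultimately have "bounds_in 1 (shell \<epsilon> \<epsilon>') ?y"
        using shell_cycle_bounds \<epsilon> by blast
      then have "bounds_in 1 D (chain_map 1 (\<phi> k) ?y)"
        by (rule bounds_map_in [OF _ cont(3) [OF k]]) (use DTk [OF k] in auto)
      moreover have "chain_map 1 (\<phi> k) ?y = ?ek"
        using chain_map_id_gen [OF cycle_in_imp_chain_in [OF ek], of "\<phi> k \<circ> (\<lambda>x. (\<gamma> k x, \<beta> k x))"] inv(1) [OF k]
        by (simp add: chain_map_compose)
      ultimately show ?thesis by simp
    qed
    then have "bounds_in 1 D (\<Sum>k\<in>K. chain_part 1 (V k) e)"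
      by (rule bounds_in_sum)
    then show ?thesis
      unfolding homologous_bounds [OF e(2)] by (subst esum)
  qed
  \<comment> \<open>The same argument one degree lower: a 0-chain that bounds in a tube has
    augmentation 0 there, and the shells are path connected.\<close>
  show "bounds_in 0 D z" if z: "chain_in 0 D z" and a: "aug z = 0"
  proof -
    have "path_connected ?P"
      using path_connected_punctured_universe [of "0 :: complex \<times> complex"] by (simp add: Compl_eq_Diff_UNIV)
    moreover have "chain_in 0 ?P z"
      by (rule chain_in_mono [OF z]) (use DT in blast)
    ultimately have "bounds_in 0 ?P z"
      using a by (intro aug_zero_bounds)
    moreover have "cycle_in 0 D z"
      using z by (simp add: singular_cycle chain_boundary_def)
    ultimately obtain e where e: "cycle_in 0 (D \<inter> TT) e" "homologous_rel 0 (top_of_set D) {} z e" "bounds_in 0 TT e"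
      using MV_kernel [OF op] unfolding DT by metis
    have eV: "chain_in 0 (\<Union>(V ` K)) e"
      using e(1) by (simp add: VTT singular_cycle)
    have esum: "e = (\<Sum>k\<in>K. chain_part 0 (V k) e)"
      using chain_sum_parts [OF sepV eV] by simp
    have ek: "chain_in 0 (V k) (chain_part 0 (V k) e)" for k
      by (rule chain_in_mono [OF part_in [OF eV]]) auto
    have part_eq: "chain_part 0 (V k) e = chain_part 0 (T k) e" if k: "k \<in> K" for k
    proof -
      have "T k \<inter> V l = {}" if "l \<in> K" "l \<noteq> k" for l
        using disjT that k by (auto simp: V_def)
      moreover have "chain_part 0 (T k) (chain_part 0 (V k) e) = chain_part 0 (V k) e"
        by (rule part_self [OF chain_in_mono [OF ek]]) (simp add: V_def)
      ultimately have "chain_part 0 (T k) (chain_part 0 (V l) e) = (if l = k then chain_part 0 (V k) e else 0)" if "l \<in> K" for l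
        using that part_disjoint [OF ek] by auto
      moreover have "chain_part 0 (T k) e = (\<Sum>l\<in>K. chain_part 0 (T k) (chain_part 0 (V l) e))"
        by (subst esum) (rule part_sum)
      ultimately show ?thesis
        using K k by simp
    qed
    have "bounds_in 0 D (chain_part 0 (V k) e)" if k: "k \<in> K" for k
    proof -
      have "bounds_in 0 (T k) (chain_part 0 (V k) e)"
        using bounds_part [OF sepT k, of 0 e] e(3) k part_eq by (simp add: TT_def)
      then have "aug (chain_part 0 (V k) e) = 0"
        by (metis singular_boundary aug_boundary(2))
      moreover have "path_connected (V k)"
        unfolding V_def DTk [OF k] using k path_connected_shell [OF \<epsilon>]
        by (intro path_connected_continuous_image cont)
      ultimately have "bounds_in 0 (V k) (chain_part 0 (V k) e)"
        using ek by (intro aug_zero_bounds)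
      then show ?thesis
        by (rule bounds_in_mono) (simp add: V_def)
    qed
    then have "bounds_in 0 D (\<Sum>k\<in>K. chain_part 0 (V k) e)"
      by (rule bounds_in_sum)
    then show ?thesis
      unfolding homologous_bounds [OF e(2)] by (subst esum)
  qed
qed

lemma homologous_sum:
  "finite I \<Longrightarrow> (\<And>i. i \<in> I \<Longrightarrow> homologous_rel p X {} (f i) (g i)) \<Longrightarrow> homologous_rel p X {} (sum f I) (sum g I)"
  by (induction I rule: finite_induct) (auto intro: homologous_rel_add)

lemma cycle_in_sum: "(\<And>i. i \<in> I \<Longrightarrow> cycle_in p S (f i)) \<Longrightarrow> cycle_in p S (sum f I)"
  by (induction I rule: infinite_finite_induct) (auto intro: singular_relcycle_add)

lemma chain_in_sum: "(\<And>i. i \<in> I \<Longrightarrow> chain_in p S (f i)) \<Longrightarrow> chain_in p S (sum f I)"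
  by (induction I rule: infinite_finite_induct) (auto intro: singular_chain_add)

section \<open>Homology of a neck decomposition\<close>

definition upairs :: "nat \<Rightarrow> (nat \<times> nat) set"
  where "upairs n = {(i,j). i < j \<and> j < n}"

text \<open>Each pair stands for the triangle that it forms with vertex 0; these triangles are a
  basis of the cycle space of the complete graph.\<close>

definition upairs1 :: "nat \<Rightarrow> (nat \<times> nat) set"
  where "upairs1 n = {(i,j). 1 \<le> i \<and> i < j \<and> j < n}"

text \<open>An ordered pair stands for one end of a neck: the part of the neck between
  \<open>i\<close> and \<open>j\<close> that lies in core \<open>i\<close>.\<close>

definition opairs :: "nat \<Rightarrow> (nat \<times> nat) set"
  where "opairs n = {(i,j). i < n \<and> j < n \<and> i \<noteq> j}"

lemma finite_pairs [simp]: "finite (upairs n)" "finite (upairs1 n)" "finite (opairs n)"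
proof -
  have "opairs n \<subseteq> {..<n} \<times> {..<n}" "upairs n \<subseteq> {..<n} \<times> {..<n}" "upairs1 n \<subseteq> {..<n} \<times> {..<n}"
    by (auto simp: opairs_def upairs_def upairs1_def)
  then show "finite (upairs n)" "finite (upairs1 n)" "finite (opairs n)"
    by (meson finite_subset finite_SigmaI finite_lessThan)+
qed

lemma sum_opairs_upairs:
  fixes f :: "nat \<times> nat \<Rightarrow> 'a::comm_monoid_add"
  shows "sum f (opairs n) = (\<Sum>(i,j)\<in>upairs n. f (i,j) + f (j,i))"
proof -
  have "opairs n = upairs n \<union> prod.swap ` upairs n"
    by (auto simp: opairs_def upairs_def image_iff)
  moreover have "upairs n \<inter> prod.swap ` upairs n = {}"
    by (auto simp: upairs_def)
  ultimately have "sum f (opairs n) = sum f (upairs n) + sum f (prod.swap ` upairs n)"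
    by (simp add: sum.union_disjoint)
  also have "sum f (prod.swap ` upairs n) = (\<Sum>(i,j)\<in>upairs n. f (j,i))"
    by (subst sum.reindex) (auto simp: case_prod_unfold prod.swap_def)
  finally show ?thesis
    by (simp add: case_prod_unfold sum.distrib)
qed

lemma sum_opairs_row:
  fixes f :: "nat \<times> nat \<Rightarrow> 'a::comm_monoid_add"
  shows "sum f (opairs n) = (\<Sum>i<n. \<Sum>j\<in>{..<n} - {i}. f (i,j))"
proof -
  have "opairs n = Sigma {..<n} (\<lambda>i. {..<n} - {i})"
    by (auto simp: opairs_def)
  then show ?thesis
    by (simp add: sum.Sigma)
qed

definition antisym_fun :: "nat \<Rightarrow> (nat \<Rightarrow> nat \<Rightarrow> int) \<Rightarrow> bool"
  where "antisym_fun n P \<longleftrightarrow> (\<forall>i<n. \<forall>j<n. P j i = - P i j)"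

definition row_sum :: "nat \<Rightarrow> (nat \<Rightarrow> nat \<Rightarrow> int) \<Rightarrow> nat \<Rightarrow> int"
  where "row_sum n P i = (\<Sum>j<n. P i j)"

text \<open>\<open>P i j\<close> stands for the \<gamma>-winding of a cycle at the end (i,j) of a
  neck; cycles at the two ends that cancel in the neck have opposite windings, hence the skew
  symmetry. The multiple of \<open>n\<close> collects the term n - 2 of \<open>wind_opposite\<close>
  and one unit from each end.\<close>

definition relator :: "nat \<Rightarrow> (nat \<times> nat \<Rightarrow> int) \<Rightarrow> bool"
  where "relator n x \<longleftrightarrow> (\<exists>P. antisym_fun n P \<and>
           (\<forall>(i,j)\<in>upairs n. x (i,j) = row_sum n P i - row_sum n P j - int n * P i j))"

text \<open>The windings under the \<open>\<alpha> k\<close> with k \<noteq> i serve as coordinates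
  of cycles in core \<open>i\<close>; the one under \<open>\<alpha> i\<close> follows from
  \<open>wind_sum\<close>. In a neck \<open>\<gamma> i j\<close> and \<open>\<alpha> j\<close>
  suffice by \<open>wind_neck\<close>. \<open>A_inj\<close> and \<open>B_inj\<close> let cycles
  bound in all of \<open>X\<close>, because the charts of the pieces reach beyond the
  pieces.\<close>

locale neck_decomposition =
  fixes n :: nat and X :: "'v::real_normed_vector set" and A :: "nat \<Rightarrow> 'v set"
    and B :: "nat \<Rightarrow> nat \<Rightarrow> 'v set" and \<alpha> :: "nat \<Rightarrow> 'v \<Rightarrow> complex" and \<gamma> :: "nat \<Rightarrow> nat \<Rightarrow> 'v \<Rightarrow> complex"
    and x0 :: "nat \<Rightarrow> nat \<Rightarrow> 'v"
  assumes \<alpha>_cont: "\<And>i. i < n \<Longrightarrow> continuous_on X (\<alpha> i)"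
    and \<alpha>_nz: "\<And>i x. i < n \<Longrightarrow> x \<in> X \<Longrightarrow> \<alpha> i x \<noteq> 0"
    and \<gamma>_cont: "\<And>i j. (i,j) \<in> opairs n \<Longrightarrow> continuous_on X (\<gamma> i j)"
    and \<gamma>_nz: "\<And>i j x. (i,j) \<in> opairs n \<Longrightarrow> x \<in> B i j \<Longrightarrow> \<gamma> i j x \<noteq> 0"
    and A_open: "\<And>i. i < n \<Longrightarrow> openin (top_of_set X) (A i)"
    and B_open: "\<And>i j. (i,j) \<in> opairs n \<Longrightarrow> openin (top_of_set X) (B i j)"
    and sym: "\<And>i j. B i j = B j i" "\<And>i j. \<gamma> i j = \<gamma> j i"
    and cover: "X \<subseteq> (\<Union>i<n. A i) \<union> (\<Union>(i,j)\<in>upairs n. B i j)"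
    and A_disj: "\<And>i j. (i,j) \<in> opairs n \<Longrightarrow> A i \<inter> A j = {}"
    and B_disj: "\<And>i j k l. (i,j) \<in> upairs n \<Longrightarrow> (k,l) \<in> upairs n \<Longrightarrow> (i,j) \<noteq> (k,l) \<Longrightarrow> B i j \<inter> B k l = {}"
    and AB_disj: "\<And>i j k. (i,j) \<in> opairs n \<Longrightarrow> k < n \<Longrightarrow> k \<noteq> i \<Longrightarrow> k \<noteq> j \<Longrightarrow> A k \<inter> B i j = {}"
    and neck_path: "\<And>i j. (i,j) \<in> opairs n \<Longrightarrow> path_connected (A i \<inter> B i j)"
    and neck_loop: "\<And>i j p r. (i,j) \<in> opairs n \<Longrightarrow> \<exists>c. cycle_in 1 (A i \<inter> B i j) c \<and>
        winding (\<gamma> i j) c = of_int p \<and> winding (\<alpha> j) c = of_int r"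
    and wind_neck: "\<And>i j k c. (i,j) \<in> opairs n \<Longrightarrow> k < n \<Longrightarrow> k \<noteq> i \<Longrightarrow> k \<noteq> j \<Longrightarrow> cycle_in 1 (B i j) c \<Longrightarrow>
        winding (\<alpha> k) c = winding (\<gamma> i j) c"
    and wind_sum: "\<And>c. cycle_in 1 X c \<Longrightarrow> (\<Sum>k<n. winding (\<alpha> k) c) = 0"
    and A_inj: "\<And>i c. i < n \<Longrightarrow> cycle_in 1 (A i) c \<Longrightarrow> (\<And>k. k < n \<Longrightarrow> k \<noteq> i \<Longrightarrow> winding (\<alpha> k) c = 0) \<Longrightarrow> bounds_in 1 X c"
    and B_inj: "\<And>i j c. (i,j) \<in> opairs n \<Longrightarrow> cycle_in 1 (B i j) c \<Longrightarrow> winding (\<gamma> i j) c = 0 \<Longrightarrow>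
        winding (\<alpha> j) c = 0 \<Longrightarrow> bounds_in 1 X c"
    and x0_in: "\<And>i j. (i,j) \<in> opairs n \<Longrightarrow> x0 i j \<in> A i \<inter> B i j"
    and A_conn: "\<And>i j k. (i,j) \<in> opairs n \<Longrightarrow> (i,k) \<in> opairs n \<Longrightarrow>
        bounds_in 0 (A i) (point_chain (x0 i k) - point_chain (x0 i j))"
    and B_conn: "\<And>i j. (i,j) \<in> opairs n \<Longrightarrow> bounds_in 0 (B i j) (point_chain (x0 j i) - point_chain (x0 i j))"
begin

section \<open>The cover by the union of the cores and the union of the necks\<close>

definition AA where "AA = (\<Union>i<n. A i)"
definition BB where "BB = (\<Union>e\<in>upairs n. case_prod B e)"
definition N where "N e = A (fst e) \<inter> case_prod B e"

lemma A_sub: "i < n \<Longrightarrow> A i \<subseteq> X" and B_sub: "(i,j) \<in> opairs n \<Longrightarrow> B i j \<subseteq> X"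
  using A_open B_open openin_imp_subset by blast+

lemma upairs_opairs: "(i,j) \<in> upairs n \<Longrightarrow> (i,j) \<in> opairs n" "(i,j) \<in> upairs n \<Longrightarrow> (j,i) \<in> opairs n"
  "(i,j) \<in> opairs n \<Longrightarrow> (j,i) \<in> opairs n" "(i,j) \<in> opairs n \<Longrightarrow> i < n" "(i,j) \<in> opairs n \<Longrightarrow> j < n"
  "(i,j) \<in> opairs n \<Longrightarrow> i \<noteq> j"
  by (auto simp: upairs_def opairs_def)

lemma AA_sub: "AA \<subseteq> X"
  unfolding AA_def using A_sub by blast

lemma BB_sub: "BB \<subseteq> X"
  unfolding BB_def
proof (rule UN_least)
  fix e assume "e \<in> upairs n"
  then show "case_prod B e \<subseteq> X"
    using B_sub [OF upairs_opairs(1)] by (cases e) simp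
qed

lemma AA_BB: "AA \<union> BB = X"
  using AA_sub BB_sub cover unfolding AA_def BB_def by blast

lemma open_cover: "openin (top_of_set (AA \<union> BB)) AA" "openin (top_of_set (AA \<union> BB)) BB"
proof -
  show "openin (top_of_set (AA \<union> BB)) AA"
    unfolding AA_BB unfolding AA_def using A_open by (intro openin_Union) auto
  have "openin (top_of_set X) (case_prod B e)" if "e \<in> upairs n" for e
    using B_open [OF upairs_opairs(1)] that by (cases e) simp
  then show "openin (top_of_set (AA \<union> BB)) BB"
    unfolding AA_BB unfolding BB_def by (intro openin_Union) blast
qed

lemma sep_A: "separated_family {..<n} A"
  unfolding separated_family_def disjoint_family_on_def AA_def [symmetric]
proof (intro conjI ballI impI)
  fix i assume "i \<in> {..<n}"
  then show "openin (top_of_set AA) (A i)"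
    by (intro openin_subset_trans [OF A_open _ AA_sub]) (auto simp: AA_def)
qed (use A_disj in \<open>auto simp: opairs_def\<close>)

lemma sep_B: "separated_family (upairs n) (case_prod B)"
  unfolding separated_family_def disjoint_family_on_def BB_def [symmetric]
proof (intro conjI ballI impI)
  fix e assume e: "e \<in> upairs n"
  have "case_prod B e \<subseteq> BB"
    using e unfolding BB_def by (rule UN_upper)
  moreover have "openin (top_of_set X) (case_prod B e)"
    using e B_open upairs_opairs(1) by (cases e) auto
  ultimately show "openin (top_of_set BB) (case_prod B e)"
    using openin_subset_trans BB_sub by blast
next
  fix e f assume "e \<in> upairs n" "f \<in> upairs n" "e \<noteq> f"
  then show "case_prod B e \<inter> case_prod B f = {}"
    using B_disj by (cases e; cases f) simp
qed simp

lemma N_Union: "\<Union>(N ` opairs n) = AA \<inter> BB"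
proof (intro equalityI subsetI)
  fix x assume "x \<in> \<Union>(N ` opairs n)"
  then obtain i j where ij: "(i,j) \<in> opairs n" "x \<in> A i" "x \<in> B i j"
    by (auto simp: N_def)
  moreover have "x \<in> BB"
  proof (cases "i < j")
    case True
    then show ?thesis using ij by (force simp: BB_def upairs_def opairs_def)
  next
    case False
    then have "(j,i) \<in> upairs n" using ij by (auto simp: upairs_def opairs_def)
    then show ?thesis using ij sym(1) [of i j] by (force simp: BB_def)
  qed
  ultimately show "x \<in> AA \<inter> BB"
    by (auto simp: AA_def opairs_def)
next
  fix x assume "x \<in> AA \<inter> BB"
  then obtain k i j where k: "k < n" "x \<in> A k" "(i,j) \<in> upairs n" "x \<in> B i j"
    by (auto simp: AA_def BB_def)
  then have "k = i \<or> k = j"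
    using AB_disj [OF upairs_opairs(1) [OF k(3)] k(1)] by blast
  then show "x \<in> \<Union>(N ` opairs n)"
    using k upairs_opairs sym(1) [of i j] by (auto simp: N_def intro: bexI [of _ "(i,j)"] bexI [of _ "(j,i)"])
qed

text \<open>Different first indices are separated by the cores; for equal first indices the two
  necks differ and are disjoint.\<close>

lemma N_disjoint:
  assumes "e \<in> opairs n" "f \<in> opairs n" "e \<noteq> f"
  shows "N e \<inter> N f = {}"
proof (rule ccontr)
  assume "N e \<inter> N f \<noteq> {}"
  then obtain x where x: "x \<in> N e" "x \<in> N f" by blast
  obtain i j k l where ef: "e = (i,j)" "f = (k,l)" by fastforce
  have "i = k"
    using x A_disj [of i k] assms by (auto simp: ef N_def opairs_def)
  then have "A k \<inter> B i j \<noteq> {}" "x \<in> B i j" "x \<in> B i l"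
    using x by (auto simp: ef N_def)
  moreover have "j \<noteq> l"
    using assms ef \<open>i = k\<close> by auto
  moreover define s where "s a b = (if a < b then (a,b) else (b,a))" for a b :: nat
  have "s i j \<in> upairs n" "s i l \<in> upairs n"
    using assms \<open>i = k\<close> by (auto simp: s_def ef upairs_def opairs_def)
  moreover have "s i j \<noteq> s i l"
    using \<open>j \<noteq> l\<close> assms \<open>i = k\<close> by (auto simp: s_def ef opairs_def)
  moreover have "case_prod B (s i j) = B i j" "case_prod B (s i l) = B i l"
    using sym by (auto simp: s_def)
  ultimately show False
    using B_disj [of "fst (s i j)" "snd (s i j)" "fst (s i l)" "snd (s i l)"]
    by (auto simp: case_prod_unfold)
qed

lemma sep_N: "separated_family (opairs n) N"
  unfolding separated_family_def disjoint_family_on_def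
proof (intro conjI ballI impI)
  fix e assume e: "e \<in> opairs n"
  then have "openin (top_of_set X) (N e)"
    using A_open B_open by (auto simp: N_def opairs_def intro!: openin_Int)
  moreover have "N e \<subseteq> \<Union>(N ` opairs n)" using e by auto
  moreover have "\<Union>(N ` opairs n) \<subseteq> X" unfolding N_Union using AA_sub by auto
  ultimately show "openin (top_of_set (\<Union>(N ` opairs n))) (N e)"
    using openin_subset_trans by blast
qed (use N_disjoint in auto)

lemma N_sub: "(i,j) \<in> opairs n \<Longrightarrow> N (i,j) \<subseteq> A i" "(i,j) \<in> opairs n \<Longrightarrow> N (i,j) \<subseteq> B i j"
  "e \<in> opairs n \<Longrightarrow> N e \<subseteq> AA" "e \<in> opairs n \<Longrightarrow> N e \<subseteq> X"
  using N_Union AA_sub by (auto simp: N_def)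

section \<open>Windings as coordinates, and the meridians\<close>

definition wint :: "('v \<Rightarrow> complex) \<Rightarrow> 'v chain \<Rightarrow> int"
  where "wint f c = \<lfloor>Re (winding f c)\<rfloor>"

lemma wint: "cycle_in 1 S c \<Longrightarrow> continuous_on S f \<Longrightarrow> (\<And>x. x \<in> S \<Longrightarrow> f x \<noteq> 0) \<Longrightarrow> of_int (wint f c) = winding f c"
  using winding_Ints [of S c f] by (auto simp: wint_def elim: Ints_cases)

lemma wint_\<alpha>: "cycle_in 1 S c \<Longrightarrow> S \<subseteq> X \<Longrightarrow> k < n \<Longrightarrow> of_int (wint (\<alpha> k) c) = winding (\<alpha> k) c"
  using \<alpha>_cont \<alpha>_nz by (intro wint [of S]) (auto intro: continuous_on_subset)

lemma wint_\<gamma>: "cycle_in 1 S c \<Longrightarrow> S \<subseteq> B i j \<Longrightarrow> (i,j) \<in> opairs n \<Longrightarrow> of_int (wint (\<gamma> i j) c) = winding (\<gamma> i j) c"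
  using \<gamma>_nz by (intro wint [of S] continuous_on_subset [OF \<gamma>_cont]) (use B_sub in blast)+

lemma wind_bounds_\<alpha>: "bounds_in 1 S c \<Longrightarrow> S \<subseteq> X \<Longrightarrow> k < n \<Longrightarrow> winding (\<alpha> k) c = 0"
  using \<alpha>_cont \<alpha>_nz by (intro winding_bounds [of S]) (auto intro: continuous_on_subset)

lemma wind_bounds_\<gamma>: "bounds_in 1 S c \<Longrightarrow> S \<subseteq> B i j \<Longrightarrow> (i,j) \<in> opairs n \<Longrightarrow> winding (\<gamma> i j) c = 0"
  using \<gamma>_nz by (intro winding_bounds [of S] continuous_on_subset [OF \<gamma>_cont]) (use B_sub in blast)+

text \<open>All windings of a cycle add up to 0, and in a neck the n - 2 forms other than
  \<open>\<alpha> i\<close> and \<open>\<alpha> j\<close> wind like \<open>\<gamma> i j\<close>.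
  This is where \<open>n\<close> enters the relations.\<close>

lemma wind_opposite:
  assumes "(i,j) \<in> opairs n" "cycle_in 1 (B i j) c"
  shows "winding (\<alpha> i) c = - winding (\<alpha> j) c - (of_nat n - 2) * winding (\<gamma> i j) c"
proof -
  have ij: "i < n" "j < n" "i \<noteq> j" using assms by (auto simp: opairs_def)
  have "0 = (\<Sum>k<n. winding (\<alpha> k) c)"
    using wind_sum [OF cycle_in_mono [OF assms(2) B_sub [OF assms(1)]]] by simp
  also have "\<dots> = winding (\<alpha> i) c + (winding (\<alpha> j) c + (\<Sum>k\<in>{..<n}-{i}-{j}. winding (\<alpha> k) c))"
    using ij by (simp add: sum.remove [of "{..<n}" i] sum.remove [of "{..<n} - {i}" j])
  also have "(\<Sum>k\<in>{..<n}-{i}-{j}. winding (\<alpha> k) c) = (\<Sum>k\<in>{..<n}-{i}-{j}. winding (\<gamma> i j) c)"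
    using wind_neck [OF assms(1) _ _ _ assms(2)] by (intro sum.cong) auto
  also have "\<dots> = (of_nat n - 2) * winding (\<gamma> i j) c"
    using ij by (simp add: card_Diff_subset of_nat_diff)
  finally show ?thesis by (simp add: algebra_simps)
qed

lemma Re_complex_of_int: "Re (of_int m) = of_int m"
  by simp

text \<open>The meridian of hyperplane \<open>j\<close> inside core \<open>i\<close>: it winds once
  under \<open>\<alpha> j\<close> and, apart from \<open>\<alpha> i\<close>, under no other form, so
  that the \<open>mu i j\<close> are dual to the coordinates of core \<open>i\<close>.\<close>

definition mu where "mu i j = (SOME c. cycle_in 1 (A i \<inter> B i j) c \<and> winding (\<gamma> i j) c = of_int 0 \<and> winding (\<alpha> j) c = of_int 1)"

lemma mu:
  assumes "(i,j) \<in> opairs n"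
  shows "cycle_in 1 (N (i,j)) (mu i j)" "winding (\<gamma> i j) (mu i j) = 0" "winding (\<alpha> j) (mu i j) = 1"
  using someI_ex [OF neck_loop [OF assms, of 0 1]] unfolding mu_def N_def by auto

lemma mu_in:
  assumes "(i,j) \<in> opairs n"
  shows "cycle_in 1 (A i) (mu i j)" "cycle_in 1 (B i j) (mu i j)" "cycle_in 1 AA (mu i j)" "cycle_in 1 X (mu i j)"
  by (rule cycle_in_mono [OF mu(1) [OF assms]], rule N_sub [OF assms])+

lemma wind_mu:
  assumes "(i,j) \<in> opairs n" "k < n" "k \<noteq> i"
  shows "winding (\<alpha> k) (mu i j) = (if k = j then 1 else 0)"
  using mu(2,3) [OF assms(1)] wind_neck [OF assms(1) assms(2,3) _ mu_in(2) [OF assms(1)]] by auto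

lemma wind_mu_self:
  assumes "(i,j) \<in> opairs n"
  shows "winding (\<alpha> i) (mu i j) = -1"
  using wind_opposite [OF assms mu_in(2) [OF assms]] mu(2,3) [OF assms] by simp

text \<open>\<open>mu j i\<close> has winding -1 under the form \<open>\<alpha> j\<close> of its own
  core, so the neck coordinates of the sum vanish.\<close>

lemma mu_swap:
  assumes "(i,j) \<in> opairs n"
  shows "bounds_in 1 X (mu i j + mu j i)"
proof (rule B_inj [OF assms])
  have ji: "(j,i) \<in> opairs n" using assms upairs_opairs by blast
  show "cycle_in 1 (B i j) (mu i j + mu j i)"
    using mu_in(2) [OF assms] mu_in(2) [OF ji] sym by (simp add: singular_relcycle_add)
  show "winding (\<gamma> i j) (mu i j + mu j i) = 0"
    using mu(2) [OF assms] mu(2) [OF ji] sym(2) [of i j] by (simp add: winding_add)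
  show "winding (\<alpha> j) (mu i j + mu j i) = 0"
    using mu(3) [OF assms] wind_mu_self [OF ji] by (simp add: winding_add)
qed

abbreviation homologous_X (infix "\<sim>" 50) where "c \<sim> d \<equiv> homologous_rel 1 (top_of_set X) {} c d"

definition mu_sum :: "(nat \<times> nat \<Rightarrow> int) \<Rightarrow> 'v chain"
  where "mu_sum x = (\<Sum>(i,j)\<in>upairs n. frag_cmul (x (i,j)) (mu i j))"

lemma mu_sum_opairs:
  "(\<Sum>(i,j)\<in>opairs n. frag_cmul (m (i,j)) (mu i j)) \<sim> mu_sum (\<lambda>(i,j). m (i,j) - m (j,i))"
proof -
  have "(\<Sum>(i,j)\<in>opairs n. frag_cmul (m (i,j)) (mu i j))
      = (\<Sum>(i,j)\<in>upairs n. frag_cmul (m (i,j)) (mu i j) + frag_cmul (m (j,i)) (mu j i))"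
    by (simp add: sum_opairs_upairs)
  moreover have "\<dots> \<sim> mu_sum (\<lambda>(i,j). m (i,j) - m (j,i))"
    unfolding mu_sum_def
  proof (rule homologous_sum)
    fix e assume e: "e \<in> upairs n"
    obtain i j where ij: "e = (i,j)" by fastforce
    have "bounds_in 1 X (frag_cmul (m (j,i)) (mu i j + mu j i))"
      using e upairs_opairs ij by (intro singular_relboundary_cmul mu_swap) auto
    moreover have "frag_cmul (m (i,j)) (mu i j) + frag_cmul (m (j,i)) (mu j i)
        - frag_cmul (m (i,j) - m (j,i)) (mu i j) = frag_cmul (m (j,i)) (mu i j + mu j i)"
      by (rule poly_mapping_eqI) (simp add: lookup_minus lookup_add algebra_simps)
    ultimately show "(case e of (i,j) \<Rightarrow> frag_cmul (m (i,j)) (mu i j) + frag_cmul (m (j,i)) (mu j i))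
      \<sim> (case e of (i,j) \<Rightarrow> frag_cmul (case (i,j) of (i,j) \<Rightarrow> m (i,j) - m (j,i)) (mu i j))"
      unfolding homologous_rel_def ij by simp
  qed simp
  ultimately show ?thesis by simp
qed

text \<open>In each core the combination of meridians with the same windings is subtracted; the
  difference bounds by \<open>A_inj\<close>. Folding the pairs (j,i) onto (i,j) by
  \<open>mu_swap\<close> gives the differences of windings.\<close>

lemma AA_representation:
  assumes c: "cycle_in 1 AA c"
  shows "c \<sim> mu_sum (\<lambda>(i,j). wint (\<alpha> j) (chain_part 1 (A i) c) - wint (\<alpha> i) (chain_part 1 (A j) c))"
proof -
  let ?m = "\<lambda>(i,j). wint (\<alpha> j) (chain_part 1 (A i) c)"
  have cA: "cycle_in (Suc 0) (\<Union>(A ` {..<n})) c" using c by (simp add: AA_def)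
  have "chain_part 1 (A i) c \<sim> (\<Sum>j\<in>{..<n}-{i}. frag_cmul (?m (i,j)) (mu i j))" if i: "i < n" for i
    unfolding homologous_rel_def
  proof (rule A_inj [OF i])
    let ?ci = "chain_part 1 (A i) c" and ?s = "\<Sum>j\<in>{..<n}-{i}. frag_cmul (?m (i,j)) (mu i j)"
    have ci: "cycle_in 1 (A i) ?ci"
      using cycle_part [OF sep_A _ cA] i by simp
    have "cycle_in 1 (A i) ?s"
      using i by (intro cycle_in_sum singular_relcycle_cmul mu_in) (auto simp: opairs_def)
    with ci show "cycle_in 1 (A i) (?ci - ?s)"
      by (rule singular_relcycle_diff)
    fix k assume k: "k < n" "k \<noteq> i"
    have "winding (\<alpha> k) ?s = (\<Sum>j\<in>{..<n}-{i}. of_int (?m (i,j)) * (if k = j then 1 else 0))"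
      unfolding winding_sum winding_cmul
      using k i by (intro sum.cong refl) (simp add: wind_mu opairs_def)
    also have "\<dots> = (\<Sum>j\<in>{..<n}-{i}. if k = j then of_int (?m (i,j)) else 0)"
      by (intro sum.cong) auto
    also have "\<dots> = of_int (?m (i,k))"
      using k by simp
    finally show "winding (\<alpha> k) (?ci - ?s) = 0"
      using wint_\<alpha> [OF ci A_sub [OF i] k(1)] by (simp add: winding_diff)
  qed
  then have "(\<Sum>i<n. chain_part 1 (A i) c) \<sim> (\<Sum>i<n. \<Sum>j\<in>{..<n}-{i}. frag_cmul (?m (i,j)) (mu i j))"
    by (intro homologous_sum) auto
  moreover have "(\<Sum>i<n. chain_part 1 (A i) c) = c"
    using chain_sum_parts [OF sep_A cycle_in_imp_chain_in [OF cA]] by simp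
  moreover have "(\<Sum>i<n. \<Sum>j\<in>{..<n}-{i}. frag_cmul (?m (i,j)) (mu i j)) = (\<Sum>(i,j)\<in>opairs n. frag_cmul (?m (i,j)) (mu i j))"
    by (simp add: sum_opairs_row)
  ultimately have "c \<sim> (\<Sum>(i,j)\<in>opairs n. frag_cmul (?m (i,j)) (mu i j))"
    by simp
  then show ?thesis
    using homologous_rel_trans [OF mu_sum_opairs [of ?m]] by simp
qed

text \<open>For every neck, a loop with \<gamma>-winding \<open>P i j\<close> is placed at one end
  and a loop with the same neck coordinates at the other. The differences bound through the necks;
  expanding their sum in the meridians of the cores yields \<open>x\<close>.\<close>

lemma relator_bounds:
  assumes "relator n x"
  shows "bounds_in 1 X (mu_sum x)"
proof -
  obtain P where P: "antisym_fun n P"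
    "\<And>i j. (i,j) \<in> upairs n \<Longrightarrow> x (i,j) = row_sum n P i - row_sum n P j - int n * P i j"
    using assms by (auto simp: relator_def)
  have PP: "P j i = - P i j" if "i < n" "j < n" for i j
    using P(1) that unfolding antisym_fun_def by blast
  have P0: "P i i = 0" if "i < n" for i
    using PP [OF that that] by simp
  \<comment> \<open>The \<alpha>_i-winding of the second loop is dictated by
    \<open>wind_opposite\<close>, so that its winding under \<open>\<alpha> j\<close> becomes 0 like
    that of the first.\<close>
  have "\<exists>c. cycle_in 1 (N (i,j)) c \<and> winding (\<gamma> i j) c = of_int (P i j) \<and> winding (\<alpha> j) c = 0"
    "\<exists>c. cycle_in 1 (N (j,i)) c \<and> winding (\<gamma> i j) c = of_int (P i j) \<and> winding (\<alpha> i) c = of_int (- (int n - 2) * P i j)"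
    if "(i,j) \<in> upairs n" for i j
    using neck_loop [OF upairs_opairs(1) [OF that], of "P i j" 0]
      neck_loop [OF upairs_opairs(2) [OF that], of "P i j" "- (int n - 2) * P i j"]
      sym(2) [of i j] unfolding N_def by auto
  then obtain l l' where
    l: "\<And>i j. (i,j) \<in> upairs n \<Longrightarrow> cycle_in 1 (N (i,j)) (l i j) \<and> winding (\<gamma> i j) (l i j) = of_int (P i j) \<and> winding (\<alpha> j) (l i j) = 0"
    and l': "\<And>i j. (i,j) \<in> upairs n \<Longrightarrow> cycle_in 1 (N (j,i)) (l' i j) \<and> winding (\<gamma> i j) (l' i j) = of_int (P i j) \<and> winding (\<alpha> i) (l' i j) = of_int (- (int n - 2) * P i j)"
    by metis
  define z where "z = (\<Sum>(i,j)\<in>upairs n. l i j - l' i j)"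
  have lA: "cycle_in 1 (A i) (l i j)" "cycle_in 1 (B i j) (l i j)" "cycle_in 1 (A j) (l' i j)" "cycle_in 1 (B i j) (l' i j)"
    if "(i,j) \<in> upairs n" for i j
    using cycle_in_mono [OF conjunct1 [OF l [OF that]] N_sub(1) [OF upairs_opairs(1) [OF that]]]
      cycle_in_mono [OF conjunct1 [OF l [OF that]] N_sub(2) [OF upairs_opairs(1) [OF that]]]
      cycle_in_mono [OF conjunct1 [OF l' [OF that]] N_sub(1) [OF upairs_opairs(2) [OF that]]]
      cycle_in_mono [OF conjunct1 [OF l' [OF that]] N_sub(2) [OF upairs_opairs(2) [OF that]]]
      sym(1) [of i j] by simp_all
  have AAA: "A i \<subseteq> AA" if "i < n" for i using that by (auto simp: AA_def)
  have wl': "winding (\<alpha> j) (l' i j) = 0" if "(i,j) \<in> upairs n" for i j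
    using wind_opposite [OF upairs_opairs(2) [OF that], of "l' i j"] lA [OF that] l' [OF that] sym
    by (simp add: algebra_simps)
  have "bounds_in 1 X (l i j - l' i j)" if ij: "(i,j) \<in> upairs n" for i j
    using lA [OF ij] l [OF ij] l' [OF ij] wl' [OF ij]
    by (intro B_inj [OF upairs_opairs(1) [OF ij]]) (auto simp: winding_diff intro: singular_relcycle_diff)
  then have zb: "bounds_in 1 X z"
    unfolding z_def by (intro bounds_in_sum) auto
  have zA: "cycle_in 1 AA z"
    unfolding z_def
  proof (intro cycle_in_sum)
    fix e assume "e \<in> upairs n"
    then obtain i j where ij: "e = (i,j)" "(i,j) \<in> upairs n" "i < n" "j < n"
      by (auto simp: upairs_def)
    then show "cycle_in 1 AA (case e of (i, j) \<Rightarrow> l i j - l' i j)"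
      using cycle_in_mono [OF lA(1) AAA] cycle_in_mono [OF lA(3) AAA] by (simp add: singular_relcycle_diff)
  qed
  \<comment> \<open>Every end of core \<open>i\<close> contributes \<open>P i b\<close>, as
    \<open>\<alpha> k\<close> winds like \<gamma> there, except the end towards \<open>k\<close>: it
    contributes 0 if i < k, and (n - 2) \<open>P k i\<close> if it carries the second loop of its
    neck.\<close>
  have w: "wint (\<alpha> k) (chain_part 1 (A i) z) = row_sum n P i - P i k + (if k < i then (int n - 2) * P k i else 0)"
    if ik: "i < n" "k < n" "k \<noteq> i" for i k
  proof -
    have part: "chain_part 1 (A i) (l a b) = (if a = i then l a b else 0)"
       "chain_part 1 (A i) (l' a b) = (if b = i then l' a b else 0)" if ab: "(a,b) \<in> upairs n" for a b
    proof -
      have "A i \<inter> A a = {}" if "a \<noteq> i" using A_disj [of i a] ab ik that by (auto simp: opairs_def upairs_def)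
      then show "chain_part 1 (A i) (l a b) = (if a = i then l a b else 0)"
        using part_self [OF cycle_in_imp_chain_in [OF lA(1) [OF ab]]]
          part_disjoint [OF cycle_in_imp_chain_in [OF lA(1) [OF ab]], of "A i"] by auto
      have "A i \<inter> A b = {}" if "b \<noteq> i" using A_disj [of i b] ab ik that by (auto simp: opairs_def upairs_def)
      then show "chain_part 1 (A i) (l' a b) = (if b = i then l' a b else 0)"
        using part_self [OF cycle_in_imp_chain_in [OF lA(3) [OF ab]]]
          part_disjoint [OF cycle_in_imp_chain_in [OF lA(3) [OF ab]], of "A i"] by auto
    qed
    have "winding (\<alpha> k) (chain_part 1 (A i) z)
       = (\<Sum>(a,b)\<in>upairs n. (if a = i then winding (\<alpha> k) (l a b) else 0) - (if b = i then winding (\<alpha> k) (l' a b) else 0))"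
      unfolding z_def part_sum winding_sum
      by (intro sum.cong refl) (auto simp: part_diff winding_diff part simp del: One_nat_def)
    \<comment> \<open>Both loops of a neck are rewritten as loops at ordered ends, so that only the
      row \<open>a = i\<close> survives.\<close>
    also have "\<dots> = (\<Sum>(a,b)\<in>opairs n. if a = i then (if a < b then winding (\<alpha> k) (l a b) else - winding (\<alpha> k) (l' b a)) else 0)"
      unfolding sum_opairs_upairs by (intro sum.cong refl) (auto simp: upairs_def)
    also have "\<dots> = (\<Sum>a<n. if a = i then (\<Sum>b\<in>{..<n}-{i}. (if i < b then winding (\<alpha> k) (l i b) else - winding (\<alpha> k) (l' b i))) else 0)"
      unfolding sum_opairs_row by (intro sum.cong refl) auto
    also have "\<dots> = (\<Sum>b\<in>{..<n}-{i}. (if i < b then winding (\<alpha> k) (l i b) else - winding (\<alpha> k) (l' b i)))"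
      using ik by simp
    also have "\<dots> = (\<Sum>b\<in>{..<n}-{i}. of_int (P i b - (if b = k then P i k - (if k < i then (int n - 2) * P k i else 0) else 0)))"
    proof (intro sum.cong refl)
      fix b assume b: "b \<in> {..<n} - {i}"
      show "(if i < b then winding (\<alpha> k) (l i b) else - winding (\<alpha> k) (l' b i))
        = of_int (P i b - (if b = k then P i k - (if k < i then (int n - 2) * P k i else 0) else 0))"
      proof (cases "i < b")
        case True
        then have ib: "(i,b) \<in> upairs n" using b by (auto simp: upairs_def)
        show ?thesis
          using True l [OF ib] wind_neck [OF upairs_opairs(1) [OF ib] ik(2,3) _ lA(2) [OF ib]] by auto
      next
        case False
        then have bi: "(b,i) \<in> upairs n" using b ik by (auto simp: upairs_def)
        have "winding (\<alpha> k) (l' b i) = winding (\<gamma> b i) (l' b i)" if "k \<noteq> b"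
          using wind_neck [OF upairs_opairs(1) [OF bi] ik(2) that ik(3) lA(4) [OF bi]] .
        then show ?thesis
          using False l' [OF bi] PP [of b i] b ik by (auto simp: algebra_simps)
      qed
    qed
    also have "\<dots> = of_int ((\<Sum>b\<in>{..<n}-{i}. P i b) - (P i k - (if k < i then (int n - 2) * P k i else 0)))"
      unfolding of_int_sum [symmetric] sum_subtractf using ik by simp
    also have "(\<Sum>b\<in>{..<n}-{i}. P i b) = row_sum n P i"
      using P0 [OF ik(1)] ik(1) by (simp add: row_sum_def sum_diff1)
    finally have "winding (\<alpha> k) (chain_part 1 (A i) z) = of_int (row_sum n P i - (P i k - (if k < i then (int n - 2) * P k i else 0)))" .
    then have "wint (\<alpha> k) (chain_part 1 (A i) z) = row_sum n P i - (P i k - (if k < i then (int n - 2) * P k i else 0))"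
      unfolding wint_def by (simp only: Re_complex_of_int floor_of_int)
    then show ?thesis by simp
  qed
  have "mu_sum (\<lambda>(i,j). wint (\<alpha> j) (chain_part 1 (A i) z) - wint (\<alpha> i) (chain_part 1 (A j) z)) = mu_sum x"
    unfolding mu_sum_def
  proof (intro sum.cong refl)
    fix e assume "e \<in> upairs n"
    then obtain i j where ij: "e = (i,j)" "(i,j) \<in> upairs n" "i < j" "j < n"
      by (auto simp: upairs_def)
    have "wint (\<alpha> j) (chain_part 1 (A i) z) - wint (\<alpha> i) (chain_part 1 (A j) z) = x (i,j)"
      using w [of i j] w [of j i] PP [of i j] P(2) [OF ij(2)] ij by (simp add: algebra_simps)
    then show "(case e of (i, j) \<Rightarrow> frag_cmul (case (i, j) of (i, j) \<Rightarrow> wint (\<alpha> j) (chain_part 1 (A i) z) - wint (\<alpha> i) (chain_part 1 (A j) z)) (mu i j))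
       = (case e of (i, j) \<Rightarrow> frag_cmul (x (i, j)) (mu i j))"
      by (simp add: ij)
  qed
  then show ?thesis
    using AA_representation [OF zA] zb homologous_bounds by metis
qed

end

section \<open>Relations among the meridians\<close>

context neck_decomposition
begin

lemma N_swap_sub: "(i,j) \<in> opairs n \<Longrightarrow> N (j,i) \<subseteq> B i j"
  using N_sub(2) [of j i] upairs_opairs(3) sym(1) [of i j] by auto

lemma B_in_BB: "(i,j) \<in> opairs n \<Longrightarrow> B i j \<subseteq> BB"
proof -
  assume "(i,j) \<in> opairs n"
  then consider "(i,j) \<in> upairs n" | "(j,i) \<in> upairs n"
    by (auto simp: opairs_def upairs_def) linarith
  then show ?thesis
  proof cases
    case 1
    then show ?thesis by (force simp: BB_def)
  next
    case 2
    then show ?thesis using sym(1) [of i j] by (force simp: BB_def)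
  qed
qed

lemma A_in_AA: "i < n \<Longrightarrow> A i \<subseteq> AA"
  by (auto simp: AA_def)

lemma part_N_in: "chain_in p (AA \<inter> BB) c \<Longrightarrow> chain_in p (N e) (chain_part p (N e) c)"
  by (rule chain_in_mono [OF part_in]) auto

lemma part_N_cycle: "cycle_in 1 (AA \<inter> BB) c \<Longrightarrow> e \<in> opairs n \<Longrightarrow> cycle_in 1 (N e) (chain_part 1 (N e) c)"
  using cycle_part [OF sep_N, of e 0 c] by (simp add: N_Union)

lemma sum_part_N: "chain_in p (AA \<inter> BB) c \<Longrightarrow> (\<Sum>e\<in>opairs n. chain_part p (N e) c) = c"
  using chain_sum_parts [OF sep_N, of p c] by (simp add: N_Union)

lemma part_A_eq:
  assumes c: "chain_in p (AA \<inter> BB) c" and i: "i < n"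
  shows "chain_part p (A i) c = (\<Sum>j\<in>{..<n}-{i}. chain_part p (N (i,j)) c)"
proof -
  have *: "chain_part p (A i) (chain_part p (N (k,l)) c) = (if k = i then chain_part p (N (k,l)) c else 0)"
    if kl: "(k,l) \<in> opairs n" for k l
  proof -
    have "chain_in p (A k) (chain_part p (N (k,l)) c)"
      by (rule chain_in_mono [OF part_N_in [OF c] N_sub(1) [OF kl]])
    moreover have "A i \<inter> A k = {}" if "k \<noteq> i"
      using A_disj [of i k] kl i that by (auto simp: opairs_def)
    ultimately show ?thesis
      using part_self part_disjoint by auto
  qed
  have "chain_part p (A i) c = (\<Sum>e\<in>opairs n. chain_part p (A i) (chain_part p (N e) c))"
    by (subst sum_part_N [OF c, symmetric]) (rule part_sum)
  also have "\<dots> = (\<Sum>k<n. \<Sum>l\<in>{..<n}-{k}. chain_part p (A i) (chain_part p (N (k,l)) c))"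
    by (rule sum_opairs_row)
  also have "\<dots> = (\<Sum>k<n. if k = i then (\<Sum>l\<in>{..<n}-{i}. chain_part p (N (i,l)) c) else 0)"
  proof (rule sum.cong [OF refl])
    fix k assume k: "k \<in> {..<n}"
    have "chain_part p (A i) (chain_part p (N (k,l)) c) = (if k = i then chain_part p (N (k,l)) c else 0)" if "l \<in> {..<n} - {k}" for l
      using * [of k l] k that by (auto simp: opairs_def)
    then show "(\<Sum>l\<in>{..<n}-{k}. chain_part p (A i) (chain_part p (N (k,l)) c)) = (if k = i then (\<Sum>l\<in>{..<n}-{i}. chain_part p (N (i,l)) c) else 0)"
      by (cases "k = i") auto
  qed
  also have "\<dots> = (\<Sum>l\<in>{..<n}-{i}. chain_part p (N (i,l)) c)"
    using i by simp
  finally show ?thesis .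
qed

lemma part_B_eq:
  assumes c: "chain_in p (AA \<inter> BB) c" and ij: "(i,j) \<in> upairs n"
  shows "chain_part p (B i j) c = chain_part p (N (i,j)) c + chain_part p (N (j,i)) c"
proof -
  have *: "chain_part p (B i j) (chain_part p (N (k,l)) c) = (if (k,l) = (i,j) then chain_part p (N (k,l)) c else 0)"
    "chain_part p (B i j) (chain_part p (N (l,k)) c) = (if (k,l) = (i,j) then chain_part p (N (l,k)) c else 0)"
    if kl: "(k,l) \<in> upairs n" for k l
  proof -
    have kl': "(k,l) \<in> opairs n" using kl upairs_opairs by blast
    have in1: "chain_in p (B k l) (chain_part p (N (k,l)) c)"
      by (rule chain_in_mono [OF part_N_in [OF c] N_sub(2) [OF kl']])
    have in2: "chain_in p (B k l) (chain_part p (N (l,k)) c)"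
      by (rule chain_in_mono [OF part_N_in [OF c] N_swap_sub [OF kl']])
    have "B i j \<inter> B k l = {}" if "(k,l) \<noteq> (i,j)"
      using B_disj [OF ij kl] that by auto
    then show "chain_part p (B i j) (chain_part p (N (k,l)) c) = (if (k,l) = (i,j) then chain_part p (N (k,l)) c else 0)"
      "chain_part p (B i j) (chain_part p (N (l,k)) c) = (if (k,l) = (i,j) then chain_part p (N (l,k)) c else 0)"
      using part_self [OF in1] part_self [OF in2] part_disjoint [OF in1, of "B i j"] part_disjoint [OF in2, of "B i j"]
      by auto
  qed
  have "chain_part p (B i j) c = (\<Sum>e\<in>opairs n. chain_part p (B i j) (chain_part p (N e) c))"
    by (subst sum_part_N [OF c, symmetric]) (rule part_sum)
  also have "\<dots> = (\<Sum>(k,l)\<in>upairs n. chain_part p (B i j) (chain_part p (N (k,l)) c) + chain_part p (B i j) (chain_part p (N (l,k)) c))"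
    by (rule sum_opairs_upairs)
  also have "\<dots> = (\<Sum>e\<in>upairs n. if e = (i,j) then chain_part p (N (i,j)) c + chain_part p (N (j,i)) c else 0)"
    using * by (intro sum.cong refl) (auto simp: case_prod_unfold)
  also have "\<dots> = chain_part p (N (i,j)) c + chain_part p (N (j,i)) c"
    using ij by simp
  finally show ?thesis .
qed

lemma mu_sum_cycle: "cycle_in 1 AA (mu_sum x)"
  unfolding mu_sum_def
proof (rule cycle_in_sum)
  fix e assume "e \<in> upairs n"
  then show "cycle_in 1 AA (case e of (i, j) \<Rightarrow> frag_cmul (x (i, j)) (mu i j))"
    using mu_in(3) upairs_opairs(1) by (cases e) (auto intro: singular_relcycle_cmul)
qed

lemma wind_part_mu_sum:
  assumes "i < n" "k < n" "k \<noteq> i"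
  shows "winding (\<alpha> k) (chain_part 1 (A i) (mu_sum x)) = (if i < k then of_int (x (i,k)) else 0)"
proof -
  have "winding (\<alpha> k) (chain_part 1 (A i) (mu_sum x))
      = (\<Sum>(a,b)\<in>upairs n. of_int (x (a,b)) * winding (\<alpha> k) (chain_part 1 (A i) (mu a b)))"
    unfolding mu_sum_def part_sum winding_sum
    by (intro sum.cong refl) (auto simp: part_cmul winding_cmul)
  also have "\<dots> = (\<Sum>e\<in>upairs n. if e = (i,k) then of_int (x (i,k)) else 0)"
  proof (intro sum.cong refl)
    fix e assume e: "e \<in> upairs n"
    obtain a b where ab: "e = (a,b)" by fastforce
    have o: "(a,b) \<in> opairs n" using e ab upairs_opairs by blast
    have m: "chain_in 1 (A a) (mu a b)"
      using mu_in(1) [OF o] by (rule cycle_in_imp_chain_in)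
    have "chain_part 1 (A i) (mu a b) = (if a = i then mu a b else 0)"
      using part_self [OF m] part_disjoint [OF m, of "A i"] A_disj [of i a] o assms by (auto simp: opairs_def)
    then show "(case e of (a,b) \<Rightarrow> of_int (x (a,b)) * winding (\<alpha> k) (chain_part 1 (A i) (mu a b)))
      = (if e = (i,k) then of_int (x (i,k)) else 0)"
      using wind_mu [OF o assms(2)] assms(3) by (auto simp: ab)
  qed
  also have "\<dots> = (if i < k then of_int (x (i,k)) else 0)"
    using assms by (subst sum.delta [OF finite_pairs(1)]) (auto simp: upairs_def)
  finally show ?thesis .
qed

text \<open>By \<open>MV_kernel\<close> the bounding combination is homologous in the cores to a
  cycle \<open>e\<close> in the neck ends that bounds in the necks. The \<gamma>-windings of its
  parts form the matrix \<open>P\<close>; comparing \<alpha>-windings core by core gives the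
  relation.\<close>

lemma mu_sum_bounds_relator:
  assumes bd: "bounds_in 1 X (mu_sum x)"
  shows "relator n x"
proof -
  obtain e where e: "cycle_in 1 (AA \<inter> BB) e" "homologous_rel 1 (top_of_set AA) {} (mu_sum x) e" "bounds_in 1 BB e"
    using MV_kernel [OF open_cover mu_sum_cycle] bd unfolding AA_BB by metis
  have ec: "chain_in 1 (AA \<inter> BB) e" using e(1) by (rule cycle_in_imp_chain_in)
  define E where "E i j = chain_part 1 (N (i,j)) e" for i j
  have EN: "cycle_in 1 (N (i,j)) (E i j)" if "(i,j) \<in> opairs n" for i j
    unfolding E_def by (rule part_N_cycle [OF e(1) that])
  have EB: "cycle_in 1 (B i j) (E i j)" if "(i,j) \<in> opairs n" for i j
    by (rule cycle_in_mono [OF EN [OF that] N_sub(2) [OF that]])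
  define P where "P i j = (if i = j then 0 else wint (\<gamma> i j) (E i j))" for i j
  define r where "r i j = wint (\<alpha> j) (E i j)" for i j
  have P: "winding (\<gamma> i j) (E i j) = of_int (P i j)" if "(i,j) \<in> opairs n" for i j
    using wint_\<gamma> [OF EB [OF that] _ that] that by (auto simp: P_def opairs_def)
  have r: "winding (\<alpha> j) (E i j) = of_int (r i j)" if "(i,j) \<in> opairs n" for i j
    using wint_\<alpha> [OF EB [OF that] B_sub [OF that]] that by (auto simp: r_def opairs_def)
  \<comment> \<open>The parts of \<open>e\<close> at the two ends of a neck bound together in that
    neck. This gives the skew symmetry of \<open>P\<close> and, further down, the relation between
    \<open>r i k\<close> and \<open>r k i\<close>.\<close>
  have bB: "bounds_in 1 (B i j) (E i j + E j i)" if ij: "(i,j) \<in> upairs n" for i j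
    using bounds_part [OF sep_B ij, of 1 e] e(3) part_B_eq [OF ec ij]
    by (simp add: BB_def E_def)
  have anti: "P j i = - P i j" if "(i,j) \<in> upairs n" for i j
  proof -
    have o: "(i,j) \<in> opairs n" "(j,i) \<in> opairs n" using that upairs_opairs by blast+
    have "winding (\<gamma> i j) (E i j + E j i) = 0"
      using wind_bounds_\<gamma> [OF bB [OF that] _ o(1)] by simp
    then have "(of_int (P i j + P j i) :: complex) = 0"
      using P [OF o(1)] P [OF o(2)] sym(2) [of i j] by (simp add: winding_add)
    then show ?thesis by (simp only: of_int_eq_0_iff)
  qed
  have "antisym_fun n P"
    unfolding antisym_fun_def
  proof (intro allI impI)
    fix i j assume "i < n" "j < n"
    then consider "i = j" | "(i,j) \<in> upairs n" | "(j,i) \<in> upairs n"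
      by (auto simp: upairs_def) linarith
    then show "P j i = - P i j"
      by cases (auto simp: P_def dest: anti)
  qed
  moreover have "x (i,k) = row_sum n P i - row_sum n P k - int n * P i k" if ik: "(i,k) \<in> upairs n" for i k
  proof -
    have o: "(i,k) \<in> opairs n" "(k,i) \<in> opairs n" using ik upairs_opairs by blast+
    \<comment> \<open>The winding under \<open>\<alpha> k\<close> inside core \<open>i\<close>,
      computed once from the meridians and once from \<open>e\<close>. The case distinction arises
      because \<open>mu_sum\<close> places the meridian of a pair in the core of the smaller
      index.\<close>
    have main: "(if i < k then x (i,k) else 0) = r i k + row_sum n P i - P i k"
      if oik: "(i,k) \<in> opairs n" for i k
    proof -
      have ik': "i < n" "k < n" "k \<noteq> i" "i \<noteq> k" using oik by (auto simp: opairs_def)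
      have "bounds_in 1 (A i) (chain_part 1 (A i) (mu_sum x - e))"
        using e(2) ik' bounds_part [OF sep_A, of i 1 "mu_sum x - e"] by (simp add: homologous_rel_def AA_def)
      then have "winding (\<alpha> k) (chain_part 1 (A i) (mu_sum x - e)) = 0"
        using wind_bounds_\<alpha> A_sub ik' by blast
      then have "(if i < k then of_int (x (i,k)) else 0) = winding (\<alpha> k) (chain_part 1 (A i) e)"
        using wind_part_mu_sum [OF ik'(1,2,3)] by (simp add: part_diff winding_diff)
      also have "\<dots> = (\<Sum>j\<in>{..<n}-{i}. winding (\<alpha> k) (E i j))"
        unfolding part_A_eq [OF ec ik'(1)] winding_sum E_def ..
      also have "\<dots> = (\<Sum>j\<in>{..<n}-{i}. of_int (P i j + (if j = k then r i k - P i k else 0)))"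
      proof (intro sum.cong refl)
        fix j assume j: "j \<in> {..<n} - {i}"
        then have oj: "(i,j) \<in> opairs n" using ik' by (auto simp: opairs_def)
        show "winding (\<alpha> k) (E i j) = of_int (P i j + (if j = k then r i k - P i k else 0))"
          using r [OF oj] P [OF oj] wind_neck [OF oj ik'(2,3) _ EB [OF oj]] by auto
      qed
      also have "\<dots> = of_int ((\<Sum>j\<in>{..<n}-{i}. P i j) + (r i k - P i k))"
        unfolding of_int_sum [symmetric] sum.distrib using ik' by simp
      also have "(\<Sum>j\<in>{..<n}-{i}. P i j) = row_sum n P i"
      proof -
        have "P i i = 0" by (simp add: P_def)
        then show ?thesis using ik' by (simp add: row_sum_def sum_diff1)
      qed
      finally have "(of_int (if i < k then x (i,k) else 0) :: complex) = of_int (row_sum n P i + (r i k - P i k))"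
        by (cases "i < k") simp_all
      then show ?thesis
        unfolding of_int_eq_iff by simp
    qed
    have "winding (\<alpha> k) (E i k + E k i) = 0"
      using wind_bounds_\<alpha> [OF bB [OF ik] B_sub [OF o(1)]] o by (auto simp: opairs_def)
    moreover have "winding (\<alpha> k) (E k i) = - of_int (r k i) - (of_nat n - 2) * of_int (P k i)"
      using wind_opposite [OF o(2) EB [OF o(2)]] r [OF o(2)] P [OF o(2)] by simp
    ultimately have "(of_int (r i k) :: complex) = of_int (r k i + (int n - 2) * P k i)"
      using r [OF o(1)] by (simp add: winding_add algebra_simps add_eq_0_iff)
    then have "r i k = r k i + (int n - 2) * P k i"
      unfolding of_int_eq_iff .
    moreover have "i < k" using ik by (simp add: upairs_def)
    ultimately show ?thesis
      using main [OF o(1)] main [OF o(2)] anti [OF ik] by (simp add: algebra_simps)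
  qed
  ultimately show ?thesis
    by (auto simp: relator_def)
qed

lemma mu_sum_bounds_iff: "bounds_in 1 X (mu_sum x) \<longleftrightarrow> relator n x"
  using mu_sum_bounds_relator relator_bounds by blast

section \<open>Loops around triangles and crossing numbers\<close>

definition dA where "dA i j k = (SOME d. chain_in 1 (A i) d \<and> chain_boundary 1 d = point_chain (x0 i k) - point_chain (x0 i j))"
definition dB where "dB i j = (SOME d. chain_in 1 (B i j) d \<and> chain_boundary 1 d = point_chain (x0 j i) - point_chain (x0 i j))"

lemma dA:
  assumes "(i,j) \<in> opairs n" "(i,k) \<in> opairs n"
  shows "chain_in 1 AA (dA i j k)" "chain_boundary 1 (dA i j k) = point_chain (x0 i k) - point_chain (x0 i j)"
proof -
  have *: "chain_in 1 (A i) (dA i j k) \<and> chain_boundary 1 (dA i j k) = point_chain (x0 i k) - point_chain (x0 i j)"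
  proof -
    have "\<exists>d. chain_in 1 (A i) d \<and> chain_boundary 1 d = point_chain (x0 i k) - point_chain (x0 i j)"
      using A_conn [OF assms] by (simp add: singular_boundary)
    from someI_ex [OF this] show ?thesis unfolding dA_def .
  qed
  then show "chain_in 1 AA (dA i j k)"
    using chain_in_mono [OF _ A_in_AA [OF upairs_opairs(4) [OF assms(1)]]] by blast
  show "chain_boundary 1 (dA i j k) = point_chain (x0 i k) - point_chain (x0 i j)" using * by blast
qed

lemma dB:
  assumes "(i,j) \<in> opairs n"
  shows "chain_in 1 BB (dB i j)" "chain_boundary 1 (dB i j) = point_chain (x0 j i) - point_chain (x0 i j)"
proof -
  have *: "chain_in 1 (B i j) (dB i j) \<and> chain_boundary 1 (dB i j) = point_chain (x0 j i) - point_chain (x0 i j)"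
  proof -
    have "\<exists>d. chain_in 1 (B i j) d \<and> chain_boundary 1 d = point_chain (x0 j i) - point_chain (x0 i j)"
      using B_conn [OF assms] by (simp add: singular_boundary)
    from someI_ex [OF this] show ?thesis unfolding dB_def .
  qed
  then show "chain_in 1 BB (dB i j)"
    using B_in_BB [OF assms] chain_in_mono by blast
  show "chain_boundary 1 (dB i j) = point_chain (x0 j i) - point_chain (x0 i j)" using * by blast
qed

text \<open>The core part of a closed path through the cores 0, j, k and the three necks between
  them; \<open>triB\<close> is its neck part. They are kept apart because crossing numbers are read
  off the boundary of the neck part.\<close>

definition triA where "triA e = (case e of (j,k) \<Rightarrow> dA 0 k j + dA j 0 k + dA k j 0)"
definition triB where "triB e = (case e of (j,k) \<Rightarrow> dB 0 j + dB j k + dB k 0)"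

lemma upairs1_opairs:
  assumes "(j,k) \<in> upairs1 n"
  shows "(j,k) \<in> opairs n" "(k,j) \<in> opairs n" "(0,j) \<in> opairs n" "(j,0) \<in> opairs n" "(0,k) \<in> opairs n" "(k,0) \<in> opairs n"
  using assms by (auto simp: upairs1_def opairs_def)

lemma tri:
  assumes "e \<in> upairs1 n"
  shows "chain_in 1 AA (triA e)" "chain_in 1 BB (triB e)" "chain_boundary 1 (triA e) = - chain_boundary 1 (triB e)"
proof -
  obtain j k where e: "e = (j,k)" by fastforce
  note o = upairs1_opairs [OF assms [unfolded e]]
  show "chain_in 1 AA (triA e)" "chain_in 1 BB (triB e)"
    unfolding triA_def triB_def e using o by (auto intro!: singular_chain_add dA dB simp del: One_nat_def)
  show "chain_boundary 1 (triA e) = - chain_boundary 1 (triB e)"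
    unfolding triA_def triB_def e using o by (simp add: chain_boundary_add dA dB del: One_nat_def)
qed

definition tri_sum where "tri_sum y = (\<Sum>e\<in>upairs1 n. frag_cmul (y e) (triA e + triB e))"
definition triA_sum where "triA_sum y = (\<Sum>e\<in>upairs1 n. frag_cmul (y e) (triA e))"
definition triB_sum where "triB_sum y = (\<Sum>e\<in>upairs1 n. frag_cmul (y e) (triB e))"

lemma tri_sum_eq: "tri_sum y = triA_sum y + triB_sum y"
  by (simp add: tri_sum_def triA_sum_def triB_sum_def frag_cmul_distrib2 sum.distrib)

lemma tri_sum_in:
  "chain_in 1 AA (triA_sum y)" "chain_in 1 BB (triB_sum y)" "chain_boundary 1 (triA_sum y) = - chain_boundary 1 (triB_sum y)"
proof -
  show "chain_in 1 AA (triA_sum y)" "chain_in 1 BB (triB_sum y)"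
    unfolding triA_sum_def triB_sum_def by (auto intro!: chain_in_sum singular_chain_cmul tri simp del: One_nat_def)
  show "chain_boundary 1 (triA_sum y) = - chain_boundary 1 (triB_sum y)"
    unfolding triA_sum_def triB_sum_def chain_boundary_sum sum_negf [symmetric]
    by (intro sum.cong refl) (simp add: chain_boundary_cmul tri(3) frag_cmul_cmul [of _ "-1"] flip: frag_cmul_minus_one del: One_nat_def)
qed

lemma tri_sum_cycle: "cycle_in 1 X (tri_sum y)"
  unfolding singular_cycle tri_sum_eq
  using tri_sum_in [of y] chain_in_mono [OF _ AA_sub] chain_in_mono [OF _ BB_sub]
  by (auto simp: chain_boundary_add intro: singular_chain_add)

text \<open>Applied to the boundary of the neck part of a cycle, this is the component at the neck
  end \<open>e\<close> of the connecting homomorphism into H_0. These numbers form a flow on the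
  complete graph.\<close>

definition crossing where "crossing e z = aug (chain_part 0 (N e) z)"

lemma crossing_linear:
  "crossing e (z + w) = crossing e z + crossing e w" "crossing e (z - w) = crossing e z - crossing e w"
  "crossing e (frag_cmul k z) = k * crossing e z" "crossing e (sum f I) = (\<Sum>i\<in>I. crossing e (f i))"
  by (simp_all add: crossing_def part_add part_diff part_cmul part_sum pt_eval_add pt_eval_diff pt_eval_cmul pt_eval_sum)

lemma crossing_point:
  assumes "e \<in> opairs n" "(k,l) \<in> opairs n"
  shows "crossing e (point_chain (x0 k l)) = (if e = (k,l) then 1 else 0)"
proof -
  have "chain_in 0 (N (k,l)) (point_chain (x0 k l))"
    using x0_in [OF assms(2)] by (auto simp: N_def intro: point_chain_in)
  note * = this
  show ?thesis
    using part_self [OF *] part_disjoint [OF * N_disjoint [OF assms]] by (auto simp: crossing_def)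
qed

text \<open>An edge that avoids vertex 0 lies in only one of the triangles with vertex 0, so it
  isolates one coefficient. The end \<open>(q,p)\<close> is the one at which the path of
  \<open>triB\<close> leaves the neck, hence the sign +.\<close>

lemma crossing_triB:
  assumes "(p,q) \<in> upairs1 n" "e \<in> upairs1 n"
  shows "crossing (q,p) (chain_boundary 1 (triB e)) = (if e = (p,q) then 1 else 0)"
proof -
  obtain j k where e: "e = (j,k)" by fastforce
  note o = upairs1_opairs [OF assms(2) [unfolded e]]
  have qp: "(q,p) \<in> opairs n" using upairs1_opairs [OF assms(1)] by blast
  have "crossing (q,p) (chain_boundary 1 (triB e)) =
      (if (q,p) = (j,0) then 1 else 0) - (if (q,p) = (0,j) then 1 else 0)
    + ((if (q,p) = (k,j) then 1 else 0) - (if (q,p) = (j,k) then 1 else 0))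
    + ((if (q,p) = (0,k) then 1 else 0) - (if (q,p) = (k,0) then 1 else 0))"
    unfolding triB_def e using o qp
    by (simp add: chain_boundary_add dB crossing_linear crossing_point del: One_nat_def prod.inject)
  then show ?thesis
    using assms by (auto simp: e upairs1_def)
qed

lemma crossing_triB_sum:
  assumes "(p,q) \<in> upairs1 n"
  shows "crossing (q,p) (chain_boundary 1 (triB_sum y)) = y (p,q)"
proof -
  have "crossing (q,p) (chain_boundary 1 (triB_sum y)) = (\<Sum>e\<in>upairs1 n. y e * (if e = (p,q) then 1 else 0))"
    unfolding triB_sum_def chain_boundary_sum crossing_linear
    by (intro sum.cong refl) (simp add: chain_boundary_cmul crossing_linear crossing_triB [OF assms] del: One_nat_def)
  also have "\<dots> = (\<Sum>e\<in>upairs1 n. if e = (p,q) then y (p,q) else 0)"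
    by (intro sum.cong) auto
  also have "\<dots> = y (p,q)" using assms by simp
  finally show ?thesis .
qed

lemma crossing_boundary_zero:
  assumes u: "chain_in 1 (AA \<inter> BB) u" and "e \<in> opairs n"
  shows "crossing e (chain_boundary 1 u) = 0"
proof -
  have "chain_boundary 1 (chain_part 1 (N e) u) = chain_part 0 (N e) (chain_boundary 1 u)"
    using part_boundary [OF sep_N assms(2), of 0 u] u by (simp add: N_Union)
  then show ?thesis
    by (metis crossing_def aug_boundary(1))
qed

text \<open>What enters a neck at one end leaves it at the other.\<close>

lemma crossing_antisym:
  assumes e: "chain_in 1 BB e" "chain_in 0 (AA \<inter> BB) (chain_boundary 1 e)" and ij: "(i,j) \<in> upairs n"
  shows "crossing (i,j) (chain_boundary 1 e) + crossing (j,i) (chain_boundary 1 e) = 0"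
proof -
  have "crossing (i,j) (chain_boundary 1 e) + crossing (j,i) (chain_boundary 1 e) = aug (chain_part 0 (B i j) (chain_boundary 1 e))"
    unfolding part_B_eq [OF e(2) ij] by (simp add: crossing_def pt_eval_add)
  also have "chain_part 0 (B i j) (chain_boundary 1 e) = chain_boundary 1 (chain_part 1 (B i j) e)"
    using part_boundary [OF sep_B ij, of 0 e] e(1) by (simp add: BB_def)
  finally show ?thesis by simp
qed

text \<open>Kirchhoff's law at a vertex of the nerve: the part of the boundary in core
  \<open>i\<close> is itself a boundary there, so its augmentation is 0.\<close>

lemma crossing_conservation:
  assumes d: "chain_in 1 AA d" "chain_in 0 (AA \<inter> BB) (chain_boundary 1 d)" and i: "i < n"
  shows "(\<Sum>j\<in>{..<n}-{i}. crossing (i,j) (chain_boundary 1 d)) = 0"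
proof -
  have "(\<Sum>j\<in>{..<n}-{i}. crossing (i,j) (chain_boundary 1 d)) = aug (chain_part 0 (A i) (chain_boundary 1 d))"
    unfolding part_A_eq [OF d(2) i] by (simp add: crossing_def pt_eval_sum)
  also have "chain_part 0 (A i) (chain_boundary 1 d) = chain_boundary 1 (chain_part 1 (A i) d)"
    using part_boundary [OF sep_A, of i 0 d] d(1) i by (simp add: AA_def)
  finally show ?thesis by simp
qed

lemma crossing_zero_bounds:
  assumes z: "chain_in 0 (AA \<inter> BB) z" and cr: "\<And>e. e \<in> opairs n \<Longrightarrow> crossing e z = 0"
  shows "bounds_in 0 (AA \<inter> BB) z"
proof -
  have "bounds_in 0 (AA \<inter> BB) (chain_part 0 (N e) z)" if e: "e \<in> opairs n" for e
  proof -
    have "path_connected (N e)"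
      using neck_path e by (cases e) (simp add: N_def)
    then have "bounds_in 0 (N e) (chain_part 0 (N e) z)"
      using cr [OF e] by (intro aug_zero_bounds part_N_in z) (auto simp: crossing_def)
    then show ?thesis
      by (rule bounds_in_mono) (use N_Union e in blast)
  qed
  then have "bounds_in 0 (AA \<inter> BB) (\<Sum>e\<in>opairs n. chain_part 0 (N e) z)"
    by (rule bounds_in_sum)
  then show ?thesis
    unfolding sum_part_N [OF z] .
qed

text \<open>Necks contribute no further classes: by \<open>neck_loop\<close> every pair of neck
  windings is realised at the end in core \<open>i\<close>, and \<open>B_inj\<close> makes the
  difference bound.\<close>

lemma BB_representation:
  assumes c: "cycle_in 1 BB c"
  obtains d where "cycle_in 1 AA d" "c \<sim> d"
proof -
  have cB: "cycle_in (Suc 0) (\<Union>(case_prod B ` upairs n)) c" using c by (simp add: BB_def)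
  have "\<exists>l. cycle_in 1 AA l \<and> chain_part 1 (case_prod B e) c \<sim> l" if e: "e \<in> upairs n" for e
  proof -
    obtain i j where ij: "e = (i,j)" by fastforce
    have o: "(i,j) \<in> opairs n" using e ij upairs_opairs by blast
    let ?c = "chain_part 1 (B i j) c"
    have ci: "cycle_in 1 (B i j) ?c"
      using cycle_part [OF sep_B e cB] by (simp add: ij)
    obtain l where l: "cycle_in 1 (A i \<inter> B i j) l" "winding (\<gamma> i j) l = of_int (wint (\<gamma> i j) ?c)"
      "winding (\<alpha> j) l = of_int (wint (\<alpha> j) ?c)"
      using neck_loop [OF o] by blast
    have lB: "cycle_in 1 (B i j) l" by (rule cycle_in_mono [OF l(1)]) auto
    have "bounds_in 1 X (?c - l)"
    proof (rule B_inj [OF o singular_relcycle_diff [OF ci lB]])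
      show "winding (\<gamma> i j) (?c - l) = 0"
        using l(2) wint_\<gamma> [OF ci _ o] by (simp add: winding_diff)
      show "winding (\<alpha> j) (?c - l) = 0"
        using l(3) wint_\<alpha> [OF ci B_sub [OF o]] o by (simp add: winding_diff opairs_def)
    qed
    moreover have "cycle_in 1 AA l"
      by (rule cycle_in_mono [OF l(1)]) (use o in \<open>auto simp: AA_def opairs_def\<close>)
    ultimately show ?thesis
      by (auto simp: homologous_rel_def ij)
  qed
  then obtain l where l: "\<And>e. e \<in> upairs n \<Longrightarrow> cycle_in 1 AA (l e) \<and> chain_part 1 (case_prod B e) c \<sim> l e"
    by metis
  have "(\<Sum>e\<in>upairs n. chain_part 1 (case_prod B e) c) \<sim> (\<Sum>e\<in>upairs n. l e)"
    using l by (intro homologous_sum) auto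
  moreover have "(\<Sum>e\<in>upairs n. chain_part 1 (case_prod B e) c) = c"
    using chain_sum_parts [OF sep_B cycle_in_imp_chain_in [OF cB]] by simp
  moreover have "cycle_in 1 AA (\<Sum>e\<in>upairs n. l e)"
    using l by (intro cycle_in_sum) auto
  ultimately show ?thesis using that by simp
qed

text \<open>The cycle is split into a core part and a neck part, and triangle loops are subtracted
  until no crossing is left. The parts can then be closed up to cycles inside the cores and the
  necks, where meridians suffice.\<close>

lemma generated:
  assumes c: "cycle_in 1 X c"
  shows "\<exists>x y. c \<sim> mu_sum x + tri_sum y"
proof -
  obtain d e where de: "chain_in 1 AA d" "chain_in 1 BB e" "c \<sim> d + e"
    using MV_cycle [OF open_cover, of 1 c] c unfolding AA_BB by metis
  have "cycle_in 1 X (d + e)"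
    using de(3) c homologous_rel_singular_relcycle by blast
  then have bd: "chain_boundary 1 d = - chain_boundary 1 e"
    by (simp add: singular_cycle chain_boundary_add eq_neg_iff_add_eq_0)
  define y where "y = (\<lambda>(p,q). crossing (q,p) (chain_boundary 1 e))"
  define d' where "d' = d - triA_sum y"
  define e' where "e' = e - triB_sum y"
  have d': "chain_in 1 AA d'" and e': "chain_in 1 BB e'"
    unfolding d'_def e'_def using de tri_sum_in by (auto intro: singular_chain_diff)
  have bd': "chain_boundary 1 d' = - chain_boundary 1 e'"
    unfolding d'_def e'_def using bd tri_sum_in(3) by (simp add: chain_boundary_diff)
  have "chain_in 0 AA (chain_boundary 1 d')" "chain_in 0 BB (chain_boundary 1 e')"
    using singular_chain_boundary [OF d'] singular_chain_boundary [OF e'] by simp_all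
  then have be: "chain_in 0 (AA \<inter> BB) (chain_boundary 1 e')"
    using bd' by (metis chain_in_Int minus_minus singular_chain_minus)
  then have bdd: "chain_in 0 (AA \<inter> BB) (chain_boundary 1 d')"
    using bd' by (metis singular_chain_minus)
  let ?cr = "\<lambda>e. crossing e (chain_boundary 1 e')"
  have anti: "?cr (i,j) + ?cr (j,i) = 0" if "(i,j) \<in> upairs n" for i j
    by (rule crossing_antisym [OF e' be that])
  have cr0: "crossing f (chain_boundary 1 d') = - ?cr f" for f
    unfolding bd' using crossing_linear(3) [of f "-1"] by simp
  have cons: "(\<Sum>j\<in>{..<n}-{i}. ?cr (i,j)) = 0" if "i < n" for i
    using crossing_conservation [OF d' bdd that] unfolding cr0 sum_negf by simp
  \<comment> \<open>The triangle loops remove the flow on all edges avoiding vertex 0. What remains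
    is a flow on a star, and conservation at the outer vertices makes it vanish.\<close>
  have 1: "?cr (q,p) = 0" if "(p,q) \<in> upairs1 n" for p q
    using crossing_triB_sum [OF that, of y]
    by (simp add: e'_def chain_boundary_diff crossing_linear y_def del: One_nat_def)
  have 2: "?cr (p,q) = 0" if "(p,q) \<in> upairs1 n" for p q
    using 1 [OF that] anti [of p q] that by (simp add: upairs1_def upairs_def)
  have 3: "?cr (i,j) = 0" if "(i,j) \<in> opairs n" "i \<noteq> 0" "j \<noteq> 0" for i j
    using 1 [of j i] 2 [of i j] that by (cases "i < j") (auto simp: opairs_def upairs1_def)
  have 4: "?cr (i,0) = 0" if i: "i < n" "i \<noteq> 0" for i
  proof -
    have "0 = (\<Sum>j\<in>{..<n}-{i}. ?cr (i,j))" using cons i by simp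
    also have "\<dots> = ?cr (i,0) + (\<Sum>j\<in>{..<n}-{i}-{0}. ?cr (i,j))"
      using i by (subst sum.remove [of _ 0]) auto
    also have "(\<Sum>j\<in>{..<n}-{i}-{0}. ?cr (i,j)) = 0"
      using i 3 by (intro sum.neutral) (auto simp: opairs_def)
    finally show ?thesis by simp
  qed
  have "?cr f = 0" if "f \<in> opairs n" for f
  proof -
    obtain i j where ij: "f = (i,j)" by fastforce
    consider "i \<noteq> 0" "j \<noteq> 0" | "j = 0" | "i = 0" by auto
    then show ?thesis
    proof cases
      case 3
      then have "(0,j) \<in> upairs n" using that ij by (auto simp: opairs_def upairs_def)
      then show ?thesis using anti [of 0 j] 4 [of j] 3 ij that by (auto simp: opairs_def)
    qed (use 3 4 that ij in \<open>auto simp: opairs_def\<close>)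
  qed
  then have "bounds_in 0 (AA \<inter> BB) (chain_boundary 1 e')"
    by (rule crossing_zero_bounds [OF be])
  \<comment> \<open>\<open>u\<close> joins the remaining boundary points inside the neck ends;
    adding it to one part and subtracting it from the other makes both of them cycles.\<close>
  then obtain u where u: "chain_in 1 (AA \<inter> BB) u" "chain_boundary 1 u = chain_boundary 1 e'"
    by (auto simp: singular_boundary)
  have uAB: "chain_in 1 AA u" "chain_in 1 BB u"
    by (rule chain_in_mono [OF u(1)], simp)+
  have cA: "cycle_in 1 AA (d' + u)" and cB: "cycle_in 1 BB (e' - u)"
    using d' e' uAB bd' u(2)
    by (auto simp: singular_cycle chain_boundary_add chain_boundary_diff intro: singular_chain_add singular_chain_diff)
  obtain g where g: "cycle_in 1 AA g" "e' - u \<sim> g"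
    using BB_representation [OF cB] by blast
  obtain x where x: "(d' + u) + g \<sim> mu_sum x"
    using AA_representation [OF singular_relcycle_add [OF cA g(1)]] by blast
  have "(d' + u) + (e' - u) \<sim> (d' + u) + g"
    using g(2) by (intro homologous_rel_add) auto
  then have "(d' + u) + (e' - u) \<sim> mu_sum x"
    using x homologous_rel_trans by blast
  then have "(d' + u) + (e' - u) + tri_sum y \<sim> mu_sum x + tri_sum y"
    by (intro homologous_rel_add) auto
  moreover have "(d' + u) + (e' - u) + tri_sum y = d + e"
    by (simp add: d'_def e'_def tri_sum_eq)
  ultimately show ?thesis
    using de(3) homologous_rel_trans by metis
qed

text \<open>For a bounding cycle the crossing numbers vanish; since they recover \<open>y\<close>,
  only the meridian part remains.\<close>

lemma bounds_iff:
  "bounds_in 1 X (mu_sum x + tri_sum y) \<longleftrightarrow> relator n x \<and> (\<forall>e\<in>upairs1 n. y e = 0)"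
proof
  assume bd: "bounds_in 1 X (mu_sum x + tri_sum y)"
  have eq: "mu_sum x + tri_sum y = (mu_sum x + triA_sum y) + triB_sum y"
    by (simp add: tri_sum_eq)
  have "chain_in 1 AA (mu_sum x + triA_sum y)"
    using cycle_in_imp_chain_in [OF mu_sum_cycle] tri_sum_in(1) by (rule singular_chain_add)
  then obtain u where u: "chain_in 1 (AA \<inter> BB) u" "chain_boundary 1 u = chain_boundary 1 (triB_sum y)"
    using MV_connecting [OF open_cover _ tri_sum_in(2)] bd unfolding AA_BB eq by metis
  have y0: "y (p,q) = 0" if "(p,q) \<in> upairs1 n" for p q
    using crossing_triB_sum [OF that, of y] crossing_boundary_zero [OF u(1) upairs1_opairs(2) [OF that]] u(2) by simp
  then have "tri_sum y = 0"
    unfolding tri_sum_def by (intro sum.neutral) auto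
  with bd y0 show "relator n x \<and> (\<forall>e\<in>upairs1 n. y e = 0)"
    using mu_sum_bounds_iff by auto
next
  assume *: "relator n x \<and> (\<forall>e\<in>upairs1 n. y e = 0)"
  then have "tri_sum y = 0"
    unfolding tri_sum_def by (intro sum.neutral) auto
  with * show "bounds_in 1 X (mu_sum x + tri_sum y)"
    using mu_sum_bounds_iff by simp
qed

end

section \<open>The relation lattice\<close>

definition skew :: "(nat \<times> nat \<Rightarrow> int) \<Rightarrow> nat \<Rightarrow> nat \<Rightarrow> int"
  where "skew x i j = (if i < j then x (i,j) else if j < i then - x (j,i) else 0)"

definition divergence :: "nat \<Rightarrow> (nat \<times> nat \<Rightarrow> int) \<Rightarrow> nat \<Rightarrow> int"
  where "divergence n x j = (\<Sum>k<n. skew x j k)"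

text \<open>The sum of the skew extension of \<open>x\<close> around the triangle 1, j, k. Vertex 1
  is the base point, so that the entries in row 0 stay free for prescribing the divergences.\<close>

definition holonomy :: "nat \<times> nat \<Rightarrow> (nat \<times> nat \<Rightarrow> int) \<Rightarrow> int"
  where "holonomy e x = skew x (fst e) (snd e) - skew x 1 (snd e) + skew x 1 (fst e)"

definition upairs2 :: "nat \<Rightarrow> (nat \<times> nat) set"
  where "upairs2 n = {(i,j). 2 \<le> i \<and> i < j \<and> j < n}"

lemma skew_swap: "skew x j i = - skew x i j"
  by (auto simp: skew_def)

lemma skew_sum_zero:
  fixes f :: "nat \<Rightarrow> nat \<Rightarrow> int"
  assumes "finite I" "\<And>i j. i \<in> I \<Longrightarrow> j \<in> I \<Longrightarrow> f j i = - f i j"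
  shows "(\<Sum>i\<in>I. \<Sum>j\<in>I. f i j) = 0"
proof -
  have "(\<Sum>i\<in>I. \<Sum>j\<in>I. f i j) = (\<Sum>j\<in>I. \<Sum>i\<in>I. f i j)"
    by (rule sum.swap)
  also have "\<dots> = (\<Sum>j\<in>I. \<Sum>i\<in>I. - f j i)"
    by (intro sum.cong refl assms(2))
  also have "\<dots> = - (\<Sum>i\<in>I. \<Sum>j\<in>I. f i j)"
    by (simp add: sum_negf)
  finally show ?thesis by simp
qed

text \<open>Modulo \<open>n\<close> a relator is a coboundary, and over the integers its divergences
  vanish because the row sums of \<open>P\<close> add up to 0. Conversely, trivial holonomy modulo
  \<open>n\<close> yields a potential \<open>S\<close>, and vanishing divergence makes
  \<open>S\<close> the row sums of the quotient matrix.\<close>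

lemma relator_iff:
  assumes n: "n \<ge> 1"
  shows "relator n x \<longleftrightarrow> (\<forall>j\<in>{1..<n}. divergence n x j = 0) \<and> (\<forall>e\<in>upairs2 n. int n dvd holonomy e x)"
proof
  assume "relator n x"
  then obtain P where P: "antisym_fun n P"
    "\<And>i j. (i,j) \<in> upairs n \<Longrightarrow> x (i,j) = row_sum n P i - row_sum n P j - int n * P i j"
    by (auto simp: relator_def)
  have PP: "P j i = - P i j" if "i < n" "j < n" for i j
    using P(1) that unfolding antisym_fun_def by blast
  have sk: "skew x i j = row_sum n P i - row_sum n P j - int n * P i j" if ij: "i < n" "j < n" for i j
  proof -
    consider "i < j" | "j < i" | "i = j" by linarith
    then show ?thesis
    proof cases
      case 2
      then show ?thesis
        using P(2) [of j i] PP [OF ij] ij by (simp add: skew_def upairs_def)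
    next
      case 3
      then show ?thesis
        using PP [of i i] ij by (simp add: skew_def)
    qed (use P(2) [of i j] ij in \<open>simp add: skew_def upairs_def\<close>)
  qed
  have S0: "(\<Sum>i<n. row_sum n P i) = 0"
    unfolding row_sum_def by (rule skew_sum_zero) (auto intro: PP)
  have "divergence n x j = 0" if "j \<in> {1..<n}" for j
  proof -
    have "divergence n x j = (\<Sum>k<n. row_sum n P j - row_sum n P k - int n * P j k)"
      unfolding divergence_def using that by (intro sum.cong refl sk) auto
    also have "\<dots> = int n * row_sum n P j - (\<Sum>k<n. row_sum n P k) - int n * row_sum n P j"
      by (simp add: sum_subtractf sum_distrib_left row_sum_def)
    finally show ?thesis using S0 by simp
  qed
  moreover have "int n dvd holonomy e x" if "e \<in> upairs2 n" for e
  proof -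
    obtain j k where e: "e = (j,k)" by fastforce
    have "holonomy e x = int n * (P 1 k - P j k - P 1 j)"
      using that e sk [of j k] sk [of 1 k] sk [of 1 j] by (simp add: holonomy_def upairs2_def algebra_simps)
    then show ?thesis by simp
  qed
  ultimately show "(\<forall>j\<in>{1..<n}. divergence n x j = 0) \<and> (\<forall>e\<in>upairs2 n. int n dvd holonomy e x)"
    by blast
next
  assume R: "(\<forall>j\<in>{1..<n}. divergence n x j = 0) \<and> (\<forall>e\<in>upairs2 n. int n dvd holonomy e x)"
  \<comment> \<open>Its differences determine a potential modulo \<open>n\<close> up to a constant,
    so the entries of column 1 are taken. The value at 0 is fixed by the requirement that the row
    sums of a skew matrix add up to 0; that it is also right modulo \<open>n\<close> is shown in
    \<open>col0\<close>.\<close>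
  define S where "S i = (if i = 0 then - (\<Sum>k\<in>{1..<n}. skew x k 1) else skew x i 1)" for i
  have split0: "(\<Sum>k<n. f k) = f 0 + (\<Sum>k\<in>{1..<n}. f k)" for f :: "nat \<Rightarrow> int"
    using n by (simp add: lessThan_atLeast0 sum.atLeast_Suc_lessThan)
  have S1: "(\<Sum>k\<in>{1..<n}. S k) = - S 0"
    by (simp add: S_def)
  have SS: "(\<Sum>k<n. S k) = 0"
    unfolding split0 S1 by simp
  have pos: "int n dvd S i - S j - skew x i j" if ij: "i \<in> {1..<n}" "j \<in> {1..<n}" for i j
  proof -
    have lt: "int n dvd S i - S j - skew x i j" if "2 \<le> i" "i < j" "j < n" for i j
    proof -
      have "int n dvd - holonomy (i,j) x" using R that by (auto simp: upairs2_def)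
      moreover have "S i - S j - skew x i j = - holonomy (i,j) x"
        using that skew_swap [of x 1 i] skew_swap [of x 1 j] by (simp add: S_def holonomy_def)
      ultimately show ?thesis by simp
    qed
    consider "i = j" | "i = 1" | "j = 1" | "2 \<le> i" "i < j" | "2 \<le> j" "j < i"
      using ij by fastforce
    then show ?thesis
    proof cases
      case 2
      then show ?thesis using ij skew_swap [of x 1 j] by (simp add: S_def skew_def)
    next
      case 5
      then have "int n dvd - (S j - S i - skew x j i)" using lt [of j i] ij by (simp only: dvd_minus_iff) auto
      then show ?thesis using skew_swap [of x j i] by (simp add: algebra_simps)
    qed (use ij lt in \<open>auto simp: S_def skew_def\<close>)
  qed
  \<comment> \<open>No triangle condition involves vertex 0. The congruence follows by summing those
    of row \<open>i\<close> over the other columns and using the vanishing divergence at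
    \<open>i\<close>.\<close>
  have col0: "int n dvd S i - S 0 - skew x i 0" if i: "i \<in> {1..<n}" for i
  proof -
    have D: "skew x i 0 = - (\<Sum>k\<in>{1..<n}. skew x i k)"
      using R i split0 [of "skew x i"] by (simp add: divergence_def)
    have "int n dvd (\<Sum>k\<in>{1..<n}. S i - S k - skew x i k)"
      using pos i by (intro dvd_sum) auto
    moreover have "(\<Sum>k\<in>{1..<n}. S i - S k - skew x i k) = (int n - 1) * S i + S 0 + skew x i 0"
      using n D S1 by (simp add: sum_subtractf of_nat_diff)
    ultimately have "int n dvd int n * S i - ((int n - 1) * S i + S 0 + skew x i 0)"
      by (intro dvd_diff) auto
    then show ?thesis by (simp add: algebra_simps)
  qed
  have all: "int n dvd S i - S j - skew x i j" if ij: "i < n" "j < n" for i j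
  proof -
    consider "i = 0" "j = 0" | "i = 0" "j \<in> {1..<n}" | "i \<in> {1..<n}" "j = 0" | "i \<in> {1..<n}" "j \<in> {1..<n}"
      using ij by fastforce
    then show ?thesis
    proof cases
      case 2
      then have "int n dvd - (S j - S 0 - skew x j 0)" using col0 [of j] by (simp only: dvd_minus_iff)
      then show ?thesis using skew_swap [of x j 0] 2 by (simp add: algebra_simps)
    qed (use pos col0 in \<open>auto simp: skew_def\<close>)
  qed
  define P where "P i j = (S i - S j - skew x i j) div int n" for i j
  have nP: "int n * P i j = S i - S j - skew x i j" if "i < n" "j < n" for i j
    unfolding P_def using all [OF that] by simp
  have "antisym_fun n P"
    unfolding antisym_fun_def
  proof (intro allI impI)
    fix i j assume ij: "i < n" "j < n"
    have "int n * P j i = int n * (- P i j)"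
      using nP [OF ij] nP [OF ij(2,1)] skew_swap [of x i j] by simp
    then show "P j i = - P i j" using n by (simp only: mult_cancel_left) auto
  qed
  \<comment> \<open>The divergences of a skew matrix add up to 0, so the one at vertex 0 vanishes
    with the others.\<close>
  moreover have div0: "divergence n x i = 0" if i: "i < n" for i
  proof (cases "i = 0")
    case True
    have "0 = (\<Sum>i<n. divergence n x i)"
      unfolding divergence_def by (subst skew_sum_zero) (auto intro: skew_swap)
    also have "\<dots> = divergence n x 0 + (\<Sum>i\<in>{1..<n}. divergence n x i)"
      by (rule split0)
    also have "(\<Sum>i\<in>{1..<n}. divergence n x i) = 0"
      using R by (intro sum.neutral) auto
    finally show ?thesis using True by simp
  qed (use R i in auto)
  have "row_sum n P i = S i" if i: "i < n" for i
  proof -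
    have "int n * row_sum n P i = (\<Sum>j<n. S i - S j - skew x i j)"
      unfolding row_sum_def sum_distrib_left using i by (intro sum.cong refl nP) auto
    also have "\<dots> = int n * S i"
      using SS div0 [OF i] by (simp add: sum_subtractf divergence_def)
    finally show ?thesis using n by simp
  qed
  then have "x (i,j) = row_sum n P i - row_sum n P j - int n * P i j" if "(i,j) \<in> upairs n" for i j
    using that nP [of i j] by (simp add: upairs_def skew_def)
  ultimately show "relator n x"
    by (auto simp: relator_def)
qed

section \<open>Presentation of the target group\<close>

lemma card_upairs_from: "2 * card {(i,j). a \<le> i \<and> i < j \<and> j < n} = (n - a) * (n - a - 1)"
proof (induction n)
  case (Suc n)
  have fin: "finite {(i,j). a \<le> i \<and> i < j \<and> j < n}"
    by (rule finite_subset [of _ "{..<n} \<times> {..<n}"]) auto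
  have "{(i,j). a \<le> i \<and> i < j \<and> j < Suc n} = {(i,j). a \<le> i \<and> i < j \<and> j < n} \<union> {a..<n} \<times> {n}"
    by auto
  moreover have "{(i,j). a \<le> i \<and> i < j \<and> j < n} \<inter> {a..<n} \<times> {n} = {}"
    by auto
  ultimately have "card {(i,j). a \<le> i \<and> i < j \<and> j < Suc n} = card {(i,j). a \<le> i \<and> i < j \<and> j < n} + (n - a)"
    using fin by (simp add: card_Un_disjoint)
  then have "2 * card {(i,j). a \<le> i \<and> i < j \<and> j < Suc n} = (n - a) * (n - a - 1) + 2 * (n - a)"
    using Suc by simp
  also have "\<dots> = (Suc n - a) * (Suc n - a - 1)"
  proof (cases "a \<le> n")
    case True
    then obtain m where "n = a + m" using le_Suc_ex by blast
    then show ?thesis by (cases m) (auto simp: algebra_simps)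
  qed simp
  finally show ?case .
qed auto

definition pair_group :: "((nat \<times> nat \<Rightarrow> int) \<times> (nat \<times> nat \<Rightarrow> int)) monoid"
  where "pair_group = \<lparr>carrier = UNIV, monoid.mult = (\<lambda>p q. (\<lambda>e. fst p e + fst q e, \<lambda>e. snd p e + snd q e)),
     one = (\<lambda>e. 0, \<lambda>e. 0)\<rparr>"

lemma group_pair_group: "group pair_group"
proof (rule groupI)
  fix p assume "p \<in> carrier pair_group"
  show "\<exists>q\<in>carrier pair_group. q \<otimes>\<^bsub>pair_group\<^esub> p = \<one>\<^bsub>pair_group\<^esub>"
    by (rule bexI [of _ "(\<lambda>e. - fst p e, \<lambda>e. - snd p e)"]) (auto simp: pair_group_def)
qed (auto simp: pair_group_def algebra_simps)

text \<open>Both groups are the quotient of \<open>H\<close> by the same normal subgroup. In this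
  way homology and target are compared without an explicit map between them.\<close>

lemma iso_of_equal_kernels:
  assumes "group H" "group G" "group K" "f \<in> hom H G" "g \<in> hom H K"
    "f ` carrier H = carrier G" "g ` carrier H = carrier K" "kernel H G f = kernel H K g"
  shows "G \<cong> K"
proof -
  interpret f: group_hom H G f using assms by (simp add: group_hom_def group_hom_axioms_def)
  interpret g: group_hom H K g using assms by (simp add: group_hom_def group_hom_axioms_def)
  have "H Mod kernel H G f \<cong> G" using f.FactGroup_iso assms by blast
  moreover have "H Mod kernel H G f \<cong> K" using g.FactGroup_iso assms by simp
  moreover have "group (H Mod kernel H G f)"
    using f.normal_kernel normal.factorgroup_is_group by blast
  ultimately show ?thesis
    using group.iso_sym iso_trans by blast
qed

lemma skew_add: "skew (\<lambda>e. x e + x' e) i j = skew x i j + skew x' i j"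
  by (simp add: skew_def)

lemma group_Zsum: "group (Zsum_group r m s)"
  unfolding Zsum_group_def by (rule product_group) auto

text \<open>The free coordinates are the triangle coefficients and the divergences at the vertices
  1, ..., n - 1; their number is (n-1)(n-2)/2 + (n-1) = n(n-1)/2. The torsion coordinates are the
  holonomies modulo \<open>n\<close>. By \<open>relator_iff\<close> all of them vanish exactly on
  the relations.\<close>

lemma Zsum_presentation:
  assumes n: "n \<ge> 1"
  obtains \<phi> where "\<phi> \<in> hom pair_group (Zsum_group (n * (n - 1) div 2) n (nat (((int n - 2) * (int n - 3)) div 2)))"
    "\<phi> ` UNIV = carrier (Zsum_group (n * (n - 1) div 2) n (nat (((int n - 2) * (int n - 3)) div 2)))"
    "\<And>x y. \<phi> (x,y) = \<one>\<^bsub>Zsum_group (n * (n - 1) div 2) n (nat (((int n - 2) * (int n - 3)) div 2))\<^esub>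
       \<longleftrightarrow> relator n x \<and> (\<forall>e\<in>upairs1 n. y e = 0)"
proof -
  define r where "r = n * (n - 1) div 2"
  define s where "s = nat (((int n - 2) * (int n - 3)) div 2)"
  define J :: "((nat \<times> nat) + nat) set" where "J = Inl ` upairs1 n \<union> Inr ` {1..<n}"
  have c1: "2 * card (upairs1 n) = (n - 1) * (n - 1 - 1)"
    using card_upairs_from [of 1 n] by (simp add: upairs1_def)
  have "card J = card (upairs1 n) + (n - 1)"
    unfolding J_def by (subst card_Un_disjoint) (auto simp: card_image)
  then have "2 * card J = (n - 1) * (n - 1 - 1) + 2 * (n - 1)"
    using c1 by linarith
  also have "\<dots> = n * (n - 1)"
  proof -
    obtain m where "n = Suc m" using n by (cases n) auto
    then show ?thesis by (cases m) (auto simp: algebra_simps)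
  qed
  finally have "2 * card J = n * (n - 1)" .
  then have "card J = r" by (simp add: r_def)
  moreover have "finite J" by (simp add: J_def)
  ultimately obtain g where g: "bij_betw g {0..<r} J"
    by (metis ex_bij_betw_nat_finite)
  have finU2: "finite (upairs2 n)"
    by (rule finite_subset [of _ "{..<n} \<times> {..<n}"]) (auto simp: upairs2_def)
  \<comment> \<open>For n = 1 the formula yields \<open>s = 1\<close> although
    \<open>upairs2 n\<close> is empty. The extra factor is the trivial group of integers modulo 1,
    so any \<open>h\<close> will do there.\<close>
  have "\<exists>h. n = 1 \<or> bij_betw h {r..<r+s} (upairs2 n)"
  proof (cases "n = 1")
    case False
    then have n2: "n \<ge> 2" using n by simp
    have "2 * card (upairs2 n) = (n - 2) * (n - 2 - 1)"
      using card_upairs_from [of 2 n] by (simp add: upairs2_def)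
    moreover have "(int n - 2) * (int n - 3) = int ((n - 2) * (n - 2 - 1))"
      using n2 by (cases "n = 2") (auto simp: of_nat_diff)
    ultimately have "(int n - 2) * (int n - 3) = 2 * int (card (upairs2 n))"
      by (metis of_nat_mult of_nat_numeral)
    then have "s = card (upairs2 n)"
      by (simp add: s_def)
    then have "card {r..<r+s} = card (upairs2 n)" by simp
    then show ?thesis
      using finU2 finite_same_card_bij by blast
  qed auto
  then obtain h where h: "n = 1 \<or> bij_betw h {r..<r+s} (upairs2 n)" by blast
  define lin where "lin i p = (case g i of Inl e \<Rightarrow> snd p e | Inr j \<Rightarrow> divergence n (fst p) j)" for i and p :: "(nat \<times> nat \<Rightarrow> int) \<times> (nat \<times> nat \<Rightarrow> int)"
  define \<phi> where "\<phi> p = (\<lambda>i\<in>{0..<r+s}. if i < r then lin i p else holonomy (h i) (fst p) mod int n)" for p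
  let ?Z = "Zsum_group r n s"
  let ?C = "\<lambda>i. if i < r then integer_group else integer_mod_group n"
  have carr: "carrier ?Z = (\<Pi>\<^sub>E i\<in>{0..<r+s}. carrier (?C i))"
    by (simp add: Zsum_group_def product_group_def)
  have cmod: "carrier (integer_mod_group n) = {0..<int n}" "\<one>\<^bsub>integer_mod_group n\<^esub> = 0"
    "x \<otimes>\<^bsub>integer_mod_group n\<^esub> y = (x + y) mod int n" for x y
    using n by (auto simp: integer_mod_group_def)
  have \<phi>_in: "\<phi> p \<in> carrier ?Z" for p
    unfolding carr \<phi>_def using n by (auto simp: cmod integer_group_def)
  have divadd: "divergence n (\<lambda>e. x e + x' e) j = divergence n x j + divergence n x' j" for x x' j
    by (simp add: divergence_def skew_add sum.distrib)
  have holadd: "holonomy e (\<lambda>e. x e + x' e) = holonomy e x + holonomy e x'" for x x' e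
    by (simp add: holonomy_def skew_add)
  have "\<phi> \<in> hom pair_group ?Z"
  proof (rule homI)
    fix p q
    show "\<phi> (p \<otimes>\<^bsub>pair_group\<^esub> q) = \<phi> p \<otimes>\<^bsub>?Z\<^esub> \<phi> q"
    proof
      fix i
      show "\<phi> (p \<otimes>\<^bsub>pair_group\<^esub> q) i = (\<phi> p \<otimes>\<^bsub>?Z\<^esub> \<phi> q) i"
        by (auto simp: \<phi>_def Zsum_group_def product_group_def pair_group_def lin_def cmod integer_group_def
            divadd holadd mod_add_eq split: sum.split)
    qed
  qed (rule \<phi>_in)
  moreover have "\<phi> ` UNIV = carrier ?Z"
  proof (intro equalityI subsetI)
    fix t assume t: "t \<in> carrier ?Z"
    define y where "y e = t (inv_into {0..<r} g (Inl e))" for e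
    define d where "d j = t (inv_into {0..<r} g (Inr j))" for j
    \<comment> \<open>Row 1 is 0, so the holonomy of a triangle is a single entry of
      \<open>x1\<close>; row 0 of \<open>x\<close> then corrects the divergences without affecting
      any holonomy.\<close>
    define x1 where "x1 e = (if fst e \<ge> 2 then t (inv_into {r..<r+s} h e) else 0)" for e :: "nat \<times> nat"
    define x where "x e = (if fst e = 0 then (\<Sum>k\<in>{1..<n}. skew x1 (snd e) k) - d (snd e) else x1 e)" for e
    have "divergence n x j = d j" if j: "j \<in> {1..<n}" for j
    proof -
      have "divergence n x j = skew x j 0 + (\<Sum>k\<in>{1..<n}. skew x j k)"
        unfolding divergence_def using n by (simp add: lessThan_atLeast0 sum.atLeast_Suc_lessThan)
      also have "(\<Sum>k\<in>{1..<n}. skew x j k) = (\<Sum>k\<in>{1..<n}. skew x1 j k)"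
        using j by (intro sum.cong refl) (auto simp: skew_def x_def)
      also have "skew x j 0 = d j - (\<Sum>k\<in>{1..<n}. skew x1 j k)"
        using j by (simp add: skew_def x_def)
      finally show ?thesis by simp
    qed
    note div = this
    have lin_eq: "lin i (x,y) = t i" if i: "i < r" for i
    proof -
      have gi: "g i \<in> J" "inv_into {0..<r} g (g i) = i"
        using g i by (auto simp: bij_betw_def)
      show ?thesis
        using gi div by (cases "g i") (auto simp: lin_def y_def d_def J_def)
    qed
    have tor_eq: "holonomy (h i) x mod int n = t i" if i: "r \<le> i" "i < r + s" for i
    proof -
      have "t i \<in> carrier (?C i)"
        using t i unfolding carr PiE_iff by (metis atLeastLessThan_iff zero_le)
      then have ti: "0 \<le> t i" "t i < int n"
        using i by (auto simp: cmod)
      show ?thesis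
      proof (cases "n = 1")
        case True
        then show ?thesis using ti by simp
      next
        case False
        then have hb: "bij_betw h {r..<r+s} (upairs2 n)" using h by blast
        then have hi: "h i \<in> upairs2 n" "inv_into {r..<r+s} h (h i) = i"
          using i by (auto simp: bij_betw_def)
        then have "holonomy (h i) x = t i"
          by (cases "h i") (auto simp: holonomy_def skew_def x_def x1_def upairs2_def)
        then show ?thesis using ti by simp
      qed
    qed
    have "\<phi> (x,y) = t"
    proof
      fix i
      show "\<phi> (x,y) i = t i"
        using lin_eq [of i] tor_eq [of i] t unfolding carr by (auto simp: \<phi>_def PiE_def extensional_def)
    qed
    then show "t \<in> \<phi> ` UNIV" by blast
  qed (use \<phi>_in in auto)
  moreover have "\<phi> (x,y) = \<one>\<^bsub>?Z\<^esub> \<longleftrightarrow> relator n x \<and> (\<forall>e\<in>upairs1 n. y e = 0)" for x y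
  proof -
    have one: "\<one>\<^bsub>?Z\<^esub> = (\<lambda>i\<in>{0..<r+s}. 0)"
      by (auto simp: Zsum_group_def product_group_def cmod integer_group_def fun_eq_iff)
    have "\<phi> (x,y) = \<one>\<^bsub>?Z\<^esub> \<longleftrightarrow> (\<forall>i\<in>{0..<r+s}. (if i < r then lin i (x,y) else holonomy (h i) x mod int n) = 0)"
      unfolding one \<phi>_def by (auto simp: fun_eq_iff restrict_def)
    also have "\<dots> \<longleftrightarrow> (\<forall>i\<in>{0..<r}. lin i (x,y) = 0) \<and> (\<forall>i\<in>{r..<r+s}. holonomy (h i) x mod int n = 0)"
      by (auto split: if_splits)
    also have "(\<forall>i\<in>{0..<r}. lin i (x,y) = 0) \<longleftrightarrow> (\<forall>w\<in>J. (case w of Inl e \<Rightarrow> y e | Inr j \<Rightarrow> divergence n x j) = 0)"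
    proof -
      have "g ` {0..<r} = J" using g by (simp add: bij_betw_def)
      then show ?thesis
        unfolding lin_def fst_conv snd_conv by (metis (no_types, lifting) imageE imageI)
    qed
    also have "\<dots> \<longleftrightarrow> (\<forall>e\<in>upairs1 n. y e = 0) \<and> (\<forall>j\<in>{1..<n}. divergence n x j = 0)"
      unfolding J_def ball_Un ball_simps(9) sum.case by (rule refl)
    also have "(\<forall>i\<in>{r..<r+s}. holonomy (h i) x mod int n = 0) \<longleftrightarrow> (\<forall>e\<in>upairs2 n. int n dvd holonomy e x)"
    proof (cases "n = 1")
      case True
      then show ?thesis by (auto simp: upairs2_def)
    next
      case False
      then have "upairs2 n = h ` {r..<r+s}" using h by (auto simp: bij_betw_def)
      then show ?thesis by (simp add: dvd_eq_mod_eq_0)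
    qed
    finally show ?thesis
      using relator_iff [OF n] by blast
  qed
  ultimately show ?thesis
    by (rule that [folded r_def s_def])
qed

lemma homologous_set_add:
  assumes "singular_relcycle p X S a" "singular_relcycle p X S b"
  shows "homologous_rel_set p X S a \<otimes>\<^bsub>relative_homology_group (int p) X S\<^esub> homologous_rel_set p X S b
    = homologous_rel_set p X S (a + b)"
proof -
  interpret normal "singular_relboundary_set p X S" "relcycle_group p X S"
    by (rule normal_subgroup_singular_relboundary_relcycle)
  show ?thesis
    using rcos_sum [of a b] assms
    by (simp add: nontrivial_relative_homology_group FactGroup_def right_coset_singular_relboundary)
qed

context neck_decomposition
begin

text \<open>By \<open>generated\<close> the map from coefficients to homology is onto, and by
  \<open>bounds_iff\<close> its kernel is that of \<open>\<phi>\<close>.\<close>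

theorem homology_group_iso:
  assumes n: "n \<ge> 1"
  shows "homology_group 1 (top_of_set X)
     \<cong> Zsum_group (n * (n - 1) div 2) n (nat (((int n - 2) * (int n - 3)) div 2))"
proof -
  let ?Z = "Zsum_group (n * (n - 1) div 2) n (nat (((int n - 2) * (int n - 3)) div 2))"
  let ?G = "homology_group (int 1) (top_of_set X)"
  obtain \<phi> where \<phi>: "\<phi> \<in> hom pair_group ?Z" "\<phi> ` UNIV = carrier ?Z"
    "\<And>x y. \<phi> (x,y) = \<one>\<^bsub>?Z\<^esub> \<longleftrightarrow> relator n x \<and> (\<forall>e\<in>upairs1 n. y e = 0)"
    by (rule Zsum_presentation [OF n]) blast
  define c where "c p = mu_sum (fst p) + tri_sum (snd p)" for p
  define \<Phi> where "\<Phi> p = homologous_rel_set 1 (top_of_set X) {} (c p)" for p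
  have cyc: "cycle_in 1 X (c p)" for p
    unfolding c_def using cycle_in_mono [OF mu_sum_cycle AA_sub] tri_sum_cycle by (rule singular_relcycle_add)
  have cadd: "c (p \<otimes>\<^bsub>pair_group\<^esub> q) = c p + c q" for p q
    by (simp add: c_def mu_sum_def tri_sum_def pair_group_def frag_cmul_distrib sum.distrib case_prod_unfold)
  have "\<Phi> \<in> hom pair_group ?G"
  proof (rule homI)
    show "\<Phi> p \<in> carrier ?G" for p
      unfolding carrier_relative_homology_group \<Phi>_def using cyc by blast
    show "\<Phi> (p \<otimes>\<^bsub>pair_group\<^esub> q) = \<Phi> p \<otimes>\<^bsub>?G\<^esub> \<Phi> q" for p q
      unfolding \<Phi>_def homologous_set_add [OF cyc cyc] cadd ..
  qed
  moreover have "\<Phi> ` UNIV = carrier ?G"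
  proof (intro equalityI subsetI)
    fix z assume "z \<in> carrier ?G"
    then obtain d where d: "z = homologous_rel_set 1 (top_of_set X) {} d" "cycle_in 1 X d"
      unfolding carrier_relative_homology_group by blast
    obtain x y where "d \<sim> mu_sum x + tri_sum y"
      using generated [OF d(2)] by blast
    then have "z = \<Phi> (x,y)"
      unfolding d(1) \<Phi>_def c_def by (simp add: homologous_rel_set_eq)
    then show "z \<in> \<Phi> ` UNIV" by blast
  next
    fix z assume "z \<in> \<Phi> ` UNIV"
    then show "z \<in> carrier ?G"
      unfolding carrier_relative_homology_group \<Phi>_def using cyc by blast
  qed
  moreover have "\<Phi> (x,y) = \<one>\<^bsub>?G\<^esub> \<longleftrightarrow> relator n x \<and> (\<forall>e\<in>upairs1 n. y e = 0)" for x y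
    unfolding \<Phi>_def one_relative_homology_group homologous_rel_set_eq_relboundary c_def
    using bounds_iff by simp
  then have "\<Phi> p = \<one>\<^bsub>?G\<^esub> \<longleftrightarrow> \<phi> p = \<one>\<^bsub>?Z\<^esub>" for p
    using \<phi>(3) by (cases p) simp
  then have "kernel pair_group ?G \<Phi> = kernel pair_group ?Z \<phi>"
    unfolding kernel_def by blast
  ultimately have "?G \<cong> ?Z"
    using \<phi> by (intro iso_of_equal_kernels [of pair_group _ _ \<Phi> \<phi>] group_pair_group group_Zsum)
       (auto simp: pair_group_def)
  then show ?thesis by simp
qed

end

section \<open>Cores and necks of the cone\<close>

text \<open>Banach's fixed point theorem with parameters. The common contraction factor 1/2 makes
  the fixed point depend continuously on \<open>z\<close>; \<open>le\<close> asks for half the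
  radius, so that a fixed point stays admissible when \<open>z\<close>, and with it the radius,
  moves slightly.\<close>

lemma contraction_section:
  fixes T :: "'a::metric_space \<Rightarrow> complex \<Rightarrow> complex" and \<rho> :: "'a \<Rightarrow> real"
  assumes pos: "\<And>z. z \<in> Z \<Longrightarrow> 0 < \<rho> z" and \<rho>: "continuous_on Z \<rho>"
    and le: "\<And>z s. z \<in> Z \<Longrightarrow> norm s \<le> \<rho> z \<Longrightarrow> norm (T z s) \<le> \<rho> z / 2"
    and lip: "\<And>z s t. z \<in> Z \<Longrightarrow> norm s \<le> \<rho> z \<Longrightarrow> norm t \<le> \<rho> z \<Longrightarrow> norm (T z s - T z t) \<le> norm (s - t) / 2"
    and cont: "\<And>z s. z \<in> Z \<Longrightarrow> norm s < \<rho> z \<Longrightarrow> continuous (at z within Z) (\<lambda>w. T w s)"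
  obtains \<sigma> where "continuous_on Z \<sigma>" "\<And>z. z \<in> Z \<Longrightarrow> norm (\<sigma> z) \<le> \<rho> z" "\<And>z. z \<in> Z \<Longrightarrow> \<sigma> z = T z (\<sigma> z)"
    "\<And>z s. z \<in> Z \<Longrightarrow> norm s \<le> \<rho> z \<Longrightarrow> s = T z s \<Longrightarrow> s = \<sigma> z"
proof -
  have "\<exists>s. norm s \<le> \<rho> z \<and> s = T z s" if z: "z \<in> Z" for z
  proof -
    have "\<exists>!s\<in>cball 0 (\<rho> z). T z s = s"
    proof (rule Banach_fix [where c = "1/2"])
      show "T z ` cball 0 (\<rho> z) \<subseteq> cball 0 (\<rho> z)"
        using le [OF z] pos [OF z] by fastforce
      show "dist (T z x) (T z y) \<le> 1/2 * dist x y" if "x \<in> cball 0 (\<rho> z)" "y \<in> cball 0 (\<rho> z)" for x y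
        using lip [OF z, of x y] that by (simp add: dist_norm)
    qed (use pos [OF z] in \<open>auto simp: complete_eq_closed\<close>)
    then obtain s where "s \<in> cball 0 (\<rho> z)" "T z s = s" by blast
    then show ?thesis by (intro exI [of _ s]) auto
  qed
  then obtain \<sigma> where \<sigma>: "\<And>z. z \<in> Z \<Longrightarrow> norm (\<sigma> z) \<le> \<rho> z" "\<And>z. z \<in> Z \<Longrightarrow> \<sigma> z = T z (\<sigma> z)"
    by metis
  have uniq: "s = \<sigma> z" if "z \<in> Z" "norm s \<le> \<rho> z" "s = T z s" for z s
  proof -
    have "norm (s - \<sigma> z) \<le> norm (s - \<sigma> z) / 2"
      using lip [OF that(1,2) \<sigma>(1) [OF that(1)]] that(3) \<sigma>(2) [OF that(1)] by simp
    then show ?thesis by simp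
  qed
  have "continuous_on Z \<sigma>"
    unfolding continuous_on_def
  proof (intro ballI tendstoI)
    fix z and e :: real assume z: "z \<in> Z" and e: "e > 0"
    define s where "s = \<sigma> z"
    have s: "norm s \<le> \<rho> z / 2" "s = T z s"
      using \<sigma> [OF z] le [OF z, of s] by (auto simp: s_def)
    have "(\<rho> \<longlongrightarrow> \<rho> z) (at z within Z)"
      using \<rho> z by (auto simp: continuous_on_def)
    then have "\<forall>\<^sub>F w in at z within Z. \<rho> z / 2 < \<rho> w"
      by (rule order_tendstoD) (use pos [OF z] in auto)
    moreover have "((\<lambda>w. T w s) \<longlongrightarrow> T z s) (at z within Z)"
      using cont [OF z, of s] s pos [OF z] by (auto simp: continuous_within)
    then have "\<forall>\<^sub>F w in at z within Z. dist (T w s) (T z s) < e / 2"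
      using e by (intro tendstoD) auto
    moreover have "\<forall>\<^sub>F w in at z within Z. w \<in> Z"
      by (simp add: eventually_at_filter)
    ultimately show "\<forall>\<^sub>F w in at z within Z. dist (\<sigma> w) (\<sigma> z) < e"
    proof eventually_elim
      case (elim w)
      have "norm (\<sigma> w - s) = norm ((T w (\<sigma> w) - T w s) + (T w s - T z s))"
        using \<sigma>(2) [OF elim(3)] s(2) by simp
      also have "\<dots> \<le> norm (T w (\<sigma> w) - T w s) + norm (T w s - T z s)"
        by (rule norm_triangle_ineq)
      also have "norm (T w (\<sigma> w) - T w s) \<le> norm (\<sigma> w - s) / 2"
        using s(1) elim \<sigma>(1) by (intro lip) auto
      finally show ?case
        using elim(2) by (simp add: dist_norm s_def)
    qed
  qed
  with that \<sigma> uniq show ?thesis by blast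
qed

section \<open>Linear forms and coordinate frames\<close>

lemma lform_add: "lform a (x + y) = lform a x + lform a y"
  and lform_diff: "lform a (x - y) = lform a x - lform a y"
  and lform_scale: "lform a (c *s x) = c * lform a x"
  and lform_scaleR: "lform a (t *\<^sub>R x) = of_real t * lform a x"
  and lform_0 [simp]: "lform a 0 = 0"
  by (simp_all add: lform_def sum_3 algebra_simps scaleR_conv_of_real[of _ "_ :: complex"])

lemma continuous_lform: "continuous_on S (lform a)"
  unfolding lform_def by (intro continuous_intros)

lemma norm_vscale: "norm (c *s (x :: complex^3)) = norm c * norm x"
  by (simp add: norm_vec_def norm_mult L2_set_right_distrib)

text \<open>\<open>u\<close>, \<open>v\<close>, \<open>w\<close> are coordinates with dual basis
  \<open>e1\<close>, \<open>e2\<close>, \<open>e3\<close>, and \<open>C\<close> bounds the change of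
  coordinates in both directions. The explicit constant lets one \<open>C\<close> serve all frames
  of the arrangement.\<close>

definition frame :: "real \<Rightarrow> complex^3 \<Rightarrow> complex^3 \<Rightarrow> complex^3 \<Rightarrow> complex^3 \<Rightarrow> complex^3 \<Rightarrow> complex^3 \<Rightarrow> bool"
  where "frame C u v w e1 e2 e3 \<longleftrightarrow>
    lform u e1 = 1 \<and> lform v e1 = 0 \<and> lform w e1 = 0 \<and> lform u e2 = 0 \<and> lform v e2 = 1 \<and> lform w e2 = 0 \<and>
    lform u e3 = 0 \<and> lform v e3 = 0 \<and> lform w e3 = 1 \<and>
    (\<forall>y. norm (lform u y) \<le> C * norm y) \<and> (\<forall>y. norm (lform v y) \<le> C * norm y) \<and> (\<forall>y. norm (lform w y) \<le> C * norm y) \<and>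
    (\<forall>y. norm y \<le> C * (norm (lform u y) + norm (lform v y) + norm (lform w y)))"

definition frame_pt :: "complex^3 \<Rightarrow> complex^3 \<Rightarrow> complex^3 \<Rightarrow> complex \<Rightarrow> complex \<Rightarrow> complex \<Rightarrow> complex^3"
  where "frame_pt e1 e2 e3 s p q = s *s e1 + p *s e2 + q *s e3"

lemma frame_pt_coords:
  assumes "frame C u v w e1 e2 e3"
  shows "lform u (frame_pt e1 e2 e3 s p q) = s" "lform v (frame_pt e1 e2 e3 s p q) = p" "lform w (frame_pt e1 e2 e3 s p q) = q"
    "frame_pt e1 e2 e3 (lform u y) (lform v y) (lform w y) = y"
proof -
  show 1: "lform u (frame_pt e1 e2 e3 s p q) = s" "lform v (frame_pt e1 e2 e3 s p q) = p" "lform w (frame_pt e1 e2 e3 s p q) = q" for s p q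
    using assms by (simp_all add: frame_def frame_pt_def lform_add lform_scale)
  let ?d = "frame_pt e1 e2 e3 (lform u y) (lform v y) (lform w y) - y"
  have "norm ?d \<le> C * (norm (lform u ?d) + norm (lform v ?d) + norm (lform w ?d))"
    using assms unfolding frame_def by blast
  then have "norm ?d \<le> 0" by (simp add: lform_diff 1)
  then show "frame_pt e1 e2 e3 (lform u y) (lform v y) (lform w y) = y" by simp
qed

lemma frame_norm:
  assumes "frame C u v w e1 e2 e3"
  shows "norm y \<le> C * (norm (lform u y) + norm (lform v y) + norm (lform w y))" "norm e1 \<le> C" "norm e2 \<le> C" "norm e3 \<le> C"
proof -
  show *: "norm y \<le> C * (norm (lform u y) + norm (lform v y) + norm (lform w y))" for y
    using assms unfolding frame_def by blast
  show "norm e1 \<le> C" "norm e2 \<le> C" "norm e3 \<le> C"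
    using * [of e1] * [of e2] * [of e3] assms by (simp_all add: frame_def)
qed

lemma frame_pt_diff: "frame_pt e1 e2 e3 s p q - frame_pt e1 e2 e3 t p q = (s - t) *s e1"
  by (simp add: frame_pt_def vector_sub_rdistrib)

lemma continuous_frame_pt:
  assumes "continuous_on S f" "continuous_on S g" "continuous_on S h"
  shows "continuous_on S (\<lambda>x. frame_pt e1 e2 e3 (f x) (g x) (h x))"
  unfolding frame_pt_def vector_scalar_mult_def using assms by (intro continuous_intros) auto

lemma chain_map_point_chain: "chain_map 0 f (point_chain x) = point_chain (f x)"
proof -
  have "simplex_map 0 f (restrict (\<lambda>y. x) (standard_simplex 0)) = restrict (\<lambda>y. f x) (standard_simplex 0)"
    by (auto simp: simplex_map_def fun_eq_iff restrict_def)
  then show ?thesis by (simp add: point_chain_def)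
qed

text \<open>\<open>est3\<close> is genericity in quantitative form: three distinct forms are
  coordinates. \<open>g i j\<close> completes two of them to a frame, and \<open>frame1\<close>
  supplies coordinates on a single hyperplane.\<close>

locale lines =
  fixes n :: nat and a :: "nat \<Rightarrow> complex^3" and g :: "nat \<Rightarrow> nat \<Rightarrow> complex^3" and C :: real
  assumes C1: "C \<ge> 1"
    and g_sym: "\<And>i j. g i j = g j i"
    and frame2: "\<And>i j. (i,j) \<in> opairs n \<Longrightarrow> \<exists>e1 e2 e3. frame C (a i) (a j) (g i j) e1 e2 e3"
    and frame1: "\<And>i. i < n \<Longrightarrow> \<exists>h1 h2 e1 e2 e3. frame C (a i) h1 h2 e1 e2 e3"
    and est3: "\<And>i j k y. i < n \<Longrightarrow> j < n \<Longrightarrow> k < n \<Longrightarrow> i \<noteq> j \<Longrightarrow> i \<noteq> k \<Longrightarrow> j \<noteq> k \<Longrightarrow>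
        norm y \<le> C * (norm (lform (a i) y) + norm (lform (a j) y) + norm (lform (a k) y))"
begin

abbreviation \<alpha> where "\<alpha> i \<equiv> lform (a i)"
abbreviation \<gamma> where "\<gamma> i j \<equiv> lform (g i j)"

lemma norm_alpha_le: "i < n \<Longrightarrow> norm (\<alpha> i y) \<le> C * norm y"
  using frame1 unfolding frame_def by blast

lemma norm_gamma_le: "(i,j) \<in> opairs n \<Longrightarrow> norm (\<gamma> i j y) \<le> C * norm y"
  using frame2 unfolding frame_def by blast

lemma est2: "(i,j) \<in> opairs n \<Longrightarrow> norm y \<le> C * (norm (\<alpha> i y) + norm (\<alpha> j y) + norm (\<gamma> i j y))"
  using frame2 unfolding frame_def by blast

text \<open>The equation of the cone solved for the forms outside \<open>J\<close>: their product
  equals \<open>\<delta> * G J y\<close> wherever the forms in \<open>J\<close> do not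
  vanish.\<close>

definition G :: "nat set \<Rightarrow> complex^3 \<Rightarrow> complex"
  where "G J y = of_real (norm y ^ n) / (\<Prod>k\<in>J. \<alpha> k y)"

text \<open>One bound for all \<open>J\<close> on a ball where the forms in \<open>J\<close> stay
  away from 0. Points of a neck or a core reach such a region by positive scaling, under which
  \<open>G J\<close> is homogeneous of degree n - card J.\<close>

definition lip_bound :: "real \<Rightarrow> real \<Rightarrow> real \<Rightarrow> bool"
  where "lip_bound b \<kappa> L \<longleftrightarrow> (\<forall>J y y'. J \<subseteq> {..<n} \<longrightarrow> norm y \<le> b \<longrightarrow> norm y' \<le> b \<longrightarrow>
     (\<forall>k\<in>J. \<kappa> \<le> norm (\<alpha> k y) \<and> \<kappa> \<le> norm (\<alpha> k y')) \<longrightarrow> norm (G J y) \<le> L \<and> norm (G J y - G J y') \<le> L * norm (y - y'))"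

lemma G_scale:
  assumes "t > 0" "J \<subseteq> {..<n}"
  shows "G J (t *\<^sub>R y) = of_real (t ^ (n - card J)) * G J y"
proof -
  have "card J \<le> n"
    using card_mono [OF _ assms(2)] by simp
  then have "t ^ n = t ^ (n - card J) * t ^ card J"
    by (simp flip: power_add)
  moreover have "(\<Prod>k\<in>J. \<alpha> k (t *\<^sub>R y)) = of_real (t ^ card J) * (\<Prod>k\<in>J. \<alpha> k y)"
    by (simp add: lform_scaleR prod.distrib)
  ultimately show ?thesis
    using assms by (simp add: G_def power_mult_distrib field_simps)
qed

definition X :: "real \<Rightarrow> (complex^3) set"
  where "X \<delta> = {y. y \<noteq> 0 \<and> (\<Prod>i<n. \<alpha> i y) = of_real (\<delta> * norm y ^ n)}"

text \<open>Bounded Lipschitz functions on \<open>S J\<close> are closed under products, and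
  \<open>G J\<close> is a product of norms and of inverses of forms. The finitely many constants are
  dominated by their sum.\<close>

lemma lip_bound_exists:
  assumes "b > 0" "\<kappa> > 0"
  obtains L where "L \<ge> 1" "lip_bound b \<kappa> L"
proof -
  define S where "S J = {y. norm y \<le> b \<and> (\<forall>k\<in>J. \<kappa> \<le> norm (\<alpha> k y))}" for J
  define LB where "LB J F \<longleftrightarrow> (\<exists>L\<ge>0. \<forall>y\<in>S J. \<forall>y'\<in>S J. norm (F y) \<le> L \<and> norm (F y - F y') \<le> L * norm (y - y'))"
    for J and F :: "complex^3 \<Rightarrow> complex"
  have LB_mult: "LB J (\<lambda>y. F y * F' y)" if "LB J F" "LB J F'" for J F F'
  proof -
    from that(1) [unfolded LB_def] obtain L where L0: "L \<ge> 0 \<and> (\<forall>y\<in>S J. \<forall>y'\<in>S J. norm (F y) \<le> L \<and> norm (F y - F y') \<le> L * norm (y - y'))" ..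
    have L: "L \<ge> 0" "\<And>y y'. y \<in> S J \<Longrightarrow> y' \<in> S J \<Longrightarrow> norm (F y) \<le> L \<and> norm (F y - F y') \<le> L * norm (y - y')"
      using L0 by (rule conjunct1, simp add: L0)
    from that(2) [unfolded LB_def] obtain L' where L'0: "L' \<ge> 0 \<and> (\<forall>y\<in>S J. \<forall>y'\<in>S J. norm (F' y) \<le> L' \<and> norm (F' y - F' y') \<le> L' * norm (y - y'))" ..
    have L': "L' \<ge> 0" "\<And>y y'. y \<in> S J \<Longrightarrow> y' \<in> S J \<Longrightarrow> norm (F' y) \<le> L' \<and> norm (F' y - F' y') \<le> L' * norm (y - y')"
      using L'0 by (rule conjunct1, simp add: L'0)
    have "norm (F y * F' y) \<le> 2 * (L * L') \<and> norm (F y * F' y - F y' * F' y') \<le> 2 * (L * L') * norm (y - y')"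
      if y: "y \<in> S J" "y' \<in> S J" for y y'
    proof
      have "norm (F y * F' y) \<le> L * L'"
        unfolding norm_mult using L L' y by (intro mult_mono) auto
      moreover have "L * L' \<ge> 0" using L L' by simp
      ultimately show "norm (F y * F' y) \<le> 2 * (L * L')" by linarith
      have "norm (F y * F' y - F y' * F' y') = norm (F y * (F' y - F' y') + (F y - F y') * F' y')"
        by (simp add: algebra_simps)
      also have "\<dots> \<le> norm (F y) * norm (F' y - F' y') + norm (F y - F y') * norm (F' y')"
        by (metis norm_triangle_ineq norm_mult)
      also have "\<dots> \<le> L * (L' * norm (y - y')) + L * norm (y - y') * L'"
        using L L' y by (intro add_mono mult_mono) auto
      finally show "norm (F y * F' y - F y' * F' y') \<le> 2 * (L * L') * norm (y - y')"
        by (simp add: algebra_simps)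
    qed
    then show ?thesis
      unfolding LB_def using L L' by (intro exI [of _ "2 * (L * L')"]) auto
  qed
  have LB1: "LB J (\<lambda>y. of_real (norm y))" for J
  proof -
    have "norm (complex_of_real (norm y)) \<le> b + 1 \<and>
       norm (complex_of_real (norm y) - complex_of_real (norm y')) \<le> (b + 1) * norm (y - y')" if "y \<in> S J" for y y'
    proof
      show "norm (complex_of_real (norm y)) \<le> b + 1" using that by (simp add: S_def)
      have "norm (complex_of_real (norm y) - complex_of_real (norm y')) = \<bar>norm y - norm y'\<bar>"
        by (metis norm_of_real of_real_diff)
      also have "\<dots> \<le> 1 * norm (y - y')" using norm_triangle_ineq3 [of y y'] by simp
      also have "\<dots> \<le> (b + 1) * norm (y - y')" using assms by (intro mult_right_mono) auto
      finally show "norm (complex_of_real (norm y) - complex_of_real (norm y')) \<le> (b + 1) * norm (y - y')" .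
    qed
    then show ?thesis unfolding LB_def using assms by (intro exI [of _ "b + 1"]) auto
  qed
  have LBpow: "LB J (\<lambda>y. of_real (norm y ^ m))" for J m
  proof (induction m)
    case 0
    show ?case unfolding LB_def by (intro exI [of _ 1]) auto
  next
    case (Suc m)
    then show ?case using LB_mult [OF LB1 Suc] by simp
  qed
  have LBinv: "LB J (\<lambda>y. inverse (\<alpha> k y))" if "k \<in> J" "J \<subseteq> {..<n}" for J k
  proof -
    have "norm (inverse (\<alpha> k y)) \<le> 1 / \<kappa> + C / \<kappa>^2 \<and> norm (inverse (\<alpha> k y) - inverse (\<alpha> k y')) \<le> (1 / \<kappa> + C / \<kappa>^2) * norm (y - y')"
      if y: "y \<in> S J" "y' \<in> S J" for y y'
    proof
      have k: "\<kappa> \<le> norm (\<alpha> k y)" "\<kappa> \<le> norm (\<alpha> k y')" using y \<open>k \<in> J\<close> by (auto simp: S_def)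
      have "norm (inverse (\<alpha> k y)) \<le> inverse \<kappa>"
        unfolding norm_inverse using k assms by (intro le_imp_inverse_le) auto
      moreover have "0 \<le> C / \<kappa>^2" using C1 by simp
      ultimately show "norm (inverse (\<alpha> k y)) \<le> 1 / \<kappa> + C / \<kappa>^2" by (simp add: inverse_eq_divide)
      have nz: "\<alpha> k y \<noteq> 0" "\<alpha> k y' \<noteq> 0" using k assms by auto
      have "norm (inverse (\<alpha> k y) - inverse (\<alpha> k y')) = norm (\<alpha> k (y' - y)) / (norm (\<alpha> k y) * norm (\<alpha> k y'))"
        using nz by (simp add: inverse_diff_inverse lform_diff norm_mult norm_inverse norm_minus_commute divide_inverse)
      also have "\<dots> \<le> (C * norm (y' - y)) / (\<kappa> * \<kappa>)"
        using k assms C1 norm_alpha_le [of k] that(1) \<open>k \<in> J\<close> \<open>J \<subseteq> {..<n}\<close>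
        by (intro frac_le mult_mono mult_pos_pos) auto
      also have "\<dots> \<le> (1 / \<kappa> + C / \<kappa>^2) * norm (y - y')"
        using assms C1 by (simp add: power2_eq_square norm_minus_commute field_simps)
      finally show "norm (inverse (\<alpha> k y) - inverse (\<alpha> k y')) \<le> (1 / \<kappa> + C / \<kappa>^2) * norm (y - y')" .
    qed
    moreover have "0 \<le> 1 / \<kappa> + C / \<kappa>^2" using assms C1 by simp
    ultimately show ?thesis unfolding LB_def by blast
  qed
  have LBG: "LB J (G J)" if J: "J \<subseteq> {..<n}" for J
  proof -
    have "LB J (\<lambda>y. of_real (norm y ^ n) * (\<Prod>k\<in>I. inverse (\<alpha> k y)))" if "finite I" "I \<subseteq> J" for I
      using that
    proof (induction I rule: finite_induct)
      case empty
      then show ?case using LBpow by simp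
    next
      case (insert k I)
      then show ?case
        using LB_mult [OF LBinv [of k J] insert.IH] J by (simp add: algebra_simps)
    qed
    moreover have "finite J" using J finite_subset by blast
    ultimately have "LB J (\<lambda>y. of_real (norm y ^ n) * (\<Prod>k\<in>J. inverse (\<alpha> k y)))" by blast
    moreover have "(\<lambda>y. of_real (norm y ^ n) * (\<Prod>k\<in>J. inverse (\<alpha> k y))) = G J"
      by (simp add: fun_eq_iff G_def divide_inverse prod_inversef [unfolded o_def])
    ultimately show ?thesis by simp
  qed
  then obtain L where L: "\<And>J. J \<subseteq> {..<n} \<Longrightarrow> L J \<ge> (0::real)"
    "\<And>J y y'. J \<subseteq> {..<n} \<Longrightarrow> y \<in> S J \<Longrightarrow> y' \<in> S J \<Longrightarrow> norm (G J y) \<le> L J \<and> norm (G J y - G J y') \<le> L J * norm (y - y')"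
    unfolding LB_def by metis
  define M where "M = 1 + (\<Sum>J\<in>Pow {..<n}. L J)"
  have LM: "L J \<le> M" if "J \<subseteq> {..<n}" for J
    unfolding M_def using that L(1) member_le_sum [of J "Pow {..<n}" L] by auto
  show ?thesis
  proof
    show "M \<ge> 1" unfolding M_def using L(1) sum_nonneg [of "Pow {..<n}" L] by auto
    show "lip_bound b \<kappa> M"
      unfolding lip_bound_def
    proof (intro allI impI)
      fix J y y' assume H: "J \<subseteq> {..<n}" "norm y \<le> b" "norm y' \<le> b" "\<forall>k\<in>J. \<kappa> \<le> norm (\<alpha> k y) \<and> \<kappa> \<le> norm (\<alpha> k y')"
      then have "y \<in> S J" "y' \<in> S J" by (auto simp: S_def)
      from L(2) [OF H(1) this] LM [OF H(1)]
      show "norm (G J y) \<le> M \<and> norm (G J y - G J y') \<le> M * norm (y - y')"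
        by (meson mult_right_mono norm_ge_zero order_trans)
    qed
  qed
qed

end

section \<open>The equation of the cone near one and near two hyperplanes\<close>

lemma (in lines) isCont_G:
  assumes "continuous_on UNIV F" "finite J" "\<And>k. k \<in> J \<Longrightarrow> \<alpha> k (F x) \<noteq> 0"
  shows "isCont (\<lambda>w. G J (F w)) x"
proof -
  have F: "isCont F x"
    using assms(1) by (simp add: continuous_on_eq_continuous_at)
  have "isCont (\<alpha> k) (F x)" for k
    using continuous_lform [of UNIV "a k"] by (simp add: continuous_on_eq_continuous_at)
  then have a: "isCont (\<lambda>w. \<alpha> k (F w)) x" for k
    by (rule isCont_o2 [OF F])
  have "isCont (\<lambda>w. \<Prod>k\<in>J. \<alpha> k (F w)) x"
    by (intro continuous_prod a)
  moreover have "(\<Prod>k\<in>J. \<alpha> k (F x)) \<noteq> 0"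
    using assms by simp
  moreover have "isCont (\<lambda>w. complex_of_real (norm (F w) ^ n)) x"
    using F by (intro continuous_intros)
  ultimately show ?thesis
    unfolding G_def by (intro isCont_divide)
qed

lemma (in lines) X_iff_1:
  assumes "i < n" "y \<noteq> 0" "\<And>k. k \<in> {..<n} - {i} \<Longrightarrow> \<alpha> k y \<noteq> 0"
  shows "y \<in> X \<delta> \<longleftrightarrow> \<alpha> i y = of_real \<delta> * G ({..<n} - {i}) y"
proof -
  have "(\<Prod>k\<in>{..<n}-{i}. \<alpha> k y) \<noteq> 0" using assms by simp
  moreover have "(\<Prod>k<n. \<alpha> k y) = \<alpha> i y * (\<Prod>k\<in>{..<n}-{i}. \<alpha> k y)"
    using assms by (simp add: prod.remove)
  ultimately show ?thesis
    using assms(2) by (simp add: X_def G_def field_simps)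
qed

lemma (in lines) X_iff_2:
  assumes "(i,j) \<in> opairs n" "y \<noteq> 0" "\<And>k. k \<in> {..<n} - {i} - {j} \<Longrightarrow> \<alpha> k y \<noteq> 0"
  shows "y \<in> X \<delta> \<longleftrightarrow> \<alpha> i y * \<alpha> j y = of_real \<delta> * G ({..<n} - {i} - {j}) y"
proof -
  have "(\<Prod>k\<in>{..<n}-{i}-{j}. \<alpha> k y) \<noteq> 0" using assms by simp
  moreover have "(\<Prod>k<n. \<alpha> k y) = \<alpha> i y * (\<alpha> j y * (\<Prod>k\<in>{..<n}-{i}-{j}. \<alpha> k y))"
    using assms by (simp add: prod.remove [of _ i] prod.remove [of "{..<n} - {i}" j] opairs_def)
  ultimately show ?thesis
    using assms(2) by (simp add: X_def G_def field_simps)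
qed

text \<open>The constants are chosen in the order \<open>e2, e1, e0, \<eta>\<close>, each small compared with its predecessor and with
  the Lipschitz constants of \<open>G\<close>; \<open>\<delta>\<close> comes last.\<close>

locale lines_params = lines +
  fixes L LA \<delta> e0 e1 e2 K K' \<eta> \<eta>' :: real
  assumes n1: "n \<ge> 1" and L1: "L \<ge> 1" and lipL: "lip_bound (2 * C) (1 / (2 * C^2)) L"
    and lipLA: "lip_bound (2 * C) (e0 / (16 * C^2)) LA"
    and e2_eq: "e2 = 1 / (4 * C^4)" and K_eq: "K = 2 * L * C / e2" and e1_eq: "e1 = 1 / (C^n * K)"
    and K'_eq: "K' = L / e1" and e0_eq: "e0 = e1 / (16 * L * C^n)"
    and \<eta>'_eq: "\<eta>' = e0 / (16 * C^4)" and \<eta>_eq: "\<eta> = e0 / (32 * C^5)"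
    and \<delta>0: "\<delta> > 0" and d1: "\<delta> < \<eta>^n" and d2: "2 * C * \<delta> * LA < \<eta>" and d3: "2 * K' * \<delta> * C < \<eta>"
    and d4: "\<delta> * L * C < \<eta> * e0"
begin

lemma Cpow: "C^m \<ge> 1" "C > 0" "C^m > 0"
  using C1 by (auto simp: one_le_power)

lemma pos: "e2 > 0" "K > 0" "e1 > 0" "K' > 0" "e0 > 0" "\<eta> > 0" "\<eta>' > 0"
proof -
  show *: "e2 > 0" using Cpow(2) by (simp add: e2_eq)
  show **: "K > 0" using * L1 Cpow(2) by (simp add: K_eq)
  show ***: "e1 > 0" using ** Cpow(2) by (simp add: e1_eq)
  show "K' > 0" using *** L1 by (simp add: K'_eq)
  show "e0 > 0" using *** L1 Cpow(2) by (simp add: e0_eq)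
  then show "\<eta> > 0" "\<eta>' > 0" using Cpow(2) by (simp_all add: \<eta>_eq \<eta>'_eq)
qed

lemma K_val: "K = 8 * L * C^5"
  using Cpow(2) by (simp add: K_eq e2_eq power_numeral_reduce)

text \<open>These products determine the constants: \<open>e1K\<close> brings the coordinates of a
  neck into the shell above \<open>K * \<delta>\<close>, \<open>K'e1\<close> brings the shell above
  \<open>K' * \<delta>\<close> back into the neck, \<open>e0_16\<close> lets a point deep in the
  neck reach the far core, and \<open>\<eta>C\<close> makes \<eta> small against the width of the
  tubes.\<close>

lemma e1K: "e1 * C^n * K = 1" and K'e1: "K' * e1 = L" and e0_16: "16 * L * C^n * e0 = e1" and \<eta>C: "32 * C^5 * \<eta> = e0"
  and \<eta>'C: "\<eta>' = 2 * C * \<eta>"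
  using pos Cpow L1 by (simp_all add: e1_eq K'_eq e0_eq \<eta>_eq \<eta>'_eq power_numeral_reduce)

lemma C_pow_le: "l \<le> m \<Longrightarrow> C^l \<le> C^m"
  by (rule power_increasing [OF _ C1])

lemma e1_small: "l \<le> 5 \<Longrightarrow> 8 * C^l * e1 \<le> 1"
proof -
  assume "l \<le> 5"
  have "8 * C^l * e1 \<le> 8 * C^5 * e1"
    using C_pow_le [OF \<open>l \<le> 5\<close>] pos(3) by (intro mult_right_mono) auto
  also have "\<dots> \<le> (L * C^n) * (8 * C^5 * e1)"
  proof -
    have "1 * 1 \<le> L * C^n" using L1 Cpow by (intro mult_mono) auto
    moreover have "0 \<le> 8 * C^5 * e1" using Cpow pos by simp
    ultimately show ?thesis using mult_right_mono [of 1 "L * C^n" "8 * C^5 * e1"] by simp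
  qed
  also have "\<dots> = e1 * C^n * K" by (simp add: K_val)
  finally show ?thesis by (simp add: e1K)
qed

lemma e0_small: "16 * e0 \<le> e1"
proof -
  have "1 * 1 \<le> L * C^n" using L1 Cpow by (intro mult_mono) auto
  then have "(16 * e0) * 1 \<le> (16 * e0) * (L * C^n)" using pos by (intro mult_left_mono) auto
  also have "\<dots> = e1" using e0_16 by (simp add: algebra_simps)
  finally show ?thesis by simp
qed

lemma \<eta>_small: "l \<le> 5 \<Longrightarrow> 32 * C^l * \<eta> \<le> e0"
proof -
  assume "l \<le> 5"
  have "32 * C^l * \<eta> \<le> 32 * C^5 * \<eta>"
    using C_pow_le [OF \<open>l \<le> 5\<close>] pos by (intro mult_right_mono) auto
  then show ?thesis by (simp add: \<eta>C)
qed

lemma smalls: "8 * e1 \<le> 1" "8 * C * e1 \<le> 1" "8 * C^2 * e1 \<le> 1" "8 * C^4 * e1 \<le> 1" "128 * e0 \<le> 1" "32 * \<eta> \<le> e0" "32 * C * \<eta> \<le> e0"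
  "32 * C^2 * \<eta> \<le> e0" "32 * C^3 * \<eta> \<le> e0" "e1 \<le> e2 / 2" "2 * e2 \<le> 1" "4 * C^2 * e2 \<le> 1" "\<eta>' \<le> 1" "64 * C * \<eta> \<le> 1"
proof -
  show 1: "8 * e1 \<le> 1" using e1_small [of 0] by simp
  show "8 * C * e1 \<le> 1" "8 * C^2 * e1 \<le> 1" using e1_small [of 1] e1_small [of 2] by simp_all
  show 4: "8 * C^4 * e1 \<le> 1" using e1_small [of 4] by simp
  show 5: "128 * e0 \<le> 1" using 1 e0_small by linarith
  show "32 * \<eta> \<le> e0" "32 * C^2 * \<eta> \<le> e0" "32 * C^3 * \<eta> \<le> e0"
    using \<eta>_small [of 0] \<eta>_small [of 2] \<eta>_small [of 3] by simp_all
  show 7: "32 * C * \<eta> \<le> e0" using \<eta>_small [of 1] by simp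
  show "e1 \<le> e2 / 2" using 4 Cpow by (simp add: e2_eq field_simps)
  show "2 * e2 \<le> 1" using Cpow(1) [of 4] Cpow(3) [of 4] by (simp add: e2_eq field_simps)
  have "C^2 \<le> C^4" by (rule C_pow_le) simp
  then show "4 * C^2 * e2 \<le> 1" using Cpow by (simp add: e2_eq field_simps)
  show "\<eta>' \<le> 1" "64 * C * \<eta> \<le> 1" using 7 5 by (auto simp: \<eta>'C)
qed

section \<open>Cores and necks: cover and disjointness\<close>

lemma X_nz: "y \<in> X \<delta> \<Longrightarrow> y \<noteq> 0" "y \<in> X \<delta> \<Longrightarrow> k < n \<Longrightarrow> \<alpha> k y \<noteq> 0"
proof -
  assume y: "y \<in> X \<delta>"
  then show "y \<noteq> 0" by (simp add: X_def)
  then have "(\<Prod>i<n. \<alpha> i y) \<noteq> 0" using y \<delta>0 by (simp add: X_def)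
  then show "k < n \<Longrightarrow> \<alpha> k y \<noteq> 0" by simp
qed

text \<open>\<epsilon> is the width of the tubes that are cut off. The decomposition uses
  \<open>e0\<close>; base points are taken in the smaller set for \<open>4 * e0\<close>, which
  leaves room for the paths that join them.\<close>

definition A :: "real \<Rightarrow> nat \<Rightarrow> (complex^3) set"
  where "A \<epsilon> i = {y \<in> X \<delta>. norm (\<alpha> i y) < \<eta> * norm y \<and> (\<forall>k\<in>{..<n}-{i}. \<epsilon> * norm (\<gamma> i k y) < norm (\<alpha> k y))}"

definition B :: "nat \<Rightarrow> nat \<Rightarrow> (complex^3) set"
  where "B i j = {y \<in> X \<delta>. norm (\<alpha> i y) < e1 * norm (\<gamma> i j y) \<and> norm (\<alpha> j y) < e1 * norm (\<gamma> i j y)}"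

lemma B_sym: "B i j = B j i"
  by (auto simp: B_def g_sym [of i j])

lemma B_gamma: "y \<in> B i j \<Longrightarrow> \<gamma> i j y \<noteq> 0"
  by (auto simp: B_def)

lemma A_open: "openin (top_of_set (X \<delta>)) (A \<epsilon> i)"
proof -
  let ?U = "{y. norm (\<alpha> i y) < \<eta> * norm y} \<inter> (\<Inter>k\<in>{..<n}-{i}. {y. \<epsilon> * norm (\<gamma> i k y) < norm (\<alpha> k y)})"
  have "open ?U"
    by (intro open_Int open_INT open_Collect_less continuous_intros continuous_lform ballI) auto
  moreover have "A \<epsilon> i = X \<delta> \<inter> ?U" by (auto simp: A_def)
  ultimately show ?thesis unfolding openin_open by (intro exI conjI)
qed

lemma B_open: "openin (top_of_set (X \<delta>)) (B i j)"
proof -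
  let ?U = "{y. norm (\<alpha> i y) < e1 * norm (\<gamma> i j y)} \<inter> {y. norm (\<alpha> j y) < e1 * norm (\<gamma> i j y)}"
  have "open ?U"
    by (intro open_Int open_Collect_less continuous_intros continuous_lform)
  moreover have "B i j = X \<delta> \<inter> ?U" by (auto simp: B_def)
  ultimately show ?thesis unfolding openin_open by (intro exI conjI)
qed

text \<open>Otherwise the product of the forms would have norm at least \<eta>^n |y|^n, contrary to
  \<delta> < \<eta>^n.\<close>

lemma small_alpha:
  assumes y: "y \<in> X \<delta>"
  obtains i where "i < n" "norm (\<alpha> i y) < \<eta> * norm y"
proof (rule ccontr)
  assume "\<not> thesis"
  with that have "\<eta> * norm y \<le> norm (\<alpha> i y)" if "i < n" for i
    using \<open>i < n\<close> by (meson not_le)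
  then have "(\<Prod>i<n. \<eta> * norm y) \<le> (\<Prod>i<n. norm (\<alpha> i y))"
    using pos by (intro prod_mono) auto
  also have "\<dots> = norm (\<Prod>i<n. \<alpha> i y)" by (simp add: prod_norm)
  also have "\<dots> = \<delta> * norm y ^ n"
    using y \<delta>0 by (simp add: X_def norm_mult norm_power)
  finally have "\<eta>^n * norm y ^ n \<le> \<delta> * norm y ^ n" by (simp add: power_mult_distrib)
  moreover have "norm y ^ n > 0" using X_nz(1) [OF y] by simp
  ultimately show False using d1 by simp
qed

text \<open>A point close to hyperplane \<open>i\<close> but outside its core violates the tube
  condition for some \<open>k\<close>. Then \<open>\<alpha> i\<close> and \<open>\<alpha> k\<close>
  are both small, \<open>est2\<close> makes \<open>\<gamma> i k\<close> comparable to the norm, and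
  the point lies in a neck.\<close>

lemma cover: "X \<delta> \<subseteq> (\<Union>i<n. A e0 i) \<union> (\<Union>(i,j)\<in>upairs n. B i j)"
proof
  fix y assume y: "y \<in> X \<delta>"
  obtain i where i: "i < n" "norm (\<alpha> i y) < \<eta> * norm y"
    using small_alpha [OF y] by blast
  show "y \<in> (\<Union>i<n. A e0 i) \<union> (\<Union>(i,j)\<in>upairs n. B i j)"
  proof (cases "y \<in> A e0 i")
    case False
    then obtain k where k: "k < n" "k \<noteq> i" "norm (\<alpha> k y) \<le> e0 * norm (\<gamma> i k y)"
      using y i by (auto simp: A_def not_less)
    have o: "(i,k) \<in> opairs n" using i k by (auto simp: opairs_def)
    have g0: "norm (\<gamma> i k y) > 0" using k X_nz(2) [OF y k(1)] by auto
    have e01: "e0 * norm (\<gamma> i k y) < e1 * norm (\<gamma> i k y)"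
      using g0 e0_small pos by (intro mult_strict_right_mono) auto
    have "norm y \<le> C * norm (\<alpha> i y) + C * norm (\<alpha> k y) + C * norm (\<gamma> i k y)"
      using est2 [OF o, of y] by (simp add: algebra_simps)
    moreover have "C * norm (\<alpha> i y) \<le> (C * \<eta>) * norm y"
      using i Cpow(2) by (simp add: mult_left_mono)
    moreover have "(C * \<eta>) * norm y \<le> 1/2 * norm y"
      using smalls(14) by (intro mult_right_mono) auto
    moreover have "norm (\<alpha> k y) \<le> 1 * norm (\<gamma> i k y)"
    proof -
      have "e0 * norm (\<gamma> i k y) \<le> 1 * norm (\<gamma> i k y)"
        using smalls(5) pos by (intro mult_right_mono) auto
      then show ?thesis using k(3) by linarith
    qed
    then have "C * norm (\<alpha> k y) \<le> C * norm (\<gamma> i k y)"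
      using Cpow(2) by simp
    ultimately have "norm y \<le> 4 * (C * norm (\<gamma> i k y))" by linarith
    then have "\<eta> * norm y \<le> \<eta> * (4 * (C * norm (\<gamma> i k y)))"
      using pos by (intro mult_left_mono) auto
    also have "\<dots> = (4 * C * \<eta>) * norm (\<gamma> i k y)" by simp
    also have "\<dots> \<le> e1 * norm (\<gamma> i k y)"
      using smalls(7) e0_small pos by (intro mult_right_mono) auto
    finally have "y \<in> B i k"
      using y i k e01 by (auto simp: B_def)
    moreover have "y \<in> B k i" using calculation B_sym by blast
    ultimately show ?thesis
      using o by (cases "i < k") (force simp: upairs_def opairs_def)+
  qed (use i in auto)
qed

lemma A_disj:
  assumes o: "(i,j) \<in> opairs n"
  shows "A e0 i \<inter> A e0 j = {}"
proof (rule ccontr)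
  assume "A e0 i \<inter> A e0 j \<noteq> {}"
  then obtain y where y: "y \<in> X \<delta>" "norm (\<alpha> i y) < \<eta> * norm y" "norm (\<alpha> j y) < \<eta> * norm y"
    "e0 * norm (\<gamma> i j y) < norm (\<alpha> j y)"
    using o by (auto simp: A_def opairs_def)
  have "norm y \<le> C * norm (\<alpha> i y) + C * norm (\<alpha> j y) + C * norm (\<gamma> i j y)"
    using est2 [OF o, of y] by (simp add: algebra_simps)
  moreover have "C * norm (\<alpha> i y) \<le> (C * \<eta>) * norm y" "C * norm (\<alpha> j y) \<le> (C * \<eta>) * norm y"
    using y Cpow(2) by (simp_all add: mult_left_mono)
  moreover have "(C * \<eta>) * norm y \<le> 1/4 * norm y"
    using smalls(14) by (intro mult_right_mono) auto
  ultimately have "norm y \<le> 2 * (C * norm (\<gamma> i j y))" by linarith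
  then have "\<eta> * norm y \<le> \<eta> * (2 * (C * norm (\<gamma> i j y)))"
    using pos by (intro mult_left_mono) auto
  also have "\<dots> = (2 * C * \<eta>) * norm (\<gamma> i j y)" by simp
  also have "\<dots> \<le> e0 * norm (\<gamma> i j y)"
    using smalls(7) pos Cpow(2) by (intro mult_right_mono) auto
  finally show False using y by linarith
qed

text \<open>By genericity three forms control the norm, so they cannot all be a small fraction of it
  away from the origin. This separates the necks from each other and from foreign cores.\<close>

lemma three_small:
  assumes ijk: "i < n" "j < n" "k < n" "i \<noteq> j" "i \<noteq> k" "j \<noteq> k"
    and y: "norm (\<alpha> i y) \<le> C * e1 * norm y" "norm (\<alpha> j y) \<le> C * e1 * norm y" "norm (\<alpha> k y) \<le> C * e1 * norm y"
  shows "y = 0"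
proof (rule ccontr)
  assume "y \<noteq> 0"
  have "norm y \<le> C * norm (\<alpha> i y) + C * norm (\<alpha> j y) + C * norm (\<alpha> k y)"
    using est3 [OF ijk, of y] by (simp add: algebra_simps)
  moreover have *: "C * t \<le> 1/8 * norm y" if "t \<le> C * e1 * norm y" for t
  proof -
    have "C * t \<le> C * (C * e1 * norm y)" using that Cpow(2) by simp
    also have "\<dots> = (C^2 * e1) * norm y" by (simp add: power2_eq_square)
    also have "\<dots> \<le> 1/8 * norm y" using smalls(3) by (intro mult_right_mono) auto
    finally show ?thesis .
  qed
  ultimately have "norm y \<le> 3/8 * norm y"
    using * [OF y(1)] * [OF y(2)] * [OF y(3)] by linarith
  then show False using \<open>y \<noteq> 0\<close> by simp
qed

lemma B_small:
  assumes "(i,j) \<in> opairs n" "y \<in> B i j"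
  shows "norm (\<alpha> i y) \<le> C * e1 * norm y" "norm (\<alpha> j y) \<le> C * e1 * norm y"
proof -
  have "e1 * norm (\<gamma> i j y) \<le> e1 * (C * norm y)"
    using norm_gamma_le [OF assms(1)] pos by (intro mult_left_mono) auto
  then show "norm (\<alpha> i y) \<le> C * e1 * norm y" "norm (\<alpha> j y) \<le> C * e1 * norm y"
    using assms(2) by (auto simp: B_def algebra_simps)
qed

lemma B_disj:
  assumes ij: "(i,j) \<in> upairs n" and kl: "(k,l) \<in> upairs n" and ne: "(i,j) \<noteq> (k,l)"
  shows "B i j \<inter> B k l = {}"
proof (rule ccontr)
  assume "B i j \<inter> B k l \<noteq> {}"
  then obtain y where y: "y \<in> B i j" "y \<in> B k l" by blast
  have o: "(i,j) \<in> opairs n" "(k,l) \<in> opairs n" using ij kl by (auto simp: upairs_def opairs_def)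
  have "\<exists>m. (m = k \<or> m = l) \<and> m \<noteq> i \<and> m \<noteq> j"
  proof (rule ccontr)
    assume "\<not> ?thesis"
    then have "k = i \<or> k = j" "l = i \<or> l = j" by blast+
    then show False using ij kl ne by (auto simp: upairs_def)
  qed
  then obtain m where m: "m = k \<or> m = l" "m \<noteq> i" "m \<noteq> j" by blast
  have "y = 0"
    using three_small [of i j m y] B_small [OF o(1) y(1)] B_small [OF o(2) y(2)] m o by (auto simp: opairs_def)
  then show False using y X_nz by (auto simp: B_def)
qed

lemma AB_disj:
  assumes o: "(i,j) \<in> opairs n" and k: "k < n" "k \<noteq> i" "k \<noteq> j"
  shows "A \<epsilon> k \<inter> B i j = {}"
proof (rule ccontr)
  assume "A \<epsilon> k \<inter> B i j \<noteq> {}"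
  then obtain y where y: "y \<in> B i j" "norm (\<alpha> k y) < \<eta> * norm y" by (auto simp: A_def)
  have "e0 \<le> e1" using e0_small pos by linarith
  also have "e1 \<le> C * e1" using C1 pos by simp
  finally have "\<eta> * norm y \<le> C * e1 * norm y"
    using smalls(6) pos by (intro mult_right_mono) auto
  then have "y = 0"
    using three_small [of i j k y] B_small [OF o y(1)] y(2) k o by (auto simp: opairs_def)
  then show False using y X_nz by (auto simp: B_def)
qed

section \<open>Estimates and charts in a neck\<close>

lemma neck_est:
  assumes o: "(i,j) \<in> opairs n" and y: "norm (\<alpha> i y) \<le> e2 * norm (\<gamma> i j y)" "norm (\<alpha> j y) \<le> e2 * norm (\<gamma> i j y)"
  shows "norm y \<le> 2 * C * norm (\<gamma> i j y)"
    "k < n \<Longrightarrow> k \<noteq> i \<Longrightarrow> k \<noteq> j \<Longrightarrow> norm (\<gamma> i j y) \<le> 2 * C^2 * norm (\<alpha> k y)"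
proof -
  have "norm y \<le> C * (norm (\<alpha> i y) + norm (\<alpha> j y) + norm (\<gamma> i j y))" by (rule est2 [OF o])
  also have "\<dots> \<le> C * ((2 * e2 + 1) * norm (\<gamma> i j y))"
    using y Cpow(2) by (intro mult_left_mono) (auto simp: algebra_simps)
  also have "\<dots> \<le> C * (2 * norm (\<gamma> i j y))"
    using smalls(11) Cpow(2) by (intro mult_left_mono mult_right_mono) auto
  finally show "norm y \<le> 2 * C * norm (\<gamma> i j y)" by simp
  assume k: "k < n" "k \<noteq> i" "k \<noteq> j"
  have "norm (\<gamma> i j y) \<le> C * norm y" by (rule norm_gamma_le [OF o])
  also have "\<dots> \<le> C * (C * (norm (\<alpha> i y) + norm (\<alpha> j y) + norm (\<alpha> k y)))"
    using est3 [of i j k y] k o Cpow(2) by (intro mult_left_mono) (auto simp: opairs_def)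
  also have "\<dots> \<le> C * (C * (2 * e2 * norm (\<gamma> i j y) + norm (\<alpha> k y)))"
    using y Cpow(2) by (intro mult_left_mono) auto
  also have "\<dots> = (2 * C^2 * e2) * norm (\<gamma> i j y) + C^2 * norm (\<alpha> k y)"
    by (simp add: power2_eq_square algebra_simps)
  also have "\<dots> \<le> 1/2 * norm (\<gamma> i j y) + C^2 * norm (\<alpha> k y)"
    using smalls(12) by (intro add_mono mult_right_mono) auto
  finally show "norm (\<gamma> i j y) \<le> 2 * C^2 * norm (\<alpha> k y)" by linarith
qed

text \<open>Scaling \<open>\<gamma> i j\<close> to modulus 1 puts the point into the region of
  \<open>lipL\<close>. As \<open>J\<close> omits two forms, \<open>G J\<close> is homogeneous of
  degree 2, which accounts for the powers of |\<gamma>|. The lower bound comes from the upper bounds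
  of the forms by \<open>C\<close> times the norm.\<close>

lemma neck_G:
  assumes o: "(i,j) \<in> opairs n" and J: "J = {..<n} - {i} - {j}"
    and y: "norm (\<alpha> i y) \<le> e2 * norm (\<gamma> i j y)" "norm (\<alpha> j y) \<le> e2 * norm (\<gamma> i j y)" "\<gamma> i j y \<noteq> 0"
  shows "k \<in> J \<Longrightarrow> \<alpha> k y \<noteq> 0" "norm (G J y) \<le> L * norm (\<gamma> i j y)^2" "norm (\<gamma> i j y)^2 \<le> C^n * norm (G J y)"
    "norm (\<alpha> i y') \<le> e2 * norm (\<gamma> i j y) \<Longrightarrow> norm (\<alpha> j y') \<le> e2 * norm (\<gamma> i j y) \<Longrightarrow> \<gamma> i j y' = \<gamma> i j y \<Longrightarrow>
      norm (G J y - G J y') \<le> L * norm (\<gamma> i j y) * norm (y - y')"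
proof -
  have Jn: "J \<subseteq> {..<n}" using J by auto
  have ij: "i < n" "j < n" "i \<noteq> j" using o by (auto simp: opairs_def)
  have "card J = n - 2" using J ij by (simp add: card_Diff_subset)
  moreover have "n \<ge> 2" using ij by linarith
  ultimately have cJ: "n - card J = 2" "n = card J + 2" by auto
  define t where "t = inverse (norm (\<gamma> i j y))"
  have t: "t > 0" "t * norm (\<gamma> i j y) = 1" using y(3) by (simp_all add: t_def)
  have sc: "norm (t *\<^sub>R z) \<le> 2 * C \<and> (\<forall>k\<in>J. 1 / (2 * C^2) \<le> norm (\<alpha> k (t *\<^sub>R z)))"
    if z: "norm (\<alpha> i z) \<le> e2 * norm (\<gamma> i j y)" "norm (\<alpha> j z) \<le> e2 * norm (\<gamma> i j y)" "\<gamma> i j z = \<gamma> i j y" for z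
  proof
    have "t * norm z \<le> t * (2 * C * norm (\<gamma> i j z))"
      using neck_est(1) [OF o, of z] z t by (intro mult_left_mono) auto
    also have "\<dots> = 2 * C * (t * norm (\<gamma> i j y))" using z(3) by simp
    finally show "norm (t *\<^sub>R z) \<le> 2 * C" using t by simp
    show "\<forall>k\<in>J. 1 / (2 * C^2) \<le> norm (\<alpha> k (t *\<^sub>R z))"
    proof
      fix k assume "k \<in> J"
      then have "norm (\<gamma> i j z) \<le> 2 * C^2 * norm (\<alpha> k z)"
        using neck_est(2) [OF o, of z k] z J by auto
      then have "t * norm (\<gamma> i j y) \<le> t * (2 * C^2 * norm (\<alpha> k z))"
        using z(3) t by (intro mult_left_mono) auto
      then show "1 / (2 * C^2) \<le> norm (\<alpha> k (t *\<^sub>R z))"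
        using t Cpow(2) by (simp add: lform_scaleR norm_mult field_simps)
    qed
  qed
  have scG: "G J (t *\<^sub>R z) = of_real (t^2) * G J z" for z
    using G_scale [OF t(1) Jn] cJ by simp
  have t2: "t^2 * norm (\<gamma> i j y)^2 = 1" using t by (simp flip: power_mult_distrib)
  show nz: "\<alpha> k y \<noteq> 0" if "k \<in> J" for k
  proof
    assume "\<alpha> k y = 0"
    then have "norm (\<gamma> i j y) \<le> 0" using neck_est(2) [OF o y(1,2), of k] that J by auto
    then show False using y(3) by simp
  qed
  have "norm (G J (t *\<^sub>R y)) \<le> L"
    using lipL sc [OF y(1,2) refl] Jn unfolding lip_bound_def by blast
  then have "t^2 * norm (G J y) \<le> L"
    using t by (simp add: scG norm_mult norm_power)
  then have "norm (\<gamma> i j y)^2 * (t^2 * norm (G J y)) \<le> norm (\<gamma> i j y)^2 * L"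
    by (intro mult_left_mono) auto
  then show "norm (G J y) \<le> L * norm (\<gamma> i j y)^2"
    using t2 by (simp add: algebra_simps) (metis mult.assoc mult.left_commute mult_1_right)
  show "norm (\<gamma> i j y)^2 \<le> C^n * norm (G J y)"
  proof -
    have y0: "norm y > 0" using y(3) by auto
    have "(\<Prod>k\<in>J. norm (\<alpha> k y)) \<le> (\<Prod>k\<in>J. C * norm y)"
      using norm_alpha_le Jn by (intro prod_mono) auto
    then have pr: "norm (\<Prod>k\<in>J. \<alpha> k y) \<le> C ^ card J * norm y ^ card J"
      by (simp add: prod_norm power_mult_distrib)
    have pr0: "norm (\<Prod>k\<in>J. \<alpha> k y) > 0"
      using nz finite_subset [OF Jn] by simp
    have "norm (\<gamma> i j y)^2 \<le> (C * norm y)^2"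
      using norm_gamma_le [OF o] by (intro power_mono) auto
    also have "\<dots> * norm (\<Prod>k\<in>J. \<alpha> k y) \<le> (C * norm y)^2 * (C ^ card J * norm y ^ card J)"
      using pr by (intro mult_left_mono) auto
    also have "\<dots> = C^n * norm y ^ n"
    proof -
      have "z ^ n = z ^ card J * z^2" for z :: real
        by (subst cJ(2)) (rule power_add)
      then show ?thesis by (simp add: power_mult_distrib)
    qed
    finally have "norm (\<gamma> i j y)^2 * norm (\<Prod>k\<in>J. \<alpha> k y) \<le> C^n * norm y ^ n"
      using pr0 by (smt (verit) mult_right_mono)
    then show ?thesis
      using pr0 by (simp add: G_def norm_divide norm_power field_simps)
  qed
  assume y': "norm (\<alpha> i y') \<le> e2 * norm (\<gamma> i j y)" "norm (\<alpha> j y') \<le> e2 * norm (\<gamma> i j y)" "\<gamma> i j y' = \<gamma> i j y"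
  have "norm (G J (t *\<^sub>R y) - G J (t *\<^sub>R y')) \<le> L * norm (t *\<^sub>R y - t *\<^sub>R y')"
    using lipL sc [OF y(1,2) refl] sc [OF y'] Jn unfolding lip_bound_def by blast
  moreover have "norm (G J (t *\<^sub>R y) - G J (t *\<^sub>R y')) = t^2 * norm (G J y - G J y')"
    unfolding scG right_diff_distrib [symmetric] norm_mult using t by (simp add: norm_power)
  moreover have "norm (t *\<^sub>R y - t *\<^sub>R y') = t * norm (y - y')"
    unfolding scaleR_diff_right [symmetric] using t by simp
  ultimately have "t^2 * norm (G J y - G J y') \<le> L * (t * norm (y - y'))" by simp
  then have "norm (\<gamma> i j y)^2 * (t^2 * norm (G J y - G J y')) \<le> norm (\<gamma> i j y)^2 * (L * (t * norm (y - y')))"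
    by (intro mult_left_mono) auto
  moreover have "norm (\<gamma> i j y)^2 * (L * (t * norm (y - y'))) = L * norm (\<gamma> i j y) * norm (y - y') * (t * norm (\<gamma> i j y))"
    by (simp add: power2_eq_square)
  moreover have "norm (\<gamma> i j y)^2 * (t^2 * norm (G J y - G J y')) = (t^2 * norm (\<gamma> i j y)^2) * norm (G J y - G J y')"
    by simp
  ultimately show "norm (G J y - G J y') \<le> L * norm (\<gamma> i j y) * norm (y - y')"
    using t t2 by simp
qed

lemma neck_product:
  assumes o: "(i,j) \<in> opairs n" and X: "y \<in> X \<delta>"
    and y: "norm (\<alpha> i y) \<le> e2 * norm (\<gamma> i j y)" "norm (\<alpha> j y) \<le> e2 * norm (\<gamma> i j y)" "\<gamma> i j y \<noteq> 0"
  shows "norm (\<alpha> i y) * norm (\<alpha> j y) \<le> \<delta> * L * norm (\<gamma> i j y)^2"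
    "\<delta> * norm (\<gamma> i j y)^2 \<le> C^n * (norm (\<alpha> i y) * norm (\<alpha> j y))"
proof -
  let ?J = "{..<n} - {i} - {j}"
  note G = neck_G [OF o refl y]
  have "\<alpha> i y * \<alpha> j y = of_real \<delta> * G ?J y"
    using X_iff_2 [OF o X_nz(1) [OF X]] G(1) X by blast
  then have eq: "norm (\<alpha> i y) * norm (\<alpha> j y) = \<delta> * norm (G ?J y)"
    using \<delta>0 by (metis norm_mult norm_of_real abs_of_pos)
  show "norm (\<alpha> i y) * norm (\<alpha> j y) \<le> \<delta> * L * norm (\<gamma> i j y)^2"
    unfolding eq using mult_left_mono [OF G(2), of \<delta>] \<delta>0 by simp
  show "\<delta> * norm (\<gamma> i j y)^2 \<le> C^n * (norm (\<alpha> i y) * norm (\<alpha> j y))"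
    unfolding eq using mult_left_mono [OF G(3), of \<delta>] \<delta>0 by (simp add: algebra_simps)
qed

text \<open>With \<gamma> and \<alpha>_j prescribed by \<open>x\<close>, the equation of the cone
  becomes a fixed point equation for s = \<alpha>_i, obtained by dividing through \<alpha>_j. The
  lower bound \<open>K * \<delta>\<close> of the shell makes the right-hand side small and
  contracting.\<close>

lemma B_chart:
  assumes o: "(i,j) \<in> opairs n"
  obtains F where "continuous_on (shell (K * \<delta>) e1) F"
    "\<And>x. x \<in> shell (K * \<delta>) e1 \<Longrightarrow> F x \<in> X \<delta> \<and> \<gamma> i j (F x) = fst x \<and> \<alpha> j (F x) = snd x \<and> norm (\<alpha> i (F x)) \<le> e2 * norm (fst x)"
    "\<And>y. y \<in> X \<delta> \<Longrightarrow> (\<gamma> i j y, \<alpha> j y) \<in> shell (K * \<delta>) e1 \<Longrightarrow> norm (\<alpha> i y) \<le> e2 * norm (\<gamma> i j y) \<Longrightarrow> F (\<gamma> i j y, \<alpha> j y) = y"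
proof -
  obtain v1 v2 v3 where fr: "frame C (a i) (a j) (g i j) v1 v2 v3" using frame2 [OF o] by blast
  note co = frame_pt_coords [OF fr]
  let ?J = "{..<n} - {i} - {j}" and ?Z = "shell (K * \<delta>) e1"
  define pt where "pt x s = frame_pt v1 v2 v3 s (snd x) (fst x)" for x s
  define T where "T x s = of_real \<delta> * G ?J (pt x s) / snd x" for x s
  define \<rho> where "\<rho> x = e2 * norm (fst x)" for x :: "complex \<times> complex"
  have K\<delta>: "K * \<delta> > 0" using pos \<delta>0 by simp
  have Z: "fst x \<noteq> 0" "snd x \<noteq> 0" "K * \<delta> * norm (fst x) < norm (snd x)" "norm (snd x) \<le> e2 * norm (fst x)" if "x \<in> ?Z" for x
  proof -
    have x: "K * \<delta> * norm (fst x) < norm (snd x)" "norm (snd x) < e1 * norm (fst x)"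
      using that by (auto simp: shell_def)
    then show "fst x \<noteq> 0" "K * \<delta> * norm (fst x) < norm (snd x)" by auto
    have "0 \<le> K * \<delta> * norm (fst x)" using K\<delta> by simp
    then show "snd x \<noteq> 0" using x by auto
    have "e1 * norm (fst x) \<le> e2 * norm (fst x)" using smalls(10) pos by (intro mult_right_mono) auto
    then show "norm (snd x) \<le> e2 * norm (fst x)" using x by linarith
  qed
  have c: "\<alpha> i (pt x s) = s" "\<alpha> j (pt x s) = snd x" "\<gamma> i j (pt x s) = fst x" for x s
    by (simp_all add: pt_def co)
  have nk: "norm (\<alpha> i (pt x s)) \<le> e2 * norm (\<gamma> i j (pt x s))" "norm (\<alpha> j (pt x s)) \<le> e2 * norm (\<gamma> i j (pt x s))" "\<gamma> i j (pt x s) \<noteq> 0"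
    if "x \<in> ?Z" "norm s \<le> \<rho> x" for x s
    using that Z [OF that(1)] by (auto simp: c \<rho>_def)
  obtain \<sigma> where \<sigma>: "continuous_on ?Z \<sigma>" "\<And>z. z \<in> ?Z \<Longrightarrow> norm (\<sigma> z) \<le> \<rho> z" "\<And>z. z \<in> ?Z \<Longrightarrow> \<sigma> z = T z (\<sigma> z)"
    "\<And>z s. z \<in> ?Z \<Longrightarrow> norm s \<le> \<rho> z \<Longrightarrow> s = T z s \<Longrightarrow> s = \<sigma> z"
  proof (rule contraction_section [of ?Z \<rho> T])
    show "0 < \<rho> z" if "z \<in> ?Z" for z using Z [OF that] pos by (simp add: \<rho>_def)
    show "continuous_on ?Z \<rho>" unfolding \<rho>_def by (intro continuous_intros)
    show "norm (T z s) \<le> \<rho> z / 2" if z: "z \<in> ?Z" "norm s \<le> \<rho> z" for z s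
    proof -
      have p0: "norm (snd z) > 0" using Z [OF z(1)] by simp
      have "norm (T z s) * norm (snd z) = \<delta> * norm (G ?J (pt z s))"
        using p0 \<delta>0 by (simp add: T_def norm_divide norm_mult)
      also have "\<dots> \<le> \<delta> * (L * norm (fst z)^2)"
        using neck_G(2) [OF o refl nk [OF z]] \<delta>0 by (simp add: c)
      also have "\<dots> \<le> C * (\<delta> * (L * norm (fst z)^2))"
        using C1 \<delta>0 L1 mult_right_mono [of 1 C "\<delta> * (L * norm (fst z)^2)"] by simp
      \<comment> \<open>\<open>K\<close> is chosen for this equality; its factor \<open>C\<close>
        serves the Lipschitz estimate below, where it bounds the norm of \<open>v1\<close>.\<close>
      also have "\<dots> = \<rho> z / 2 * (K * \<delta> * norm (fst z))"
        using pos Cpow(2) by (simp add: \<rho>_def K_eq power2_eq_square)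
      also have "\<dots> \<le> \<rho> z / 2 * norm (snd z)"
        using Z [OF z(1)] pos by (intro mult_left_mono) (auto simp: \<rho>_def)
      finally show ?thesis using p0 by simp
    qed
    show "norm (T z s - T z t) \<le> norm (s - t) / 2" if z: "z \<in> ?Z" "norm s \<le> \<rho> z" "norm t \<le> \<rho> z" for z s t
    proof -
      have p0: "norm (snd z) > 0" using Z [OF z(1)] by simp
      have "T z s - T z t = of_real \<delta> * (G ?J (pt z s) - G ?J (pt z t)) / snd z"
        by (simp add: T_def algebra_simps diff_divide_distrib)
      then have "norm (T z s - T z t) * norm (snd z) = \<delta> * norm (G ?J (pt z s) - G ?J (pt z t))"
        using p0 \<delta>0 by (simp add: norm_divide norm_mult)
      also have "\<dots> \<le> \<delta> * (L * norm (fst z) * norm (pt z s - pt z t))"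
        using neck_G(4) [OF o refl nk [OF z(1,2)], of "pt z t"] nk [OF z(1,3)] \<delta>0 by (simp add: c)
      also have "norm (pt z s - pt z t) = norm (s - t) * norm v1"
        unfolding pt_def frame_pt_diff norm_vscale ..
      also have "\<delta> * (L * norm (fst z) * (norm (s - t) * norm v1)) \<le> \<delta> * (L * norm (fst z) * (norm (s - t) * C))"
        using frame_norm(2) [OF fr] \<delta>0 L1 by (intro mult_left_mono) auto
      also have "\<dots> = norm (s - t) / 2 * (e2 * K * \<delta> * norm (fst z))"
        using pos Cpow(2) by (simp add: K_eq)
      also have "\<dots> \<le> norm (s - t) / 2 * (1 * (K * \<delta> * norm (fst z)))"
      proof -
        have "e2 * (K * \<delta> * norm (fst z)) \<le> 1 * (K * \<delta> * norm (fst z))"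
          using smalls(11) K\<delta> by (intro mult_right_mono) auto
        then show ?thesis by (intro mult_left_mono) (auto simp: mult.assoc)
      qed
      also have "\<dots> \<le> norm (s - t) / 2 * norm (snd z)"
        using Z [OF z(1)] by (intro mult_left_mono) auto
      finally show ?thesis using p0 by simp
    qed
    show "continuous (at z within ?Z) (\<lambda>w. T w s)" if z: "z \<in> ?Z" "norm s < \<rho> z" for z s
    proof -
      have "continuous_on UNIV (\<lambda>w. pt w s)"
        unfolding pt_def by (intro continuous_frame_pt continuous_intros)
      then have "isCont (\<lambda>w. G ?J (pt w s)) z"
        using neck_G(1) [OF o refl nk [of z s]] z by (intro isCont_G) auto
      then have "isCont (\<lambda>w. T w s) z"
        unfolding T_def using Z(2) [OF z(1)] by (intro continuous_intros) auto
      then show ?thesis by (rule continuous_at_imp_continuous_at_within)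
    qed
  qed (rule that)
  have pX: "pt x s \<in> X \<delta> \<longleftrightarrow> s = T x s" if "x \<in> ?Z" "norm s \<le> \<rho> x" for x s
  proof -
    have "pt x s \<noteq> 0" using nk(3) [OF that] by auto
    then have "pt x s \<in> X \<delta> \<longleftrightarrow> s * snd x = of_real \<delta> * G ?J (pt x s)"
      using X_iff_2 [OF o, of "pt x s"] neck_G(1) [OF o refl nk [OF that]] by (simp add: c)
    then show ?thesis using Z(2) [OF that(1)] by (simp add: T_def field_simps)
  qed
  show ?thesis
  proof (rule that [of "\<lambda>x. pt x (\<sigma> x)"])
    show "continuous_on ?Z (\<lambda>x. pt x (\<sigma> x))"
      unfolding pt_def by (intro continuous_frame_pt \<sigma>(1) continuous_intros)
    show "pt x (\<sigma> x) \<in> X \<delta> \<and> \<gamma> i j (pt x (\<sigma> x)) = fst x \<and> \<alpha> j (pt x (\<sigma> x)) = snd x \<and> norm (\<alpha> i (pt x (\<sigma> x))) \<le> e2 * norm (fst x)"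
      if "x \<in> ?Z" for x
      using \<sigma>(2,3) [OF that] pX [OF that] by (simp add: c \<rho>_def)
    fix y assume y: "y \<in> X \<delta>" "(\<gamma> i j y, \<alpha> j y) \<in> ?Z" "norm (\<alpha> i y) \<le> e2 * norm (\<gamma> i j y)"
    have py: "pt (\<gamma> i j y, \<alpha> j y) (\<alpha> i y) = y" using co(4) [of y] by (simp add: pt_def)
    have "\<alpha> i y = T (\<gamma> i j y, \<alpha> j y) (\<alpha> i y)"
      using pX [OF y(2), of "\<alpha> i y"] y py by (simp add: \<rho>_def)
    then have "\<alpha> i y = \<sigma> (\<gamma> i j y, \<alpha> j y)"
      using \<sigma>(4) [OF y(2), of "\<alpha> i y"] y(3) by (simp add: \<rho>_def)
    then show "pt (\<gamma> i j y, \<alpha> j y) (\<sigma> (\<gamma> i j y, \<alpha> j y)) = y" using py by simp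
  qed
qed

end

section \<open>Necks and their ends as images of shells\<close>

context lines_params
begin

lemma K_le_K': "K \<le> K'"
proof -
  have "K * (e1 * 1) \<le> K * (e1 * (L * C^n))"
  proof -
    have "1 * 1 \<le> L * C^n" using L1 Cpow by (intro mult_mono) auto
    then show ?thesis using pos by (intro mult_left_mono) auto
  qed
  also have "\<dots> = L * (e1 * C^n * K)" by simp
  also have "\<dots> = K' * e1" by (simp add: e1K K'e1)
  finally show ?thesis using pos by simp
qed

lemma \<delta>_small: "2 * K' * \<delta> < \<eta>" "K * \<delta> < e0" "K' * \<delta> < e0" "\<delta> * L < \<eta> * e0" "K * \<delta> > 0" "K' * \<delta> > 0"
proof -
  have "2 * K' * \<delta> * 1 \<le> 2 * K' * \<delta> * C" using C1 pos \<delta>0 by (intro mult_left_mono) auto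
  then show 1: "2 * K' * \<delta> < \<eta>" using d3 by linarith
  show 2: "K' * \<delta> < e0" using 1 smalls(6) pos \<delta>0 mult_pos_pos [OF pos(4) \<delta>0] by linarith
  have "K * \<delta> \<le> K' * \<delta>" using K_le_K' \<delta>0 by (intro mult_right_mono) auto
  then show "K * \<delta> < e0" using 2 by linarith
  have "\<delta> * L * 1 \<le> \<delta> * L * C" using C1 L1 \<delta>0 by (intro mult_left_mono) auto
  then show "\<delta> * L < \<eta> * e0" using d4 by linarith
  show "K * \<delta> > 0" "K' * \<delta> > 0" using pos \<delta>0 by auto
qed

lemma e1_gamma: "e1 * norm z \<le> e2 * norm (z::complex)"
  using smalls(10) pos by (intro mult_right_mono) auto

lemma B_neck: "y \<in> B i j \<Longrightarrow> norm (\<alpha> i y) \<le> e2 * norm (\<gamma> i j y)" "y \<in> B i j \<Longrightarrow> norm (\<alpha> j y) \<le> e2 * norm (\<gamma> i j y)"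
  using e1_gamma [of "\<gamma> i j y"] by (auto simp: B_def)

text \<open>In a neck |\<alpha>_i \<alpha>_j| is bounded below by a multiple of \<delta>
  |\<gamma>|^2, so the upper bound \<open>e1\<close> on |\<alpha>_i| / |\<gamma>| turns into the
  lower bound \<open>K * \<delta>\<close> on |\<alpha>_j| / |\<gamma>|.\<close>

lemma B_in_chart:
  assumes o: "(i,j) \<in> opairs n" and y: "y \<in> B i j"
  shows "(\<gamma> i j y, \<alpha> j y) \<in> shell (K * \<delta>) e1"
proof -
  have yB: "y \<in> X \<delta>" "norm (\<alpha> i y) < e1 * norm (\<gamma> i j y)" "norm (\<alpha> j y) < e1 * norm (\<gamma> i j y)"
    using y by (auto simp: B_def)
  have g0: "norm (\<gamma> i j y) > 0" using B_gamma [OF y] by simp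
  have aj: "norm (\<alpha> j y) > 0" using X_nz(2) [OF yB(1)] o by (auto simp: opairs_def)
  have "\<delta> * norm (\<gamma> i j y)^2 \<le> C^n * (norm (\<alpha> i y) * norm (\<alpha> j y))"
    by (rule neck_product(2) [OF o yB(1) B_neck [OF y] B_gamma [OF y]])
  also have "\<dots> < C^n * (e1 * norm (\<gamma> i j y) * norm (\<alpha> j y))"
    using yB(2) aj Cpow by (intro mult_strict_left_mono mult_strict_right_mono) auto
  finally have "K * (\<delta> * norm (\<gamma> i j y)^2) < K * (C^n * (e1 * norm (\<gamma> i j y) * norm (\<alpha> j y)))"
    using pos by (intro mult_strict_left_mono) auto
  also have "\<dots> = (e1 * C^n * K) * norm (\<gamma> i j y) * norm (\<alpha> j y)" by simp
  also have "\<dots> = norm (\<gamma> i j y) * norm (\<alpha> j y)" by (simp only: e1K mult_1)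
  finally have "norm (\<gamma> i j y) * (K * \<delta> * norm (\<gamma> i j y)) < norm (\<gamma> i j y) * norm (\<alpha> j y)"
    by (simp add: power2_eq_square algebra_simps)
  then have "K * \<delta> * norm (\<gamma> i j y) < norm (\<alpha> j y)" using g0 by simp
  then show ?thesis using yB by (simp add: shell_def)
qed

lemma shell_mono: "r \<le> s \<Longrightarrow> shell s t \<subseteq> shell r t"
proof
  fix x assume le: "r \<le> s" and x: "x \<in> shell s t"
  have "r * norm (fst x) \<le> s * norm (fst x)" using le by (intro mult_right_mono) auto
  then show "x \<in> shell r t" using x by (auto simp: shell_def)
qed

text \<open>Inside a neck only the tube condition for \<open>j\<close> is a restriction. If
  \<open>\<alpha> j\<close> is not too small, the product estimate makes \<open>\<alpha> i\<close>
  tiny, and \<open>three_small\<close> keeps every third form away from 0.\<close>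

lemma neck_set:
  assumes o: "(i,j) \<in> opairs n" and \<epsilon>: "e0 \<le> \<epsilon>" "\<epsilon> \<le> 4 * e0"
  shows "A \<epsilon> i \<inter> B i j = {y \<in> B i j. \<epsilon> * norm (\<gamma> i j y) < norm (\<alpha> j y)}"
proof (intro equalityI subsetI)
  fix y assume "y \<in> A \<epsilon> i \<inter> B i j"
  then show "y \<in> {y \<in> B i j. \<epsilon> * norm (\<gamma> i j y) < norm (\<alpha> j y)}"
    using o by (auto simp: A_def opairs_def)
next
  fix y assume "y \<in> {y \<in> B i j. \<epsilon> * norm (\<gamma> i j y) < norm (\<alpha> j y)}"
  then have y: "y \<in> B i j" "\<epsilon> * norm (\<gamma> i j y) < norm (\<alpha> j y)" by auto
  have yX: "y \<in> X \<delta>" using y by (simp add: B_def)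
  have y0: "norm y > 0" using X_nz(1) [OF yX] by simp
  have g0: "norm (\<gamma> i j y) > 0" using B_gamma [OF y(1)] by simp
  have "norm (\<alpha> i y) * (e0 * norm (\<gamma> i j y)) \<le> norm (\<alpha> i y) * norm (\<alpha> j y)"
    using y(2) \<epsilon> mult_right_mono [OF \<epsilon>(1), of "norm (\<gamma> i j y)"] by (intro mult_left_mono) auto
  also have "\<dots> \<le> \<delta> * L * norm (\<gamma> i j y)^2"
    by (rule neck_product(1) [OF o yX B_neck [OF y(1)] B_gamma [OF y(1)]])
  finally have "(norm (\<alpha> i y) * e0) * norm (\<gamma> i j y) \<le> (\<delta> * L * norm (\<gamma> i j y)) * norm (\<gamma> i j y)"
    by (simp add: power2_eq_square algebra_simps)
  then have "norm (\<alpha> i y) * e0 \<le> \<delta> * L * norm (\<gamma> i j y)" using g0 by simp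
  also have "\<dots> \<le> \<delta> * L * (C * norm y)"
    using norm_gamma_le [OF o] \<delta>0 L1 by (intro mult_left_mono) auto
  also have "\<dots> = (\<delta> * L * C) * norm y" by simp
  also have "\<dots> < (\<eta> * e0) * norm y" using d4 y0 by (intro mult_strict_right_mono)
  finally have ai: "norm (\<alpha> i y) < \<eta> * norm y" using pos by (simp add: algebra_simps)
  have "\<epsilon> * norm (\<gamma> i k y) < norm (\<alpha> k y)" if k: "k \<in> {..<n} - {i}" for k
  proof (cases "k = j")
    case False
    have ok: "(i,k) \<in> opairs n" using k o by (auto simp: opairs_def)
    have "\<epsilon> * norm (\<gamma> i k y) \<le> \<epsilon> * (C * norm y)"
      using norm_gamma_le [OF ok] \<epsilon> pos by (intro mult_left_mono) auto
    also have "\<dots> \<le> e1 * (C * norm y)"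
      using \<epsilon> e0_small pos Cpow(2) by (intro mult_right_mono) auto
    also have "\<dots> = C * e1 * norm y" by simp
    finally have "\<epsilon> * norm (\<gamma> i k y) \<le> C * e1 * norm y" .
    moreover have "\<not> norm (\<alpha> k y) \<le> C * e1 * norm y"
      using three_small [of i j k y] B_small [OF o y(1)] k False o y0 by (auto simp: opairs_def)
    ultimately show ?thesis by linarith
  qed (use y in simp)
  then show "y \<in> A \<epsilon> i \<inter> B i j" using y ai yX by (simp add: A_def)
qed

text \<open>The neck itself is only squeezed: it contains the chart image of the shell above
  \<open>K' * \<delta>\<close>, and its coordinates lie in the shell above
  \<open>K * \<delta>\<close>. Its end in core \<open>i\<close>, however, is exactly the image of a
  shell.\<close>

lemma neck_image:
  assumes o: "(i,j) \<in> opairs n" and \<epsilon>: "e0 \<le> \<epsilon>" "\<epsilon> \<le> 4 * e0"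
    and F: "\<And>x. x \<in> shell (K * \<delta>) e1 \<Longrightarrow> F x \<in> X \<delta> \<and> \<gamma> i j (F x) = fst x \<and> \<alpha> j (F x) = snd x \<and> norm (\<alpha> i (F x)) \<le> e2 * norm (fst x)"
      "\<And>y. y \<in> X \<delta> \<Longrightarrow> (\<gamma> i j y, \<alpha> j y) \<in> shell (K * \<delta>) e1 \<Longrightarrow> norm (\<alpha> i y) \<le> e2 * norm (\<gamma> i j y) \<Longrightarrow> F (\<gamma> i j y, \<alpha> j y) = y"
  shows "A \<epsilon> i \<inter> B i j = F ` shell \<epsilon> e1" "F ` shell (K' * \<delta>) e1 \<subseteq> B i j"
proof -
  have inB: "F x \<in> B i j" if x: "x \<in> shell (K' * \<delta>) e1" for x
  proof -
    have xK: "x \<in> shell (K * \<delta>) e1"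
      using x shell_mono [of "K * \<delta>" "K' * \<delta>" e1] K_le_K' \<delta>0 by auto
    note Fx = F(1) [OF xK]
    have p: "K' * \<delta> * norm (fst x) < norm (snd x)" "norm (snd x) < e1 * norm (fst x)"
      using x by (auto simp: shell_def)
    then have c0: "norm (fst x) > 0" by (metis norm_ge_zero less_eq_real_def mult_zero_right not_less)
    have ne: "norm (\<alpha> i (F x)) \<le> e2 * norm (\<gamma> i j (F x))" "norm (\<alpha> j (F x)) \<le> e2 * norm (\<gamma> i j (F x))" "\<gamma> i j (F x) \<noteq> 0"
    proof -
      have "norm (snd x) \<le> e2 * norm (fst x)" using p(2) e1_gamma [of "fst x"] by linarith
      then show "norm (\<alpha> i (F x)) \<le> e2 * norm (\<gamma> i j (F x))" "norm (\<alpha> j (F x)) \<le> e2 * norm (\<gamma> i j (F x))" "\<gamma> i j (F x) \<noteq> 0"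
        using Fx c0 by auto
    qed
    have "norm (\<alpha> i (F x)) * norm (snd x) \<le> \<delta> * L * norm (fst x)^2"
      using neck_product(1) [OF o _ ne] Fx by simp
    also have "\<dots> = e1 * norm (fst x) * (K' * \<delta> * norm (fst x))"
      using K'e1 by (simp add: power2_eq_square algebra_simps)
    also have "\<dots> < e1 * norm (fst x) * norm (snd x)"
      using p(1) c0 pos by (intro mult_strict_left_mono) auto
    finally have "norm (\<alpha> i (F x)) < e1 * norm (fst x)" by (simp add: mult_less_cancel_right)
    then show ?thesis using Fx p by (simp add: B_def)
  qed
  then show "F ` shell (K' * \<delta>) e1 \<subseteq> B i j" by blast
  have sub: "shell \<epsilon> e1 \<subseteq> shell (K' * \<delta>) e1"
    using \<delta>_small(3) \<epsilon> by (intro shell_mono) auto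
  show "A \<epsilon> i \<inter> B i j = F ` shell \<epsilon> e1"
    unfolding neck_set [OF o \<epsilon>]
  proof (intro equalityI subsetI)
    fix y assume "y \<in> {y \<in> B i j. \<epsilon> * norm (\<gamma> i j y) < norm (\<alpha> j y)}"
    then have y: "y \<in> B i j" "\<epsilon> * norm (\<gamma> i j y) < norm (\<alpha> j y)" by auto
    have "F (\<gamma> i j y, \<alpha> j y) = y"
      using F(2) [OF _ B_in_chart [OF o y(1)] B_neck(1) [OF y(1)]] y by (simp add: B_def)
    moreover have "(\<gamma> i j y, \<alpha> j y) \<in> shell \<epsilon> e1"
      using y by (auto simp: shell_def B_def)
    ultimately show "y \<in> F ` shell \<epsilon> e1" by (metis imageI)
  next
    fix y assume "y \<in> F ` shell \<epsilon> e1"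
    then obtain x where x: "x \<in> shell \<epsilon> e1" "y = F x" by blast
    have x': "x \<in> shell (K' * \<delta>) e1" using x sub by blast
    then have xK: "x \<in> shell (K * \<delta>) e1"
      using shell_mono [of "K * \<delta>" "K' * \<delta>" e1] K_le_K' \<delta>0 by auto
    show "y \<in> {y \<in> B i j. \<epsilon> * norm (\<gamma> i j y) < norm (\<alpha> j y)}"
      using inB [OF x'] F(1) [OF xK] x by (auto simp: shell_def)
  qed
qed

lemma A_mono: "\<epsilon> \<le> \<epsilon>' \<Longrightarrow> A \<epsilon>' i \<subseteq> A \<epsilon> i"
proof
  fix y assume le: "\<epsilon> \<le> \<epsilon>'" and y: "y \<in> A \<epsilon>' i"
  have "\<epsilon> * norm (\<gamma> i k y) \<le> \<epsilon>' * norm (\<gamma> i k y)" for k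
    using le by (intro mult_right_mono) auto
  then have "\<epsilon> * norm (\<gamma> i k y) < t" if "\<epsilon>' * norm (\<gamma> i k y) < t" for k t
    using that by (rule le_less_trans)
  then show "y \<in> A \<epsilon> i" using y unfolding A_def by blast
qed

lemma shell_params: "0 < e0" "e0 < e1" "0 < 4 * e0" "4 * e0 < e1" "K * \<delta> < e1" "K' * \<delta> < e1"
  using pos e0_small \<delta>_small by linarith+

lemma neck_path:
  assumes o: "(i,j) \<in> opairs n" and \<epsilon>: "e0 \<le> \<epsilon>" "\<epsilon> \<le> 4 * e0"
  shows "path_connected (A \<epsilon> i \<inter> B i j)" "A \<epsilon> i \<inter> B i j \<noteq> {}"
proof -
  obtain F where F: "continuous_on (shell (K * \<delta>) e1) F"
    "\<And>x. x \<in> shell (K * \<delta>) e1 \<Longrightarrow> F x \<in> X \<delta> \<and> \<gamma> i j (F x) = fst x \<and> \<alpha> j (F x) = snd x \<and> norm (\<alpha> i (F x)) \<le> e2 * norm (fst x)"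
    "\<And>y. y \<in> X \<delta> \<Longrightarrow> (\<gamma> i j y, \<alpha> j y) \<in> shell (K * \<delta>) e1 \<Longrightarrow> norm (\<alpha> i y) \<le> e2 * norm (\<gamma> i j y) \<Longrightarrow> F (\<gamma> i j y, \<alpha> j y) = y"
    using B_chart [OF o] by blast
  have im: "A \<epsilon> i \<inter> B i j = F ` shell \<epsilon> e1" by (rule neck_image(1) [OF o \<epsilon> F(2,3)])
  have sub: "shell \<epsilon> e1 \<subseteq> shell (K * \<delta>) e1" using \<delta>_small \<epsilon> by (intro shell_mono) auto
  have ab: "0 < \<epsilon>" "\<epsilon> < e1" using \<epsilon> shell_params by linarith+
  show "path_connected (A \<epsilon> i \<inter> B i j)"
    unfolding im using path_connected_shell [OF ab] continuous_on_subset [OF F(1) sub]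
    by (rule path_connected_continuous_image [rotated])
  have "(1, of_real ((\<epsilon> + e1) / 2)) \<in> shell \<epsilon> e1"
    using ab by (simp add: shell_def norm_of_real abs_of_pos del: of_real_divide of_real_add)
  then show "A \<epsilon> i \<inter> B i j \<noteq> {}" unfolding im by blast
qed

lemma neck_loop:
  assumes o: "(i,j) \<in> opairs n"
  shows "\<exists>c. cycle_in 1 (A e0 i \<inter> B i j) c \<and> winding (\<gamma> i j) c = of_int p \<and> winding (\<alpha> j) c = of_int r"
proof -
  obtain F where F: "continuous_on (shell (K * \<delta>) e1) F"
    "\<And>x. x \<in> shell (K * \<delta>) e1 \<Longrightarrow> F x \<in> X \<delta> \<and> \<gamma> i j (F x) = fst x \<and> \<alpha> j (F x) = snd x \<and> norm (\<alpha> i (F x)) \<le> e2 * norm (fst x)"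
    "\<And>y. y \<in> X \<delta> \<Longrightarrow> (\<gamma> i j y, \<alpha> j y) \<in> shell (K * \<delta>) e1 \<Longrightarrow> norm (\<alpha> i y) \<le> e2 * norm (\<gamma> i j y) \<Longrightarrow> F (\<gamma> i j y, \<alpha> j y) = y"
    using B_chart [OF o] by blast
  have im: "A e0 i \<inter> B i j = F ` shell e0 e1" by (rule neck_image(1) [OF o _ _ F(2,3)]) (use pos in auto)
  have sub: "shell e0 e1 \<subseteq> shell (K * \<delta>) e1" using \<delta>_small by (intro shell_mono) auto
  obtain c where c: "cycle_in 1 (shell e0 e1) c" "winding fst c = of_int p" "winding snd c = of_int r"
    using shell_loop_exists [OF shell_params(1,2)] by blast
  have cc: "chain_in 1 (shell e0 e1) c" using c(1) by (rule cycle_in_imp_chain_in)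
  have "cycle_in 1 (A e0 i \<inter> B i j) (chain_map 1 F c)"
    unfolding im by (rule cycle_map_in [OF c(1) continuous_on_subset [OF F(1) sub]]) simp
  moreover have "winding (\<gamma> i j) (chain_map 1 F c) = of_int p"
    unfolding winding_chain_map c(2) [symmetric] by (rule winding_cong [OF cc]) (use F(2) sub in auto)
  moreover have "winding (\<alpha> j) (chain_map 1 F c) = of_int r"
    unfolding winding_chain_map c(3) [symmetric] by (rule winding_cong [OF cc]) (use F(2) sub in auto)
  ultimately show ?thesis by blast
qed

text \<open>On the neck \<open>\<alpha> i\<close> and \<open>\<alpha> j\<close> are small, so
  \<open>\<alpha> k\<close> is dominated by its term \<open>\<kappa> * \<gamma> i j\<close> and
  \<open>winding_near\<close> applies. The constant \<kappa> has winding 0 and is bounded below by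
  genericity.\<close>

lemma wind_neck:
  assumes o: "(i,j) \<in> opairs n" and k: "k < n" "k \<noteq> i" "k \<noteq> j" and c: "cycle_in 1 (B i j) c"
  shows "winding (\<alpha> k) c = winding (\<gamma> i j) c"
proof -
  obtain v1 v2 v3 where fr: "frame C (a i) (a j) (g i j) v1 v2 v3" using frame2 [OF o] by blast
  define \<kappa> where "\<kappa> = \<alpha> k v3"
  have v3: "\<alpha> i v3 = 0" "\<alpha> j v3 = 0" "\<gamma> i j v3 = 1" using fr by (auto simp: frame_def)
  have "1 \<le> C * norm v3" using norm_gamma_le [OF o, of v3] v3 by simp
  also have "\<dots> \<le> C * (C * norm \<kappa>)"
    using est3 [of i j k v3] k o v3 Cpow(2) by (intro mult_left_mono) (auto simp: opairs_def \<kappa>_def)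
  finally have \<kappa>: "1 \<le> C^2 * norm \<kappa>" by (simp add: power2_eq_square)
  have near: "norm (\<alpha> k y - \<kappa> * \<gamma> i j y) < norm (\<kappa> * \<gamma> i j y)" if y: "y \<in> B i j" for y
  proof -
    have g0: "norm (\<gamma> i j y) > 0" using B_gamma [OF y] by simp
    have "y = frame_pt v1 v2 v3 (\<alpha> i y) (\<alpha> j y) (\<gamma> i j y)" using frame_pt_coords(4) [OF fr] by simp
    then have "\<alpha> k y = \<alpha> k (frame_pt v1 v2 v3 (\<alpha> i y) (\<alpha> j y) (\<gamma> i j y))" by simp
    then have "\<alpha> k y - \<kappa> * \<gamma> i j y = \<alpha> i y * \<alpha> k v1 + \<alpha> j y * \<alpha> k v2"
      by (simp add: frame_pt_def lform_add lform_scale \<kappa>_def algebra_simps)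
    then have "norm (\<alpha> k y - \<kappa> * \<gamma> i j y) \<le> norm (\<alpha> i y) * norm (\<alpha> k v1) + norm (\<alpha> j y) * norm (\<alpha> k v2)"
      by (metis norm_mult norm_triangle_ineq)
    also have "\<dots> \<le> (e1 * norm (\<gamma> i j y)) * (C * C) + (e1 * norm (\<gamma> i j y)) * (C * C)"
    proof (intro add_mono mult_mono)
      show "norm (\<alpha> k v1) \<le> C * C" "norm (\<alpha> k v2) \<le> C * C"
        using norm_alpha_le [OF k(1), of v1] norm_alpha_le [OF k(1), of v2] frame_norm(2,3) [OF fr] Cpow(2)
          mult_left_mono [of "norm v1" C C] mult_left_mono [of "norm v2" C C] by linarith+
    qed (use y pos in \<open>auto simp: B_def\<close>)
    also have "\<dots> = 2 * (C^2 * e1) * norm (\<gamma> i j y)" by (simp add: power2_eq_square)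
    finally have 1: "norm (\<alpha> k y - \<kappa> * \<gamma> i j y) \<le> 2 * (C^2 * e1) * norm (\<gamma> i j y)" .
    have "C^2 * (2 * (C^2 * e1) * norm (\<gamma> i j y)) = (2 * C^4 * e1) * norm (\<gamma> i j y)"
      by (simp add: power_numeral_reduce)
    also have "\<dots> < 1 * norm (\<gamma> i j y)"
      using smalls(4) g0 pos Cpow(3) [of 4] by (intro mult_strict_right_mono) auto
    also have "\<dots> \<le> (C^2 * norm \<kappa>) * norm (\<gamma> i j y)"
      using \<kappa> by (intro mult_right_mono) auto
    finally have "C^2 * (2 * (C^2 * e1) * norm (\<gamma> i j y)) < C^2 * norm (\<kappa> * \<gamma> i j y)"
      by (simp add: norm_mult)
    then have "2 * (C^2 * e1) * norm (\<gamma> i j y) < norm (\<kappa> * \<gamma> i j y)"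
      using Cpow(3) [of 2] by (simp add: mult_less_cancel_left_pos)
    with 1 show ?thesis by linarith
  qed
  have \<kappa>0: "\<kappa> \<noteq> 0" using \<kappa> by auto
  have cc: "chain_in 1 (B i j) c" using c by (rule cycle_in_imp_chain_in)
  have "winding (\<alpha> k) c = winding (\<lambda>y. \<kappa> * \<gamma> i j y) c"
    using near by (intro winding_near [OF c] continuous_intros continuous_lform)
  also have "\<dots> = winding (\<lambda>y. \<kappa>) c + winding (\<gamma> i j) c"
    using \<kappa>0 B_gamma by (intro winding_mult [OF cc] continuous_intros continuous_lform)
  also have "winding (\<lambda>y. \<kappa>) c = 0"
    using \<kappa>0 by (intro winding_exp_cycle [OF c, of "\<lambda>y. Ln \<kappa>"] continuous_intros) auto
  finally show ?thesis by simp
qed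

text \<open>The product of the forms is a positive real number on the cone, so the real logarithm is
  available.\<close>

lemma wind_sum:
  assumes c: "cycle_in 1 (X \<delta>) c"
  shows "(\<Sum>k<n. winding (\<alpha> k) c) = 0"
proof -
  have cc: "chain_in 1 (X \<delta>) c" using c by (rule cycle_in_imp_chain_in)
  have "(\<Sum>k<n. winding (\<alpha> k) c) = winding (\<lambda>y. \<Prod>k<n. \<alpha> k y) c"
    using X_nz(2) by (intro winding_prod [symmetric, OF _ cc] continuous_lform) auto
  also have "\<dots> = 0"
  proof (rule winding_exp_cycle [OF c])
    show "continuous_on (X \<delta>) (\<lambda>y. complex_of_real (ln (\<delta> * norm y ^ n)))"
      using \<delta>0 X_nz(1) by (intro continuous_intros) auto
    show "(\<Prod>k<n. \<alpha> k y) = exp (complex_of_real (ln (\<delta> * norm y ^ n)))" if y: "y \<in> X \<delta>" for y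
    proof -
      have "\<delta> * norm y ^ n > 0" using X_nz(1) [OF y] \<delta>0 by simp
      then show ?thesis using y by (simp only: X_def exp_of_real exp_ln) simp
    qed
  qed
  finally show ?thesis .
qed

lemma B_inj:
  assumes o: "(i,j) \<in> opairs n" and c: "cycle_in 1 (B i j) c" and w: "winding (\<gamma> i j) c = 0" "winding (\<alpha> j) c = 0"
  shows "bounds_in 1 (X \<delta>) c"
proof -
  obtain F where F: "continuous_on (shell (K * \<delta>) e1) F"
    "\<And>x. x \<in> shell (K * \<delta>) e1 \<Longrightarrow> F x \<in> X \<delta> \<and> \<gamma> i j (F x) = fst x \<and> \<alpha> j (F x) = snd x \<and> norm (\<alpha> i (F x)) \<le> e2 * norm (fst x)"
    "\<And>y. y \<in> X \<delta> \<Longrightarrow> (\<gamma> i j y, \<alpha> j y) \<in> shell (K * \<delta>) e1 \<Longrightarrow> norm (\<alpha> i y) \<le> e2 * norm (\<gamma> i j y) \<Longrightarrow> F (\<gamma> i j y, \<alpha> j y) = y"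
    using B_chart [OF o] by blast
  let ?f = "\<lambda>y. (\<gamma> i j y, \<alpha> j y)"
  let ?d = "chain_map 1 ?f c"
  have "cycle_in 1 (shell (K * \<delta>) e1) ?d"
    by (rule cycle_map_in [OF c]) (use B_in_chart [OF o] in \<open>auto intro!: continuous_intros continuous_lform\<close>)
  moreover have "winding fst ?d = 0" "winding snd ?d = 0"
    unfolding winding_chain_map o_def fst_conv snd_conv using w by simp_all
  ultimately have "bounds_in 1 (shell (K * \<delta>) e1) ?d"
    by (intro shell_cycle_bounds \<delta>_small shell_params)
  then have "bounds_in 1 (X \<delta>) (chain_map 1 F ?d)"
    by (rule bounds_map_in [OF _ F(1)]) (use F(2) in auto)
  moreover have "chain_map 1 F ?d = c"
  proof -
    have "chain_map 1 (F \<circ> ?f) c = c"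
    proof (rule chain_map_id_gen [OF cycle_in_imp_chain_in [OF c]])
      fix y assume "y \<in> topspace (top_of_set (B i j))"
      then have y: "y \<in> B i j" by simp
      then show "(F \<circ> ?f) y = y"
        using F(3) [OF _ B_in_chart [OF o y] B_neck(1) [OF y]] by (simp add: B_def)
    qed
    then show ?thesis by (simp add: chain_map_compose)
  qed
  ultimately show ?thesis by simp
qed

text \<open>The neck lies only between two shells, so it is not connected as a whole. Instead a
  point \<open>y\<close> in both the chart image and the far end mediates: the chart image joins
  \<open>x\<close> to \<open>y\<close>, and the end in core \<open>j\<close> joins \<open>y\<close>
  to \<open>x'\<close>.\<close>

lemma B_conn:
  assumes o: "(i,j) \<in> opairs n" and x: "x \<in> A e0 i \<inter> B i j" and x': "x' \<in> A e0 j \<inter> B i j"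
  shows "bounds_in 0 (B i j) (point_chain x' - point_chain x)"
proof -
  obtain F where F: "continuous_on (shell (K * \<delta>) e1) F"
    "\<And>x. x \<in> shell (K * \<delta>) e1 \<Longrightarrow> F x \<in> X \<delta> \<and> \<gamma> i j (F x) = fst x \<and> \<alpha> j (F x) = snd x \<and> norm (\<alpha> i (F x)) \<le> e2 * norm (fst x)"
    "\<And>y. y \<in> X \<delta> \<Longrightarrow> (\<gamma> i j y, \<alpha> j y) \<in> shell (K * \<delta>) e1 \<Longrightarrow> norm (\<alpha> i y) \<le> e2 * norm (\<gamma> i j y) \<Longrightarrow> F (\<gamma> i j y, \<alpha> j y) = y"
    using B_chart [OF o] by blast
  have oji: "(j,i) \<in> opairs n" using o by (auto simp: opairs_def)
  have e00: "e0 \<le> e0" "e0 \<le> 4 * e0" using pos by auto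
  note im = neck_image [OF o e00 F(2,3)]
  have sub: "shell (K' * \<delta>) e1 \<subseteq> shell (K * \<delta>) e1"
    using K_le_K' \<delta>0 by (intro shell_mono) auto
  have sub0: "shell e0 e1 \<subseteq> shell (K' * \<delta>) e1"
    using \<delta>_small by (intro shell_mono) auto
  let ?P = "F ` shell (K' * \<delta>) e1"
  have pc: "path_connected ?P"
    by (rule path_connected_continuous_image [OF continuous_on_subset [OF F(1) sub] path_connected_shell])
       (use \<delta>_small shell_params in auto)
  \<comment> \<open>The modulus of \<alpha>_j is twice the lower bound of the inner shell; the lower
    product estimate then forces |\<alpha>_i| to be at least \<open>8 * e0\<close>, deep enough for
    core \<open>j\<close>.\<close>
  define w :: "complex \<times> complex" where "w = (1, of_real (2 * K' * \<delta>))"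
  have nw: "norm (snd w) = 2 * K' * \<delta>" "norm (fst w) = 1"
    using pos \<delta>0 by (simp_all add: w_def norm_mult)
  have w: "w \<in> shell (K' * \<delta>) e1"
    unfolding shell_def using nw \<delta>0 \<delta>_small(1,6) smalls(6) shell_params pos by auto
  then have wK: "w \<in> shell (K * \<delta>) e1" using sub by blast
  define y where "y = F w"
  have yP: "y \<in> ?P" "y \<in> B i j" using w im(2) by (auto simp: y_def)
  have yg: "norm (\<gamma> i j y) = 1" "norm (\<alpha> j y) = 2 * K' * \<delta>" "y \<in> X \<delta>"
    using F(2) [OF wK] nw by (auto simp: y_def)
  have "\<delta> * 1 \<le> C^n * (norm (\<alpha> i y) * (2 * K' * \<delta>))"
    using neck_product(2) [OF o yg(3) B_neck [OF yP(2)] B_gamma [OF yP(2)]] yg by simp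
  then have "\<delta> * 1 \<le> \<delta> * (C^n * norm (\<alpha> i y) * (2 * K'))" by (simp add: algebra_simps)
  then have "1 \<le> C^n * norm (\<alpha> i y) * (2 * K')" using \<delta>0 by (simp only: mult_le_cancel_left_pos)
  then have "e1 * 1 \<le> e1 * (C^n * norm (\<alpha> i y) * (2 * K'))" using pos by (intro mult_left_mono) auto
  also have "\<dots> = (2 * (K' * e1) * C^n) * norm (\<alpha> i y)" by simp
  finally have "(2 * L * C^n) * (8 * e0) \<le> (2 * L * C^n) * norm (\<alpha> i y)"
    using e0_16 by (simp add: K'e1 algebra_simps)
  moreover have "2 * L * C^n > 0" using L1 Cpow by (intro mult_pos_pos) auto
  ultimately have "8 * e0 \<le> norm (\<alpha> i y)" by (simp only: mult_le_cancel_left_pos)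
  then have "e0 * norm (\<gamma> j i y) < norm (\<alpha> i y)" using yg pos by (simp add: g_sym [of j i])
  then have yA: "y \<in> A e0 j \<inter> B j i"
    unfolding neck_set [OF oji e00] using yP by (simp add: B_sym [of j i])
  have x'A: "x' \<in> A e0 j \<inter> B j i" using x' B_sym by blast
  have "bounds_in 0 (A e0 j \<inter> B j i) (point_chain x' - point_chain y)"
    using yA x'A by (intro aug_zero_bounds neck_path(1) [OF oji e00] singular_chain_diff point_chain_in) (auto simp: pt_eval_diff)
  then have 1: "bounds_in 0 (B i j) (point_chain x' - point_chain y)"
    by (rule bounds_in_mono) (auto simp: B_sym [of j i])
  have xP: "x \<in> ?P" using x im(1) sub0 by blast
  have "bounds_in 0 ?P (point_chain y - point_chain x)"
    using xP yP by (intro aug_zero_bounds pc singular_chain_diff point_chain_in) (auto simp: pt_eval_diff)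
  then have 2: "bounds_in 0 (B i j) (point_chain y - point_chain x)"
    by (rule bounds_in_mono [OF _ im(2)])
  show ?thesis using singular_relboundary_add [OF 1 2] by simp
qed

text \<open>The core is part of the graph of a small function \<sigma> over the hyperplane: the
  equation of the cone, read as \<alpha>_i = \<delta> G, is solved by contraction over a complement
  of tubes. \<open>\<pi>\<close> and \<open>\<iota>\<close> are coordinates on the hyperplane and
  its inclusion. Both claims are carried over from \<open>tube_complement\<close> by
  \<open>F\<close>.\<close>

lemma A_chart:
  assumes i: "i < n"
  shows A_inj: "cycle_in 1 (A e0 i) c \<Longrightarrow> (\<And>k. k < n \<Longrightarrow> k \<noteq> i \<Longrightarrow> winding (\<alpha> k) c = 0) \<Longrightarrow> bounds_in 1 (X \<delta>) c"
    and A_conn: "y \<in> A (4 * e0) i \<Longrightarrow> y' \<in> A (4 * e0) i \<Longrightarrow> bounds_in 0 (A e0 i) (point_chain y' - point_chain y)"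
proof -
  obtain h1 h2 v1 v2 v3 where fr: "frame C (a i) h1 h2 v1 v2 v3" using frame1 [OF i] by blast
  note co = frame_pt_coords [OF fr]
  define J where "J = {..<n} - {i}"
  have Jn: "J \<subseteq> {..<n}" "finite J" by (auto simp: J_def)
  have cJ: "n - card J = 1" using i by (simp add: J_def card_Diff_subset)
  have oik: "(i,k) \<in> opairs n" "k < n" if "k \<in> J" for k using that i by (auto simp: J_def opairs_def)
  define pt where "pt x s = frame_pt v1 v2 v3 s (fst x) (snd x)" for x s
  define \<iota> where "\<iota> x = pt x 0" for x
  define \<pi> where "\<pi> y = (lform h1 y, lform h2 y)" for y
  define N where "N x = norm (fst x) + norm (snd x)" for x :: "complex \<times> complex"
  define D where "D \<epsilon> = {x. x \<noteq> 0 \<and> (\<forall>k\<in>J. \<epsilon> * norm (\<gamma> i k (\<iota> x)) < norm (\<alpha> k (\<iota> x)))}" for \<epsilon>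
  have c: "\<alpha> i (pt x s) = s" "lform h1 (pt x s) = fst x" "lform h2 (pt x s) = snd x" for x s
    by (simp_all add: pt_def co)
  have \<pi>pt: "\<pi> (pt x s) = x" for x s by (simp add: \<pi>_def c)
  have pt\<pi>: "pt (\<pi> y) (\<alpha> i y) = y" for y by (simp add: pt_def \<pi>_def co)
  have \<iota>0: "\<alpha> i (\<iota> x) = 0" "\<pi> (\<iota> x) = x" for x by (simp_all add: \<iota>_def c \<pi>pt)
  have N0: "N x > 0" if "x \<noteq> 0" for x
    using that by (cases x) (auto simp: N_def zero_prod_def add_pos_nonneg add_nonneg_pos)
  have N\<pi>: "N (\<pi> y) \<le> 2 * C * norm y" for y
  proof -
    have "norm (lform h1 y) \<le> C * norm y" "norm (lform h2 y) \<le> C * norm y"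
      using fr unfolding frame_def by blast+
    then show ?thesis by (simp add: N_def \<pi>_def)
  qed
  have normN: "norm y \<le> C * (norm (\<alpha> i y) + N (\<pi> y))" for y
    using frame_norm(1) [OF fr, of y] by (simp add: N_def \<pi>_def add.assoc)
  have dist: "norm (\<alpha> k (pt x s) - \<alpha> k (\<iota> x)) \<le> C^2 * norm s" "norm (\<gamma> i k (pt x s) - \<gamma> i k (\<iota> x)) \<le> C^2 * norm s"
    if "k \<in> J" for k x s
  proof -
    have eq: "pt x s - \<iota> x = (s - 0) *s v1" unfolding \<iota>_def pt_def by (rule frame_pt_diff)
    have n: "norm (pt x s - \<iota> x) \<le> C * norm s"
      unfolding eq norm_vscale using frame_norm(2) [OF fr] mult_left_mono [of "norm v1" C "norm s"] by (simp add: mult.commute)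
    have "C * norm (pt x s - \<iota> x) \<le> C^2 * norm s"
      using mult_left_mono [OF n, of C] Cpow(2) by (simp add: power2_eq_square)
    then show "norm (\<alpha> k (pt x s) - \<alpha> k (\<iota> x)) \<le> C^2 * norm s" "norm (\<gamma> i k (pt x s) - \<gamma> i k (\<iota> x)) \<le> C^2 * norm s"
      using norm_alpha_le [OF oik(2) [OF that], of "pt x s - \<iota> x"] norm_gamma_le [OF oik(1) [OF that], of "pt x s - \<iota> x"]
      by (simp_all add: lform_diff)
  qed
  \<comment> \<open>On the hyperplane \<alpha>_i = 0, so \<open>est2\<close> bounds the norm by
    \<open>\<alpha> k\<close> and \<open>\<gamma> i k\<close>; outside the tube the latter is
    controlled by the former.\<close>
  have Dest: "\<epsilon> * N x \<le> 4 * C^2 * norm (\<alpha> k (\<iota> x))" if x: "x \<in> D \<epsilon>" and k: "k \<in> J" and \<epsilon>: "0 < \<epsilon>" "\<epsilon> \<le> 1" for x k \<epsilon>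
  proof -
    have "norm (\<iota> x) \<le> C * (norm (\<alpha> k (\<iota> x)) + norm (\<gamma> i k (\<iota> x)))"
      using est2 [OF oik(1) [OF k], of "\<iota> x"] \<iota>0 by simp
    then have "\<epsilon> * norm (\<iota> x) \<le> \<epsilon> * (C * (norm (\<alpha> k (\<iota> x)) + norm (\<gamma> i k (\<iota> x))))"
      using \<epsilon> by (intro mult_left_mono) auto
    also have "\<dots> = C * (\<epsilon> * norm (\<alpha> k (\<iota> x)) + \<epsilon> * norm (\<gamma> i k (\<iota> x)))" by (simp add: algebra_simps)
    also have "\<dots> \<le> C * (1 * norm (\<alpha> k (\<iota> x)) + norm (\<alpha> k (\<iota> x)))"
      using x k \<epsilon> Cpow(2) by (intro mult_left_mono add_mono mult_right_mono) (auto simp: D_def less_imp_le)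
    finally have "\<epsilon> * norm (\<iota> x) \<le> 2 * C * norm (\<alpha> k (\<iota> x))" by simp
    then have "2 * C * (\<epsilon> * norm (\<iota> x)) \<le> 2 * C * (2 * C * norm (\<alpha> k (\<iota> x)))"
      using Cpow(2) by (intro mult_left_mono) auto
    moreover have "\<epsilon> * N x \<le> \<epsilon> * (2 * C * norm (\<iota> x))"
      using N\<pi> [of "\<iota> x"] \<iota>0 \<epsilon> by (intro mult_left_mono) auto
    ultimately show ?thesis by (simp add: power2_eq_square algebra_simps)
  qed
  have Dmono: "D \<epsilon>' \<subseteq> D \<epsilon>" if "\<epsilon> \<le> \<epsilon>'" for \<epsilon> \<epsilon>'
  proof
    fix x assume x: "x \<in> D \<epsilon>'"
    have "\<epsilon> * norm (\<gamma> i k (\<iota> x)) \<le> \<epsilon>' * norm (\<gamma> i k (\<iota> x))" for k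
      using that by (intro mult_right_mono) auto
    then have "\<epsilon> * norm (\<gamma> i k (\<iota> x)) < t" if "\<epsilon>' * norm (\<gamma> i k (\<iota> x)) < t" for k t
      using that by (rule le_less_trans)
    then show "x \<in> D \<epsilon>" using x unfolding D_def by blast
  qed
  \<comment> \<open>Projection changes the widths of the tubes: \<open>P\<close> sends the core of
    width \<epsilon> into \<open>D (\<epsilon> / 2)\<close>, whereas \<open>S\<close> brings only
    \<open>D (2 * e0)\<close> back into \<open>A e0\<close>. The section is therefore built on the
    largest of these domains.\<close>
  let ?Z = "D (e0 / 2)"
  define \<rho> where "\<rho> x = \<eta>' * N x" for x
  define T where "T x s = of_real \<delta> * G J (pt x s)" for x s
  have Z0: "x \<noteq> 0" "N x > 0" if "x \<in> D \<epsilon>" for x \<epsilon> using that N0 by (auto simp: D_def)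
  \<comment> \<open>\<eta>' is chosen so that a displacement s with |s| \<le>
    \<open>\<rho> x\<close> alters \<open>\<alpha> k\<close> by at most half of its lower bound on
    the hyperplane.\<close>
  have low: "e0 / (16 * C^2) * N x \<le> norm (\<alpha> k (pt x s))" if "x \<in> ?Z" "norm s \<le> \<rho> x" "k \<in> J" for x s k
  proof -
    have "(e0 / 2) * N x \<le> 4 * C^2 * norm (\<alpha> k (\<iota> x))"
      using Dest [OF that(1,3)] pos smalls(5) by auto
    then have 1: "e0 / (8 * C^2) * N x \<le> norm (\<alpha> k (\<iota> x))"
      using Cpow(3) [of 2] by (simp add: field_simps)
    have "C^2 * norm s \<le> C^2 * (\<eta>' * N x)" using that(2) by (intro mult_left_mono) (auto simp: \<rho>_def)
    also have "\<dots> = e0 / (16 * C^2) * N x"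
      using Cpow(2) by (simp add: \<eta>'_eq power_numeral_reduce)
    finally have "norm (\<alpha> k (pt x s) - \<alpha> k (\<iota> x)) \<le> e0 / (16 * C^2) * N x"
      using dist(1) [OF that(3), of x s] by linarith
    moreover have "e0 / (8 * C^2) * N x = 2 * (e0 / (16 * C^2) * N x)" by simp
    ultimately show ?thesis using 1 norm_triangle_ineq2 [of "\<alpha> k (\<iota> x)" "\<alpha> k (pt x s)"]
      by (simp add: norm_minus_commute)
  qed
  have k0: "e0 / (16 * C^2) > 0" using pos Cpow by simp
  have nz: "\<alpha> k (pt x s) \<noteq> 0" if "x \<in> ?Z" "norm s \<le> \<rho> x" "k \<in> J" for x s k
  proof -
    have "e0 / (16 * C^2) * N x > 0" using Z0(2) [OF that(1)] k0 by (intro mult_pos_pos)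
    then show ?thesis using low [OF that] by auto
  qed
  \<comment> \<open>Scaling to \<open>N x = 1\<close> brings the points into the region of
    \<open>lipLA\<close>. \<open>J\<close> omits a single form, so \<open>G J\<close> is homogeneous
    of degree 1 and its Lipschitz constant is invariant under scaling.\<close>
  have est: "norm (G J (pt x s)) \<le> LA * N x"
    "norm (G J (pt x s) - G J (pt x s')) \<le> LA * norm (pt x s - pt x s')"
    if x: "x \<in> ?Z" "norm s \<le> \<rho> x" "norm s' \<le> \<rho> x" for x s s'
  proof -
    define t where "t = inverse (N x)"
    have t: "t > 0" "t * N x = 1" using Z0(2) [OF x(1)] by (auto simp: t_def)
    have sc: "norm (t *\<^sub>R pt x r) \<le> 2 * C \<and> (\<forall>k\<in>J. e0 / (16 * C^2) \<le> norm (\<alpha> k (t *\<^sub>R pt x r)))" if r: "norm r \<le> \<rho> x" for r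
    proof
      have "norm (pt x r) \<le> C * (norm r + N x)" using normN [of "pt x r"] by (simp add: c \<pi>pt)
      also have "\<dots> \<le> C * (2 * N x)"
      proof (rule mult_left_mono)
        have "\<eta>' * N x \<le> 1 * N x" using smalls(13) Z0(2) [OF x(1)] by (intro mult_right_mono) auto
        then show "norm r + N x \<le> 2 * N x" using r unfolding \<rho>_def by linarith
      qed (use C1 in simp)
      finally have "t * norm (pt x r) \<le> t * (C * (2 * N x))" using t by (intro mult_left_mono) auto
      also have "\<dots> = 2 * C * (t * N x)" by simp
      finally show "norm (t *\<^sub>R pt x r) \<le> 2 * C" using t by simp
      show "\<forall>k\<in>J. e0 / (16 * C^2) \<le> norm (\<alpha> k (t *\<^sub>R pt x r))"
      proof
        fix k assume k: "k \<in> J"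
        have "t * (e0 / (16 * C^2) * N x) \<le> t * norm (\<alpha> k (pt x r))"
          using low [OF x(1) r k] t by (intro mult_left_mono) auto
        moreover have "t * (e0 / (16 * C^2) * N x) = e0 / (16 * C^2)"
          using t(2) by (metis mult.commute mult.assoc mult.right_neutral)
        moreover have "norm (\<alpha> k (t *\<^sub>R pt x r)) = t * norm (\<alpha> k (pt x r))"
          using t by (simp add: lform_scaleR norm_mult)
        ultimately show "e0 / (16 * C^2) \<le> norm (\<alpha> k (t *\<^sub>R pt x r))"
          by linarith
      qed
    qed
    have scG: "G J (t *\<^sub>R z) = of_real t * G J z" for z
      using G_scale [OF t(1) Jn(1)] cJ by simp
    have "norm (G J (t *\<^sub>R pt x s)) \<le> LA"
      using lipLA sc [OF x(2)] Jn unfolding lip_bound_def by blast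
    then have "N x * (t * norm (G J (pt x s))) \<le> N x * LA"
      using t Z0(2) [OF x(1)] by (intro mult_left_mono) (auto simp: scG norm_mult)
    moreover have "N x * (t * norm (G J (pt x s))) = (t * N x) * norm (G J (pt x s))" by simp
    ultimately show "norm (G J (pt x s)) \<le> LA * N x" using t by (simp add: mult.commute)
    have "norm (G J (t *\<^sub>R pt x s) - G J (t *\<^sub>R pt x s')) \<le> LA * norm (t *\<^sub>R pt x s - t *\<^sub>R pt x s')"
      using lipLA sc [OF x(2)] sc [OF x(3)] Jn unfolding lip_bound_def by blast
    then have "t * norm (G J (pt x s) - G J (pt x s')) \<le> t * (LA * norm (pt x s - pt x s'))"
      unfolding scG right_diff_distrib [symmetric] scaleR_diff_right [symmetric] norm_mult norm_scaleR
      using t by (simp add: algebra_simps)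
    then show "norm (G J (pt x s) - G J (pt x s')) \<le> LA * norm (pt x s - pt x s')"
      using t by simp
  qed
  have LA\<delta>: "\<delta> * LA * C \<le> 1/2" "\<delta> * LA \<le> \<eta>' / 2"
  proof -
    show "\<delta> * LA * C \<le> 1/2" using d2 smalls(5,6) by (simp add: algebra_simps)
    have "\<eta> * 1 \<le> \<eta> * (2 * C)" using C1 pos by (intro mult_left_mono) auto
    then have "\<eta> \<le> \<eta>'" by (simp add: \<eta>'C mult.commute)
    moreover have "\<delta> * LA \<le> \<eta> / 2"
    proof (cases "\<delta> * LA \<le> 0")
      case False
      then have "1 * (\<delta> * LA) \<le> C * (\<delta> * LA)" using C1 by (intro mult_right_mono) auto
      moreover have "2 * (C * (\<delta> * LA)) < \<eta>" using d2 by (simp add: mult.assoc)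
      ultimately show ?thesis by linarith
    qed (use pos in auto)
    ultimately show "\<delta> * LA \<le> \<eta>' / 2" by linarith
  qed
  obtain \<sigma> where \<sigma>: "continuous_on ?Z \<sigma>" "\<And>z. z \<in> ?Z \<Longrightarrow> norm (\<sigma> z) \<le> \<rho> z" "\<And>z. z \<in> ?Z \<Longrightarrow> \<sigma> z = T z (\<sigma> z)"
    "\<And>z s. z \<in> ?Z \<Longrightarrow> norm s \<le> \<rho> z \<Longrightarrow> s = T z s \<Longrightarrow> s = \<sigma> z"
  proof (rule contraction_section [of ?Z \<rho> T])
    show "0 < \<rho> z" if "z \<in> ?Z" for z using Z0 [OF that] pos by (simp add: \<rho>_def)
    show "continuous_on ?Z \<rho>" unfolding \<rho>_def N_def by (intro continuous_intros)
    show "norm (T z s) \<le> \<rho> z / 2" if z: "z \<in> ?Z" "norm s \<le> \<rho> z" for z s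
    proof -
      have "norm (T z s) \<le> \<delta> * (LA * N z)"
        using est(1) [OF z z(2)] \<delta>0 by (simp add: T_def norm_mult)
      also have "\<dots> \<le> \<eta>' / 2 * N z"
        using mult_right_mono [OF LA\<delta>(2), of "N z"] Z0(2) [OF z(1)] by (simp add: algebra_simps)
      finally show ?thesis by (simp add: \<rho>_def)
    qed
    show "norm (T z s - T z t) \<le> norm (s - t) / 2" if z: "z \<in> ?Z" "norm s \<le> \<rho> z" "norm t \<le> \<rho> z" for z s t
    proof -
      have "norm (T z s - T z t) = \<delta> * norm (G J (pt z s) - G J (pt z t))"
        unfolding T_def right_diff_distrib [symmetric] norm_mult using \<delta>0 by simp
      also have "\<dots> \<le> \<delta> * (LA * norm (pt z s - pt z t))"
        using est(2) [OF z] \<delta>0 by (intro mult_left_mono) auto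
      also have "norm (pt z s - pt z t) = norm (s - t) * norm v1"
        unfolding pt_def frame_pt_diff norm_vscale ..
      also have "\<delta> * (LA * (norm (s - t) * norm v1)) \<le> \<delta> * (LA * (norm (s - t) * C))"
      proof -
        have "LA \<ge> 0"
          using order_trans [OF norm_ge_zero est(1) [OF z(1,2,2)]] Z0(2) [OF z(1)] by (simp add: zero_le_mult_iff)
        then show ?thesis
          using frame_norm(2) [OF fr] \<delta>0 by (intro mult_left_mono) auto
      qed
      also have "\<dots> = (\<delta> * LA * C) * norm (s - t)" by simp
      also have "\<dots> \<le> 1/2 * norm (s - t)" using LA\<delta>(1) by (intro mult_right_mono) auto
      finally show ?thesis by simp
    qed
    show "continuous (at z within ?Z) (\<lambda>w. T w s)" if z: "z \<in> ?Z" "norm s < \<rho> z" for z s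
    proof -
      have "continuous_on UNIV (\<lambda>w. pt w s)"
        unfolding pt_def by (intro continuous_frame_pt continuous_intros)
      then have "isCont (\<lambda>w. G J (pt w s)) z"
        using nz [OF z(1), of s] z(2) Jn by (intro isCont_G) auto
      then have "isCont (\<lambda>w. T w s) z"
        unfolding T_def by (intro continuous_intros)
      then show ?thesis by (rule continuous_at_imp_continuous_at_within)
    qed
  qed (rule that)
  have ptne: "pt x s \<noteq> 0" if "x \<noteq> 0" for x s
  proof
    assume "pt x s = 0"
    then have "x = \<pi> 0" using \<pi>pt by metis
    then show False using that by (simp add: \<pi>_def zero_prod_def)
  qed
  have pX: "pt x s \<in> X \<delta> \<longleftrightarrow> s = T x s" if "x \<in> ?Z" "norm s \<le> \<rho> x" for x s
    using X_iff_1 [OF i ptne [OF Z0(1) [OF that(1)]], of s] nz [OF that] by (simp add: c T_def J_def)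
  define F where "F x = pt x (\<sigma> x)" for x
  have Fcont: "continuous_on ?Z F"
    unfolding F_def pt_def by (intro continuous_frame_pt \<sigma>(1) continuous_intros)
  have FX: "F x \<in> X \<delta>" if "x \<in> ?Z" for x
    using pX [OF that] \<sigma>(2,3) [OF that] by (simp add: F_def)
  have Funiq: "F (\<pi> y) = y" if "y \<in> X \<delta>" "\<pi> y \<in> ?Z" "norm (\<alpha> i y) \<le> \<rho> (\<pi> y)" for y
  proof -
    have "\<alpha> i y = T (\<pi> y) (\<alpha> i y)" using pX [OF that(2,3)] that(1) by (simp add: pt\<pi>)
    then have "\<alpha> i y = \<sigma> (\<pi> y)" using \<sigma>(4) [OF that(2,3)] by blast
    then show ?thesis using pt\<pi> [of y] by (simp add: F_def)
  qed
  have P: "\<pi> y \<in> D (\<epsilon> / 2)" "norm (\<alpha> i y) \<le> \<rho> (\<pi> y)" "\<And>k. k \<in> J \<Longrightarrow> norm (\<alpha> k (\<iota> (\<pi> y)) - \<alpha> k y) < norm (\<alpha> k y)"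
    if y: "y \<in> A \<epsilon> i" and \<epsilon>: "e0 \<le> \<epsilon>" "\<epsilon> \<le> 1" for y \<epsilon>
  proof -
    have yX: "y \<in> X \<delta>" and ai: "norm (\<alpha> i y) < \<eta> * norm y" using y by (auto simp: A_def)
    have y0: "norm y > 0" using X_nz(1) [OF yX] by simp
    have "norm y \<le> C * norm (\<alpha> i y) + C * N (\<pi> y)" using normN [of y] by (simp add: algebra_simps)
    moreover have Cai: "C * norm (\<alpha> i y) \<le> 1/2 * norm y"
    proof -
      have "C * norm (\<alpha> i y) \<le> C * (\<eta> * norm y)" using ai Cpow(2) by (intro mult_left_mono) auto
      also have "\<dots> = (C * \<eta>) * norm y" by simp
      also have "\<dots> \<le> 1/2 * norm y" using smalls(14) by (intro mult_right_mono) auto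
      finally show ?thesis .
    qed
    ultimately have yN: "norm y \<le> 2 * C * N (\<pi> y)" by linarith
    have "\<eta> * norm y \<le> \<eta> * (2 * C * N (\<pi> y))" using yN pos by (intro mult_left_mono) auto
    then show r: "norm (\<alpha> i y) \<le> \<rho> (\<pi> y)" using ai by (simp add: \<rho>_def \<eta>'C algebra_simps)
    have \<pi>0: "\<pi> y \<noteq> 0"
    proof
      assume "\<pi> y = 0"
      then have "N (\<pi> y) = 0" by (simp add: N_def)
      then show False using yN y0 by simp
    qed
    \<comment> \<open>Outside the tubes |\<alpha>_k| is at least of order \<epsilon> times the norm,
      while |\<alpha>_i| is below \<eta> times the norm. As \<eta> is small against
      \<open>e0\<close>, projecting to the hyperplane moves \<open>\<alpha> k\<close> by at most an
      eighth of its modulus.\<close>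
    have key: "C^2 * norm (\<alpha> i y) \<le> norm (\<alpha> k y) / 8 \<and> \<epsilon> * norm (\<gamma> i k y) < norm (\<alpha> k y)" if k: "k \<in> J" for k
    proof -
      have gk: "\<epsilon> * norm (\<gamma> i k y) < norm (\<alpha> k y)" using y k by (auto simp: A_def J_def)
      have "norm y \<le> C * norm (\<alpha> i y) + C * (norm (\<alpha> k y) + norm (\<gamma> i k y))"
        using est2 [OF oik(1) [OF k], of y] by (simp add: algebra_simps)
      then have "norm y \<le> 2 * C * (norm (\<alpha> k y) + norm (\<gamma> i k y))" using Cai by linarith
      then have "\<epsilon> * norm y \<le> \<epsilon> * (2 * C * (norm (\<alpha> k y) + norm (\<gamma> i k y)))"
        using \<epsilon> pos by (intro mult_left_mono) auto
      also have "\<dots> = 2 * C * (\<epsilon> * norm (\<alpha> k y) + \<epsilon> * norm (\<gamma> i k y))" by (simp add: algebra_simps)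
      also have "\<dots> \<le> 2 * C * (1 * norm (\<alpha> k y) + norm (\<alpha> k y))"
        using gk \<epsilon> Cpow(2) by (intro mult_left_mono add_mono mult_right_mono) auto
      finally have ey: "\<epsilon> * norm y \<le> 4 * C * norm (\<alpha> k y)" by simp
      have "\<epsilon> * (C^2 * norm (\<alpha> i y)) \<le> \<epsilon> * (C^2 * (\<eta> * norm y))"
        using ai \<epsilon> pos by (intro mult_left_mono) auto
      also have "\<dots> = (C^2 * \<eta>) * (\<epsilon> * norm y)" by simp
      also have "\<dots> \<le> (C^2 * \<eta>) * (4 * C * norm (\<alpha> k y))" using ey pos by (intro mult_left_mono) auto
      also have "\<dots> = (4 * C^3 * \<eta>) * norm (\<alpha> k y)" by (simp add: power_numeral_reduce)
      also have "\<dots> \<le> (\<epsilon> / 8) * norm (\<alpha> k y)" using smalls(9) \<epsilon> by (intro mult_right_mono) auto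
      also have "\<dots> = \<epsilon> * (norm (\<alpha> k y) / 8)" by simp
      finally have "C^2 * norm (\<alpha> i y) \<le> norm (\<alpha> k y) / 8"
        using \<epsilon> pos by (simp only: mult_le_cancel_left_pos)
      with gk show ?thesis by blast
    qed
    have dd: "norm (\<alpha> k y - \<alpha> k (\<iota> (\<pi> y))) \<le> C^2 * norm (\<alpha> i y)" "norm (\<gamma> i k y - \<gamma> i k (\<iota> (\<pi> y))) \<le> C^2 * norm (\<alpha> i y)" if "k \<in> J" for k
      using dist [OF that, of "\<pi> y" "\<alpha> i y"] by (simp_all add: pt\<pi>)
    have a0: "norm (\<alpha> k y) > 0" if "k \<in> J" for k using X_nz(2) [OF yX] oik(2) [OF that] by simp
    show "norm (\<alpha> k (\<iota> (\<pi> y)) - \<alpha> k y) < norm (\<alpha> k y)" if "k \<in> J" for k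
      using dd(1) [OF that] key [OF that] a0 [OF that] norm_minus_commute [of "\<alpha> k (\<iota> (\<pi> y))" "\<alpha> k y"] by linarith
    have "(\<epsilon> / 2) * norm (\<gamma> i k (\<iota> (\<pi> y))) < norm (\<alpha> k (\<iota> (\<pi> y)))" if k: "k \<in> J" for k
    proof -
      have 1: "norm (\<gamma> i k (\<iota> (\<pi> y))) \<le> norm (\<gamma> i k y) + norm (\<alpha> k y) / 8"
        using dd(2) [OF k] key [OF k] norm_triangle_ineq2 [of "\<gamma> i k (\<iota> (\<pi> y))" "\<gamma> i k y"] by (simp add: norm_minus_commute)
      have 2: "norm (\<alpha> k y) * (7/8) \<le> norm (\<alpha> k (\<iota> (\<pi> y)))"
        using dd(1) [OF k] key [OF k] norm_triangle_ineq2 [of "\<alpha> k y" "\<alpha> k (\<iota> (\<pi> y))"] by linarith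
      have "\<epsilon> * norm (\<gamma> i k (\<iota> (\<pi> y))) \<le> \<epsilon> * (norm (\<gamma> i k y) + norm (\<alpha> k y) / 8)"
        using 1 \<epsilon> pos by (intro mult_left_mono) auto
      also have "\<dots> = \<epsilon> * norm (\<gamma> i k y) + \<epsilon> * (norm (\<alpha> k y) / 8)" by (simp add: algebra_simps)
      also have "\<dots> < norm (\<alpha> k y) + 1 * (norm (\<alpha> k y) / 8)"
        using key [OF k] \<epsilon> by (intro add_less_le_mono mult_right_mono) auto
      finally show ?thesis using 2 a0 [OF k] by linarith
    qed
    then show "\<pi> y \<in> D (\<epsilon> / 2)" using \<pi>0 by (simp add: D_def)
  qed
  \<comment> \<open>\<open>d2\<close> keeps \<open>\<alpha> i\<close> below \<eta> times the norm,
    and the tube condition loses less than the factor 2 between \<open>2 * e0\<close> and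
    \<open>e0\<close>.\<close>
  have S: "F x \<in> A e0 i" if x: "x \<in> D (2 * e0)" for x
  proof -
    have xZ: "x \<in> ?Z" using x Dmono [of "e0/2" "2 * e0"] pos by auto
    have N: "N x > 0" using Z0(2) [OF x] .
    define s where "s = \<sigma> x"
    have Fx: "F x = pt x s" by (simp add: F_def s_def)
    have y0: "norm (F x) > 0" using ptne [OF Z0(1) [OF x]] by (simp add: Fx)
    have "norm s = \<delta> * norm (G J (pt x s))"
      using \<sigma>(3) [OF xZ] \<delta>0 by (metis s_def T_def norm_mult norm_of_real abs_of_pos)
    also have "\<dots> \<le> \<delta> * (LA * N x)"
      using est(1) [OF xZ \<sigma>(2) [OF xZ] \<sigma>(2) [OF xZ]] \<delta>0 by (simp add: s_def)
    finally have s1: "norm s \<le> (\<delta> * LA) * N x" by simp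
    have "norm s \<le> (\<delta> * LA) * (2 * C * norm (F x))"
    proof -
      have "0 \<le> \<delta> * LA"
        using order_trans [OF norm_ge_zero s1] N by (simp add: zero_le_mult_iff)
      then have "(\<delta> * LA) * N x \<le> (\<delta> * LA) * (2 * C * norm (F x))"
        using N\<pi> [of "F x"] by (intro mult_left_mono) (auto simp: Fx \<pi>pt)
      then show ?thesis using s1 by linarith
    qed
    also have "\<dots> = (2 * C * \<delta> * LA) * norm (F x)" by simp
    also have "\<dots> < \<eta> * norm (F x)" using d2 y0 by (intro mult_strict_right_mono)
    finally have ai: "norm (\<alpha> i (F x)) < \<eta> * norm (F x)" by (simp add: Fx c)
    have "e0 * norm (\<gamma> i k (F x)) < norm (\<alpha> k (F x))" if k: "k \<in> J" for k
    proof -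
      define m where "m = norm (\<alpha> k (\<iota> x))"
      have gz: "2 * e0 * norm (\<gamma> i k (\<iota> x)) < m" using x k by (auto simp: D_def m_def)
      have "(2 * e0) * N x \<le> 4 * C^2 * m"
        unfolding m_def using Dest [OF x k] pos smalls(5) by auto
      then have Nm: "e0 * N x \<le> 2 * C^2 * m" by linarith
      have m0: "m > 0" using gz pos by (smt (verit) mult_nonneg_nonneg norm_ge_zero)
      have "2 * C * norm s \<le> 2 * C * ((\<delta> * LA) * N x)" using s1 Cpow(2) by (intro mult_left_mono) auto
      also have "\<dots> = (2 * C * \<delta> * LA) * N x" by simp
      also have "\<dots> \<le> \<eta> * N x" using d2 N by (intro mult_right_mono) auto
      finally have "C * (2 * C * norm s) \<le> C * (\<eta> * N x)" using Cpow(2) by (intro mult_left_mono) auto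
      then have "e0 * (2 * (C^2 * norm s)) \<le> e0 * (C * (\<eta> * N x))"
        using pos by (intro mult_left_mono) (auto simp: power2_eq_square algebra_simps)
      also have "\<dots> = (C * \<eta>) * (e0 * N x)" by simp
      also have "\<dots> \<le> (C * \<eta>) * (2 * C^2 * m)" using Nm pos Cpow(2) by (intro mult_left_mono) auto
      also have "\<dots> = (2 * C^3 * \<eta>) * m" by (simp add: power_numeral_reduce)
      also have "\<dots> \<le> (e0 / 16) * m" using smalls(9) m0 by (intro mult_right_mono) auto
      also have "\<dots> = e0 * (m / 16)" by simp
      finally have "2 * (C^2 * norm s) \<le> m / 16" using pos by (simp only: mult_le_cancel_left_pos)
      then have sm: "C^2 * norm s \<le> m / 32" by simp
      have 1: "norm (\<gamma> i k (F x)) \<le> norm (\<gamma> i k (\<iota> x)) + m / 32"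
        using dist(2) [OF k, of x s] sm norm_triangle_ineq2 [of "\<gamma> i k (F x)" "\<gamma> i k (\<iota> x)"] by (simp add: Fx)
      have 2: "m * (31/32) \<le> norm (\<alpha> k (F x))"
        using dist(1) [OF k, of x s] sm norm_triangle_ineq2 [of "\<alpha> k (\<iota> x)" "\<alpha> k (F x)"]
        by (simp add: Fx m_def norm_minus_commute)
      have "e0 * norm (\<gamma> i k (F x)) \<le> e0 * (norm (\<gamma> i k (\<iota> x)) + m / 32)"
        using 1 pos by (intro mult_left_mono) auto
      also have "\<dots> = (2 * e0 * norm (\<gamma> i k (\<iota> x))) / 2 + e0 * (m / 32)" by (simp add: algebra_simps)
      also have "\<dots> < m / 2 + 1 * (m / 32)"
        using gz smalls(5) m0 by (intro add_less_le_mono mult_right_mono) auto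
      finally show ?thesis using 2 m0 by linarith
    qed
    then show ?thesis using ai FX [OF xZ] by (simp add: A_def J_def)
  qed
  have \<iota>cont: "continuous_on S \<iota>" for S
    unfolding \<iota>_def pt_def by (intro continuous_frame_pt continuous_intros)
  have \<pi>cont: "continuous_on S \<pi>" for S
    unfolding \<pi>_def by (intro continuous_intros continuous_lform)
  have \<iota>\<pi>: "\<iota> (\<pi> z) = z" if "\<alpha> i z = 0" for z
    using pt\<pi> [of z] that by (simp add: \<iota>_def)
  have "\<exists>w1 w2 w3. frame C (a i) (a k) (g i k) w1 w2 w3" if "k \<in> J" for k
    using frame2 [OF oik(1) [OF that]] .
  then obtain w1 w2 w3 where fk: "\<And>k. k \<in> J \<Longrightarrow> frame C (a i) (a k) (g i k) (w1 k) (w2 k) (w3 k)"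
    by metis
  \<comment> \<open>Inverse of the linear coordinates \<open>\<gamma> i k\<close>,
    \<open>\<alpha> k\<close> on the hyperplane, as required by
    \<open>tube_complement\<close>.\<close>
  define \<phi> where "\<phi> k y = \<pi> (frame_pt (w1 k) (w2 k) (w3 k) 0 (snd y) (fst y))" for k y
  have tube1: "cycle_in 1 (D \<epsilon>) b \<Longrightarrow> (\<And>k. k \<in> J \<Longrightarrow> winding (\<lambda>x. \<alpha> k (\<iota> x)) b = 0) \<Longrightarrow> bounds_in 1 (D \<epsilon>) b"
    and tube0: "chain_in 0 (D \<epsilon>) z \<Longrightarrow> aug z = 0 \<Longrightarrow> bounds_in 0 (D \<epsilon>) z"
    if \<epsilon>: "0 < \<epsilon>" "\<epsilon> < e1" for \<epsilon> b z
  proof -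
    note coords = frame_pt_coords [OF fk]
    have inv: "\<phi> k (\<gamma> i k (\<iota> x), \<alpha> k (\<iota> x)) = x" if "k \<in> J" for k x
      using coords(4) [OF that, of "\<iota> x"] by (simp add: \<phi>_def \<iota>0)
    have \<iota>\<phi>: "\<iota> (\<phi> k y) = frame_pt (w1 k) (w2 k) (w3 k) 0 (snd y) (fst y)" if "k \<in> J" for k y
      unfolding \<phi>_def by (rule \<iota>\<pi>) (simp add: coords(1) [OF that])
    have inv2: "\<gamma> i k (\<iota> (\<phi> k y)) = fst y" "\<alpha> k (\<iota> (\<phi> k y)) = snd y" if "k \<in> J" for k y
      by (simp_all add: \<iota>\<phi> [OF that] coords [OF that])
    have cont: "continuous_on S (\<lambda>x. \<alpha> k (\<iota> x))" "continuous_on S (\<lambda>x. \<gamma> i k (\<iota> x))" "continuous_on S (\<phi> k)" for k S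
      unfolding \<phi>_def
      by (auto intro!: continuous_on_compose2 [OF continuous_lform [of UNIV] \<iota>cont] continuous_on_compose2 [OF \<pi>cont [of UNIV]]
          continuous_frame_pt continuous_intros)
    have zero: "\<alpha> k (\<iota> 0) = 0" "\<gamma> i k (\<iota> 0) = 0" for k
      by (simp_all add: \<iota>_def pt_def frame_pt_def)
    \<comment> \<open>On the hyperplane \<alpha>_i = 0 counts as the third small form, so a common
      point of two tubes would be the origin, where the strict inequalities fail.\<close>
    have disj: False if kl: "k \<in> J" "l \<in> J" "k \<noteq> l" "norm (\<alpha> k (\<iota> x)) < e1 * norm (\<gamma> i k (\<iota> x))"
      "norm (\<alpha> l (\<iota> x)) < e1 * norm (\<gamma> i l (\<iota> x))" for k l x
    proof -
      have "e1 * norm (\<gamma> i k (\<iota> x)) \<le> e1 * (C * norm (\<iota> x))" "e1 * norm (\<gamma> i l (\<iota> x)) \<le> e1 * (C * norm (\<iota> x))"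
        using norm_gamma_le oik kl pos by (auto intro!: mult_left_mono)
      then have "norm (\<alpha> k (\<iota> x)) \<le> C * e1 * norm (\<iota> x)" "norm (\<alpha> l (\<iota> x)) \<le> C * e1 * norm (\<iota> x)"
        using kl(4,5) by (simp_all add: mult.assoc mult.left_commute [of e1])
      then have "\<iota> x = 0"
        using kl(1-3) i pos Cpow(2) by (intro three_small [of i k l]) (auto simp: \<iota>0 J_def)
      then show False using kl by simp
    qed
    show "bounds_in 1 (D \<epsilon>) b" if "cycle_in 1 (D \<epsilon>) b" "\<And>k. k \<in> J \<Longrightarrow> winding (\<lambda>x. \<alpha> k (\<iota> x)) b = 0"
      unfolding D_def
      by (rule tube_complement_H1 [where \<beta> = "\<lambda>k x. \<alpha> k (\<iota> x)" and \<gamma> = "\<lambda>k x. \<gamma> i k (\<iota> x)" and \<phi> = \<phi> and \<epsilon>' = e1];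
          (rule Jn(2) \<epsilon> cont zero | rule inv inv2 that, assumption
            | rule disj, assumption, assumption, assumption, assumption, assumption | rule that [unfolded D_def]))
    show "bounds_in 0 (D \<epsilon>) z" if "chain_in 0 (D \<epsilon>) z" "aug z = 0"
      unfolding D_def
      by (rule tube_complement_H0 [where \<beta> = "\<lambda>k x. \<alpha> k (\<iota> x)" and \<gamma> = "\<lambda>k x. \<gamma> i k (\<iota> x)" and \<phi> = \<phi> and \<epsilon>' = e1];
          (rule Jn(2) \<epsilon> cont zero | rule inv inv2 that, assumption
            | rule disj, assumption, assumption, assumption, assumption, assumption | rule that [unfolded D_def]))
  qed
  have e01: "e0 \<le> 1" "4 * e0 \<le> 1" "e0 \<le> 4 * e0" using pos smalls(5) by linarith+
  show "bounds_in 1 (X \<delta>) c" if cy: "cycle_in 1 (A e0 i) c" and w: "\<And>k. k < n \<Longrightarrow> k \<noteq> i \<Longrightarrow> winding (\<alpha> k) c = 0"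
  proof -
    have AX: "A e0 i \<subseteq> X \<delta>" by (auto simp: A_def)
    have \<pi>A: "\<pi> ` A e0 i \<subseteq> ?Z" using P(1) [OF _ _ e01(1)] by auto
    let ?d = "chain_map 1 \<pi> c"
    have "cycle_in 1 ?Z ?d" by (rule cycle_map_in [OF cy \<pi>cont \<pi>A])
    moreover have "winding (\<lambda>x. \<alpha> k (\<iota> x)) ?d = 0" if k: "k \<in> J" for k
    proof -
      have "winding (\<lambda>x. \<alpha> k (\<iota> x)) ?d = winding (\<lambda>y. \<alpha> k (\<iota> (\<pi> y))) c"
        unfolding winding_chain_map o_def ..
      \<comment> \<open>By \<open>P\<close> the projection changes \<open>\<alpha> k\<close> by less
        than its modulus.\<close>
      also have "\<dots> = winding (\<alpha> k) c"
        using P(3) [OF _ _ e01(1) k]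
        by (intro winding_near [OF cy] continuous_lform continuous_on_compose2 [OF continuous_lform [of UNIV]]
            continuous_on_compose2 [OF \<iota>cont [of UNIV] \<pi>cont]) auto
      finally show ?thesis using w k by (auto simp: J_def)
    qed
    ultimately have "bounds_in 1 ?Z ?d"
      by (intro tube1) (use shell_params pos in auto)
    then have "bounds_in 1 (X \<delta>) (chain_map 1 F ?d)"
      by (rule bounds_map_in [OF _ Fcont]) (use FX in auto)
    moreover have "chain_map 1 F ?d = c"
    proof -
      have "chain_map 1 (F \<circ> \<pi>) c = c"
      proof (rule chain_map_id_gen [OF cycle_in_imp_chain_in [OF cy]])
        fix y assume "y \<in> topspace (top_of_set (A e0 i))"
        then have y: "y \<in> A e0 i" by simp
        then show "(F \<circ> \<pi>) y = y"
          using Funiq [of y] P(1,2) [OF y _ e01(1)] AX by auto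
      qed
      then show ?thesis by (simp add: chain_map_compose)
    qed
    ultimately show ?thesis by simp
  qed
  show "bounds_in 0 (A e0 i) (point_chain y' - point_chain y)" if y: "y \<in> A (4 * e0) i" and y': "y' \<in> A (4 * e0) i"
  proof -
    have h: "\<pi> z \<in> D (2 * e0)" "F (\<pi> z) = z" if z: "z \<in> A (4 * e0) i" for z
    proof -
      show 1: "\<pi> z \<in> D (2 * e0)" using P(1) [OF z e01(3,2)] by simp
      have "\<pi> z \<in> ?Z" using 1 Dmono [of "e0/2" "2 * e0"] pos by auto
      then show "F (\<pi> z) = z"
        using Funiq P(2) [OF z e01(3,2)] z by (auto simp: A_def)
    qed
    have "bounds_in 0 (D (2 * e0)) (point_chain (\<pi> y') - point_chain (\<pi> y))"
      using h(1) [OF y] h(1) [OF y'] shell_params e0_small pos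
      by (intro tube0 singular_chain_diff point_chain_in) (auto simp: pt_eval_diff)
    then have "bounds_in 0 (A e0 i) (chain_map 0 F (point_chain (\<pi> y') - point_chain (\<pi> y)))"
      using S Dmono [of "e0/2" "2 * e0"] pos
      by (intro bounds_map_in [where S = "D (2 * e0)"] continuous_on_subset [OF Fcont]) auto
    then show ?thesis
      by (simp add: chain_map_diff chain_map_point_chain h y y')
  qed
qed

lemma neck_decomposition:
  "neck_decomposition n (X \<delta>) (A e0) B \<alpha> \<gamma> (\<lambda>i j. SOME y. y \<in> A (4 * e0) i \<inter> B i j)"
proof -
  let ?x = "\<lambda>i j. SOME y. y \<in> A (4 * e0) i \<inter> B i j"
  have e: "e0 \<le> e0" "e0 \<le> 4 * e0" "4 * e0 \<le> 4 * e0" using pos by auto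
  have x: "?x i j \<in> A (4 * e0) i \<inter> B i j" if "(i,j) \<in> opairs n" for i j
    using neck_path(2) [OF that e(2,3)] by (meson all_not_in_conv someI_ex)
  then have x0: "?x i j \<in> A e0 i \<inter> B i j" if "(i,j) \<in> opairs n" for i j
    using that A_mono [OF e(2)] by blast
  show ?thesis
  proof
    show "bounds_in 0 (A e0 i) (point_chain (?x i k) - point_chain (?x i j))" if "(i,j) \<in> opairs n" "(i,k) \<in> opairs n" for i j k
      using A_conn [of i "?x i j" "?x i k"] x [OF that(1)] x [OF that(2)] that by (auto simp: opairs_def)
    show "bounds_in 0 (B i j) (point_chain (?x j i) - point_chain (?x i j))" if "(i,j) \<in> opairs n" for i j
    proof (rule B_conn [OF that x0 [OF that]])
      have "(j,i) \<in> opairs n" using that by (auto simp: opairs_def)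
      then show "?x j i \<in> A e0 j \<inter> B i j" using x0 [of j i] B_sym [of i j] by simp
    qed
    show "\<gamma> i j = \<gamma> j i" for i j by (simp add: g_sym [of i j])
  qed (use continuous_lform X_nz B_gamma A_open B_open B_sym cover A_disj B_disj AB_disj neck_path(1) [OF _ e(1,2)]
      neck_loop wind_neck wind_sum A_inj B_inj x0 in \<open>auto simp del: One_nat_def\<close>)
qed

end

section \<open>Generic arrangements\<close>

text \<open>Taken without conjugation, so that it is complex bilinear and
  \<open>lform u (ccross v w)\<close> is the determinant of the three vectors.\<close>

definition ccross :: "complex^3 \<Rightarrow> complex^3 \<Rightarrow> complex^3"
  where "ccross u v = vector [u$2 * v$3 - u$3 * v$2, u$3 * v$1 - u$1 * v$3, u$1 * v$2 - u$2 * v$1]"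

text \<open>\<open>lform (vcnj v) v\<close> is the squared norm of \<open>v\<close>. Hence
  \<open>vcnj (ccross u v)\<close> is independent of \<open>u\<close> and \<open>v\<close> whenever
  these are independent of each other.\<close>

definition vcnj :: "complex^3 \<Rightarrow> complex^3"
  where "vcnj v = (\<chi> k. cnj (v$k))"

lemma ccross_nth [simp]:
  "ccross u v $ 1 = u$2 * v$3 - u$3 * v$2"
  "ccross u v $ 2 = u$3 * v$1 - u$1 * v$3"
  "ccross u v $ 3 = u$1 * v$2 - u$2 * v$1"
  by (simp_all add: ccross_def)

lemma lform_3: "lform u x = u$1 * x$1 + u$2 * x$2 + u$3 * x$3"
  by (simp add: lform_def sum_3)

lemma lform_ccross:
  "lform u (ccross u v) = 0" "lform v (ccross u v) = 0"
  "lform v (ccross w u) = lform u (ccross v w)" "lform w (ccross u v) = lform u (ccross v w)"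
  by (simp_all add: lform_3 algebra_simps)

text \<open>Cramer's rule, multiplied by the determinant.\<close>

lemma cramer_expansion:
  "lform u (ccross v w) *s y = lform u y *s ccross v w + lform v y *s ccross w u + lform w y *s ccross u v"
  by (simp add: vec_eq_iff forall_3 lform_3 algebra_simps)

lemma norm_lform_le: "norm (lform u y) \<le> (norm (u$1) + norm (u$2) + norm (u$3)) * norm y"
proof -
  have "norm (lform u y) \<le> norm (u$1 * y$1) + norm (u$2 * y$2) + norm (u$3 * y$3)"
    unfolding lform_3 by (intro order_trans [OF norm_triangle_ineq] add_mono norm_triangle_ineq order_refl)
  also have "\<dots> \<le> norm (u$1) * norm y + norm (u$2) * norm y + norm (u$3) * norm y"
    unfolding norm_mult by (intro add_mono mult_left_mono Finite_Cartesian_Product.norm_nth_le norm_ge_zero)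
  finally show ?thesis by (simp add: algebra_simps)
qed

text \<open>Stated for all large \<open>C\<close>, since finitely many such statements combine into
  one constant for the whole arrangement.\<close>

lemma eventually_frame:
  assumes D: "lform u (ccross v w) \<noteq> 0"
  shows "\<forall>\<^sub>F C in at_top. \<exists>e1 e2 e3. frame C u v w e1 e2 e3"
proof -
  define D where "D = lform u (ccross v w)"
  define e1 where "e1 = (1/D) *s ccross v w"
  define e2 where "e2 = (1/D) *s ccross w u"
  define e3 where "e3 = (1/D) *s ccross u v"
  have D0: "D \<noteq> 0" using D by (simp add: D_def)
  have dual: "lform u e1 = 1 \<and> lform v e1 = 0 \<and> lform w e1 = 0 \<and> lform u e2 = 0 \<and> lform v e2 = 1 \<and> lform w e2 = 0 \<and>
    lform u e3 = 0 \<and> lform v e3 = 0 \<and> lform w e3 = 1"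
    using D0 lform_ccross(3,4) [where u = u and v = v and w = w]
    by (simp add: e1_def e2_def e3_def lform_scale lform_ccross(1,2) D_def)
  have y: "y = lform u y *s e1 + lform v y *s e2 + lform w y *s e3" for y
  proof -
    have "y = (1/D) *s (D *s y)" using D0 by simp
    also have "\<dots> = lform u y *s e1 + lform v y *s e2 + lform w y *s e3"
      unfolding D_def cramer_expansion
      by (simp add: e1_def e2_def e3_def D_def vector_add_ldistrib mult.commute)
    finally show ?thesis .
  qed
  define S where "S u = norm (u$1) + norm (u$2) + norm (u$3)" for u :: "complex^3"
  have S0: "S u \<ge> 0" for u by (simp add: S_def)
  define m where "m = S u + S v + S w + norm e1 + norm e2 + norm e3"
  show ?thesis
    using eventually_ge_at_top [of m]
  proof eventually_elim
    case (elim C)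
    have le: "S u \<le> C" "S v \<le> C" "S w \<le> C" "norm e1 \<le> C" "norm e2 \<le> C" "norm e3 \<le> C"
      using elim S0 [of u] S0 [of v] S0 [of w] norm_ge_zero [of e1] norm_ge_zero [of e2] norm_ge_zero [of e3]
      unfolding m_def by linarith+
    have "norm (lform z y) \<le> C * norm y" if "S z \<le> C" for z y
      using norm_lform_le [of z y] mult_right_mono [OF that norm_ge_zero [of y]] by (simp add: S_def)
    moreover have "norm y \<le> C * (norm (lform u y) + norm (lform v y) + norm (lform w y))" for y
    proof -
      have "norm y \<le> norm (lform u y *s e1) + norm (lform v y *s e2) + norm (lform w y *s e3)"
        by (subst y) (intro order_trans [OF norm_triangle_ineq] add_mono norm_triangle_ineq order_refl)
      also have "\<dots> \<le> norm (lform u y) * C + norm (lform v y) * C + norm (lform w y) * C"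
        unfolding norm_vscale using le by (intro add_mono mult_left_mono) auto
      finally show ?thesis by (simp add: algebra_simps)
    qed
    ultimately have "frame C u v w e1 e2 e3"
      using dual le unfolding frame_def by blast
    then show ?case by blast
  qed
qed

lemma lform_vcnj: "lform (vcnj v) v = 0 \<longleftrightarrow> v = 0"
proof -
  have "lform (vcnj v) v = of_real ((norm (v$1))\<^sup>2 + (norm (v$2))\<^sup>2 + (norm (v$3))\<^sup>2)"
    by (simp add: lform_3 vcnj_def complex_norm_square mult.commute del: of_real_power)
  then have "lform (vcnj v) v = 0 \<longleftrightarrow> (norm (v$1))\<^sup>2 + (norm (v$2))\<^sup>2 + (norm (v$3))\<^sup>2 = 0"
    by (simp only: of_real_eq_0_iff)
  also have "\<dots> \<longleftrightarrow> v = 0"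
    by (auto simp: add_nonneg_eq_0_iff vec_eq_iff forall_3)
  finally show ?thesis .
qed

lemma ccross_eq_0:
  assumes uv: "ccross u v = 0" and 0: "u \<noteq> 0" "v \<noteq> 0"
  shows "hyp u = hyp v"
proof -
  have eq: "u$2 * v$3 = u$3 * v$2" "u$3 * v$1 = u$1 * v$3" "u$1 * v$2 = u$2 * v$1"
    using uv by (simp_all add: vec_eq_iff forall_3)
  have *: "u$1 * lform v x = v$1 * lform u x \<and> u$2 * lform v x = v$2 * lform u x \<and> u$3 * lform v x = v$3 * lform u x" for x
  proof -
    have "u$1 * lform v x - v$1 * lform u x = (u$1 * v$2 - u$2 * v$1) * x$2 - (u$3 * v$1 - u$1 * v$3) * x$3"
      "u$2 * lform v x - v$2 * lform u x = (u$2 * v$3 - u$3 * v$2) * x$3 - (u$1 * v$2 - u$2 * v$1) * x$1"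
      "u$3 * lform v x - v$3 * lform u x = (u$3 * v$1 - u$1 * v$3) * x$1 - (u$2 * v$3 - u$3 * v$2) * x$2"
      by (simp_all add: lform_3 algebra_simps)
    then show ?thesis using eq by simp
  qed
  have "lform v x = 0 \<longleftrightarrow> lform u x = 0" for x
    using 0 * [of x] by (auto simp: vec_eq_iff forall_3)
  then show ?thesis by (simp add: hyp_def)
qed

lemma ccross_nonzero_exists:
  assumes "u \<noteq> 0" obtains v where "ccross u v \<noteq> 0"
proof -
  have "ccross u (axis 1 1) $ 2 = u$3" "ccross u (axis 2 1) $ 3 = u$1" "ccross u (axis 3 1) $ 1 = u$2"
    by (simp_all add: axis_def)
  moreover have "u$1 \<noteq> 0 \<or> u$2 \<noteq> 0 \<or> u$3 \<noteq> 0"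
    using assms by (simp add: vec_eq_iff forall_3)
  ultimately have "\<exists>v. ccross u v \<noteq> 0" by (metis zero_index)
  with that show ?thesis by blast
qed

lemma ccross_vcnj: "lform u (ccross v (vcnj (ccross u v))) = 0 \<longleftrightarrow> ccross u v = 0"
  by (metis lform_vcnj lform_ccross(4))

lemma ccross_commute: "ccross v u = - ccross u v"
  by (simp add: vec_eq_iff forall_3)

text \<open>\<open>dim\<close> is the real dimension, hence the value 2, in accordance with
  \<open>L2\<close>.\<close>

lemma dim_complex_line:
  fixes v :: "complex^3"
  assumes "v \<noteq> 0"
  shows "dim (range (\<lambda>c. c *s v)) = 2"
proof -
  have "linear (\<lambda>c::complex. c *s v)"
    by (rule linearI) (simp_all add: vec_eq_iff algebra_simps)
  moreover have "inj_on (\<lambda>c::complex. c *s v) (span UNIV)"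
    using assms by (auto simp: inj_on_def vec_eq_iff)
  ultimately have "dim (range (\<lambda>c. c *s v)) = dim (UNIV :: complex set)"
    by (rule dim_image_eq)
  then show ?thesis by simp
qed

lemma hyp_Int_line:
  assumes "ccross u v \<noteq> 0"
  shows "hyp u \<inter> hyp v = range (\<lambda>c. c *s ccross u v)"
proof
  let ?w = "vcnj (ccross u v)"
  show "hyp u \<inter> hyp v \<subseteq> range (\<lambda>c. c *s ccross u v)"
  proof
    fix y assume "y \<in> hyp u \<inter> hyp v"
    define D where "D = lform u (ccross v ?w)"
    have D: "D \<noteq> 0" using assms ccross_vcnj [of u v] by (simp add: D_def)
    have "D *s y = lform ?w y *s ccross u v"
      using cramer_expansion [of u v ?w y] \<open>y \<in> _\<close> by (simp add: hyp_def D_def)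
    then have "(1/D) *s (D *s y) = (1/D) *s (lform ?w y *s ccross u v)" by simp
    then have "y = (lform ?w y / D) *s ccross u v" using D by simp
    then show "y \<in> range (\<lambda>c. c *s ccross u v)" by blast
  qed
qed (auto simp: hyp_def lform_scale lform_ccross)

text \<open>If the three forms were dependent, the third hyperplane would contain the line common to
  the other two, and this member of \<open>L2\<close> would lie on three hyperplanes.\<close>

lemma generic_independent:
  assumes "central_arrangement n a" "generic_arrangement n a"
    and ijk: "i < n" "j < n" "k < n" "i \<noteq> j" "i \<noteq> k" "j \<noteq> k"
  shows "lform (a i) (ccross (a j) (a k)) \<noteq> 0"
proof
  assume 0: "lform (a i) (ccross (a j) (a k)) = 0"
  have v: "ccross (a i) (a j) \<noteq> 0"
    using assms ccross_eq_0 [of "a i" "a j"] by (auto simp: central_arrangement_def)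
  let ?X = "hyp (a i) \<inter> hyp (a j)"
  have "?X \<in> L2 n a"
    unfolding L2_def using ijk dim_complex_line [OF v] hyp_Int_line [OF v]
    by (intro CollectI exI [of _ "{i,j}"]) auto
  then have "card {m. m < n \<and> ?X \<subseteq> hyp (a m)} = 2"
    using assms(2) by (simp add: generic_arrangement_def)
  moreover have "?X \<subseteq> hyp (a k)"
    unfolding hyp_Int_line [OF v] using 0 by (auto simp: hyp_def lform_scale lform_ccross(4))
  then have "card {i,j,k} \<le> card {m. m < n \<and> ?X \<subseteq> hyp (a m)}"
    using ijk by (intro card_mono) auto
  ultimately show False using ijk by simp
qed

lemma lines_exists:
  assumes "central_arrangement n a" "generic_arrangement n a"
  obtains g C where "lines n a g C"
proof -
  \<comment> \<open>Ordering the indices makes \<open>g\<close> symmetric; the cross product alone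
    would change sign.\<close>
  define g where "g i j = vcnj (ccross (a (min i j)) (a (max i j)))" for i j
  have nz: "a i \<noteq> 0" if "i < n" for i
    using assms that by (auto simp: central_arrangement_def)
  have "\<forall>\<^sub>F C in at_top. \<exists>e1 e2 e3. frame C (a (fst p)) (a (snd p)) (g (fst p) (snd p)) e1 e2 e3" if p: "p \<in> opairs n" for p
  proof (rule eventually_frame)
    obtain i j where ij: "p = (i,j)" "i < n" "j < n" "i \<noteq> j" using p by (auto simp: opairs_def)
    let ?c = "\<lambda>i j. ccross (a i) (a j)"
    have nc: "?c i j \<noteq> 0"
      using assms ij nz ccross_eq_0 [of "a i" "a j"] by (auto simp: central_arrangement_def)
    have "lform (g i j) (?c i j) \<noteq> 0"
    proof (cases "i < j")
      case True
      then show ?thesis using nc by (simp add: g_def lform_vcnj)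
    next
      case False
      then have "g i j = vcnj (?c j i)" using ij by (simp add: g_def min_def max_def)
      then have "lform (g i j) (?c j i) \<noteq> 0"
        using nc by (simp add: lform_vcnj ccross_commute [of "a j" "a i"] del: vector_minus_component)
      then show ?thesis
        using ccross_commute [of "a i" "a j"] lform_diff [of "g i j" 0 "?c j i"] by simp
    qed
    then show "lform (a (fst p)) (ccross (a (snd p)) (g (fst p) (snd p))) \<noteq> 0"
      by (simp add: ij lform_ccross(4))
  qed
  then have 1: "\<forall>\<^sub>F C in at_top. \<forall>p\<in>opairs n. \<exists>e1 e2 e3. frame C (a (fst p)) (a (snd p)) (g (fst p) (snd p)) e1 e2 e3"
    by (intro eventually_ball_finite) auto
  have "\<forall>\<^sub>F C in at_top. \<exists>h1 h2 e1 e2 e3. frame C (a i) h1 h2 e1 e2 e3" if i: "i < n" for i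
  proof -
    obtain v where "ccross (a i) v \<noteq> 0" using ccross_nonzero_exists nz [OF i] by blast
    then have "\<forall>\<^sub>F C in at_top. \<exists>e1 e2 e3. frame C (a i) v (vcnj (ccross (a i) v)) e1 e2 e3"
      by (intro eventually_frame) (simp add: ccross_vcnj)
    then show ?thesis by (rule eventually_mono) blast
  qed
  then have 2: "\<forall>\<^sub>F C in at_top. \<forall>i\<in>{..<n}. \<exists>h1 h2 e1 e2 e3. frame C (a i) h1 h2 e1 e2 e3"
    by (intro eventually_ball_finite) auto
  define T where "T = {t \<in> {..<n} \<times> {..<n} \<times> {..<n}. fst t \<noteq> fst (snd t) \<and> fst t \<noteq> snd (snd t) \<and> fst (snd t) \<noteq> snd (snd t)}"
  have "\<forall>\<^sub>F C in at_top. \<exists>e1 e2 e3. frame C (a (fst t)) (a (fst (snd t))) (a (snd (snd t))) e1 e2 e3" if "t \<in> T" for t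
    using that by (intro eventually_frame generic_independent [OF assms]) (auto simp: T_def)
  then have 3: "\<forall>\<^sub>F C in at_top. \<forall>t\<in>T. \<exists>e1 e2 e3. frame C (a (fst t)) (a (fst (snd t))) (a (snd (snd t))) e1 e2 e3"
    by (intro eventually_ball_finite) (auto simp: T_def)
  have "\<forall>\<^sub>F C in at_top. lines n a g C"
    using 1 2 3 eventually_ge_at_top [of 1]
  proof eventually_elim
    case (elim C)
    show ?case
    proof
      show "C \<ge> 1" by (rule elim)
      show "g i j = g j i" for i j by (simp add: g_def min.commute max.commute)
      show "\<exists>e1 e2 e3. frame C (a i) (a j) (g i j) e1 e2 e3" if "(i,j) \<in> opairs n" for i j
        using bspec [OF elim(1) that] by simp
      show "\<exists>h1 h2 e1 e2 e3. frame C (a i) h1 h2 e1 e2 e3" if "i < n" for i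
        using elim(2) that by blast
      show "norm y \<le> C * (norm (lform (a i) y) + norm (lform (a j) y) + norm (lform (a k) y))"
        if "i < n" "j < n" "k < n" "i \<noteq> j" "i \<noteq> k" "j \<noteq> k" for i j k y
      proof -
        have "(i,j,k) \<in> T" using that by (simp add: T_def)
        from bspec [OF elim(3) this] show ?thesis unfolding frame_def by auto
      qed
    qed
  qed
  with that eventually_happens' [OF trivial_limit_at_top_linorder] show ?thesis by blast
qed

lemma (in lines) conic_homology:
  assumes n: "n \<ge> 1"
  obtains \<delta>0 where "\<delta>0 > 0" "\<And>\<delta>. 0 < \<delta> \<Longrightarrow> \<delta> < \<delta>0 \<Longrightarrow>
    homology_group 1 (top_of_set (X \<delta>)) \<cong> Zsum_group (n * (n - 1) div 2) n (nat (((int n - 2) * (int n - 3)) div 2))"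
proof -
  have Cp: "C > 0" "C^m > 0" for m using C1 by auto
  obtain L where L: "L \<ge> 1" "lip_bound (2 * C) (1 / (2 * C^2)) L"
    using lip_bound_exists [of "2 * C" "1 / (2 * C^2)"] Cp by auto
  define e2 where "e2 = 1 / (4 * C^4)"
  define K where "K = 2 * L * C / e2"
  define e1 where "e1 = 1 / (C^n * K)"
  define K' where "K' = L / e1"
  define e0 where "e0 = e1 / (16 * L * C^n)"
  define \<eta>' where "\<eta>' = e0 / (16 * C^4)"
  define \<eta> where "\<eta> = e0 / (32 * C^5)"
  have pos: "L > 0" "e2 > 0" using L Cp by (auto simp: e2_def)
  have pos2: "K > 0" using pos Cp by (simp add: K_def)
  have pos3: "e1 > 0" using pos2 Cp by (simp add: e1_def)
  have pos4: "K' > 0" "e0 > 0" using pos3 pos Cp by (simp_all add: K'_def e0_def)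
  have pos5: "\<eta> > 0" using pos4 Cp by (simp add: \<eta>_def)
  obtain LA where LA: "LA \<ge> 1" "lip_bound (2 * C) (e0 / (16 * C^2)) LA"
    using lip_bound_exists [of "2 * C" "e0 / (16 * C^2)"] Cp pos4 by auto
  \<comment> \<open>Each entry turns into one of the bounds \<open>d1\<close> to
    \<open>d4\<close>.\<close>
  define \<delta>0 where "\<delta>0 = Min {\<eta>^n, \<eta> / (2 * C * LA), \<eta> / (2 * K' * C), \<eta> * e0 / (L * C)}"
  show ?thesis
  proof (rule that [of \<delta>0])
    show "\<delta>0 > 0" unfolding \<delta>0_def using Cp pos pos4 pos5 LA by auto
    fix \<delta> assume \<delta>: "0 < \<delta>" "\<delta> < \<delta>0"
    then have lt: "\<delta> < \<eta>^n" "\<delta> < \<eta> / (2 * C * LA)" "\<delta> < \<eta> / (2 * K' * C)" "\<delta> < \<eta> * e0 / (L * C)"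
      unfolding \<delta>0_def by auto
    interpret lines_params n a g C L LA \<delta> e0 e1 e2 K K' \<eta> \<eta>'
    proof unfold_locales
      show "2 * C * \<delta> * LA < \<eta>" using lt(2) Cp LA by (simp add: pos_less_divide_eq ac_simps)
      show "2 * K' * \<delta> * C < \<eta>" using lt(3) Cp pos4 by (simp add: pos_less_divide_eq ac_simps)
      show "\<delta> * L * C < \<eta> * e0" using lt(4) Cp pos by (simp add: pos_less_divide_eq ac_simps)
    qed (use n L LA \<delta> lt in \<open>simp_all add: e2_def K_def e1_def K'_def e0_def \<eta>'_def \<eta>_def\<close>)
    show "homology_group 1 (top_of_set (X \<delta>)) \<cong> Zsum_group (n * (n - 1) div 2) n (nat (((int n - 2) * (int n - 3)) div 2))"
      by (rule neck_decomposition.homology_group_iso [OF neck_decomposition n])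
  qed
qed

text \<open>The cone is invariant under positive scaling and meets the sphere of radius
  \<open>R\<close> exactly in the Milnor fiber boundary, so radial projection is a retraction,
  homotopic to the identity along rays.\<close>

lemma (in lines) milnor_fiber_boundary_conic:
  assumes R: "R > 0"
  shows "top_of_set (milnor_fiber_boundary n a R) homotopy_equivalent_space top_of_set (X (1 / R^n))"
proof -
  let ?M = "milnor_fiber_boundary n a R" and ?X = "X (1 / R^n)"
  define r where "r y = (R / norm y) *\<^sub>R y" for y :: "complex^3"
  have prod_scale: "(\<Prod>i<n. \<alpha> i (t *\<^sub>R y)) = of_real (t^n) * (\<Prod>i<n. \<alpha> i y)" for t y
    by (simp add: lform_scaleR prod.distrib)
  have MX: "?M \<subseteq> ?X"
    using R by (auto simp: milnor_fiber_boundary_def milnor_fiber_def X_def)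
  have cone: "t *\<^sub>R y \<in> ?X" if "y \<in> ?X" "t > 0" for t y
    using that by (auto simp: X_def prod_scale power_mult_distrib)
  have XM: "r y \<in> ?M" if y: "y \<in> ?X" for y
  proof -
    have "y \<noteq> 0" "(\<Prod>i<n. \<alpha> i y) = of_real ((norm y / R)^n)"
      using y by (auto simp: X_def power_divide)
    moreover have "(R / norm y)^n * (norm y / R)^n = 1"
      using R \<open>y \<noteq> 0\<close> by (simp flip: power_mult_distrib)
    then have "of_real ((R / norm y)^n) * of_real ((norm y / R)^n) = (1 :: complex)"
      by (metis of_real_1 of_real_mult)
    ultimately have "(\<Prod>i<n. \<alpha> i (r y)) = 1" "norm (r y) = R"
      using R by (simp_all only: r_def prod_scale) auto
    then show ?thesis by (simp add: milnor_fiber_boundary_def milnor_fiber_def)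
  qed
  have rM: "r y = y" if "y \<in> ?M" for y
    using that R by (auto simp: r_def milnor_fiber_boundary_def)
  have X0: "y \<noteq> 0" if "y \<in> ?X" for y using that by (simp add: X_def)
  have rcont: "continuous_on ?X r"
    unfolding r_def by (intro continuous_intros) (use X0 in auto)
  have "homotopic_with_canon (\<lambda>z. True) ?X ?X r id"
  proof (rule homotopic_with_linear [OF rcont continuous_on_id'])
    fix y assume y: "y \<in> ?X"
    show "closed_segment (r y) (id y) \<subseteq> ?X"
    proof
      fix z assume "z \<in> closed_segment (r y) (id y)"
      then obtain u where u: "0 \<le> u" "u \<le> 1" "z = (1 - u) *\<^sub>R r y + u *\<^sub>R y"
        by (auto simp: closed_segment_def)
      then have z: "z = ((1 - u) * (R / norm y) + u) *\<^sub>R y"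
        by (simp add: r_def scaleR_add_left)
      have q: "R / norm y > 0" using R X0 [OF y] by simp
      have "(1 - u) * (R / norm y) + u > 0"
      proof (cases "u = 0")
        case False
        then show ?thesis using u q by (intro add_nonneg_pos mult_nonneg_nonneg) auto
      qed (use q in auto)
      with z cone [OF y] show "z \<in> ?X" by blast
    qed
  qed
  moreover have "homotopic_with_canon (\<lambda>z. True) ?M ?M r id"
    by (rule homotopic_with_equal) (use rM MX rcont in \<open>auto intro: continuous_on_subset\<close>)
  ultimately show ?thesis
    unfolding homotopy_equivalent_space_def
    using MX XM rcont by (intro exI [of _ id] exI [of _ r]) (auto simp: o_def id_def)
qed

theorem theorem4p2:
  fixes n :: nat and a :: "nat \<Rightarrow> complex^3"
  assumes "n \<ge> 1"
    and "central_arrangement n a"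
    and "generic_arrangement n a"
  shows "\<exists>R0. \<forall>R\<ge>R0.
           homology_group 1 (subtopology euclidean (milnor_fiber_boundary n a R))
           \<cong> Zsum_group (n * (n - 1) div 2) n (nat (((int n - 2) * (int n - 3)) div 2))"
proof -
  obtain g C where "lines n a g C" using lines_exists [OF assms(2,3)] .
  then interpret lines n a g C .
  obtain \<delta>0 where \<delta>0: "\<delta>0 > 0" "\<And>\<delta>. 0 < \<delta> \<Longrightarrow> \<delta> < \<delta>0 \<Longrightarrow>
    homology_group 1 (top_of_set (X \<delta>)) \<cong> Zsum_group (n * (n - 1) div 2) n (nat (((int n - 2) * (int n - 3)) div 2))"
    using conic_homology [OF assms(1)] by blast
  show ?thesis
  proof (intro exI allI impI)
    \<comment> \<open>The summand 1 secures R \<ge> 1, so that R^n \<ge> R for positive n; thus 1 /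
      R^n falls below \<delta>0.\<close>
    fix R :: real assume R: "1 / \<delta>0 + 1 \<le> R"
    then have R1: "R > 1 / \<delta>0" "R \<ge> 1" using zero_less_divide_1_iff [of \<delta>0] \<delta>0(1) by linarith+
    have "R \<le> R^n" using R1 assms(1) by (simp add: self_le_power)
    then have "1 / \<delta>0 < R^n" using R1 by linarith
    then have "1 / R^n < \<delta>0" "0 < 1 / R^n" using \<delta>0(1) R1 by (simp_all add: field_simps)
    note iso = \<delta>0(2) [OF this(2,1)]
    have "homology_group 1 (top_of_set (milnor_fiber_boundary n a R)) \<cong> homology_group 1 (top_of_set (X (1 / R^n)))"
      using R1 by (intro homotopy_equivalent_space_imp_isomorphic_homology_groups milnor_fiber_boundary_conic) auto
    then show "homology_group 1 (top_of_set (milnor_fiber_boundary n a R)) \<cong> Zsum_group (n * (n - 1) div 2) n (nat (((int n - 2) * (int n - 3)) div 2))"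
      using iso by (rule iso_trans)
  qed
qed

end
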